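(* Let $0<\beta_*<1/3$, and let $(T_{\alpha_n})_{n\ge 1}$ be an admissible sequence of intermittent maps, i.e. $0\le\alpha_n\le\beta_*$ for all $n\ge1$. Let $Z\sim\mathcal{N}(0,1)$. Let $\mu$ be a Borel probability measure on $[0,1]$ whose density (with respect to Lebesgue measure) belongs to $\mathcal{C}_*(\beta_* )$, and let $f:[0,1]\to\mathbb{R}$ be Lipschitz continuous. Then there is a constant $C>0$, independent of $N$, such that for every integer $N\ge2$ with $\sigma_N>0$, $$d_{\mathscr{W}}(W,\sigma_NZ)\le C\max\{1,\sigma_N^{-2}\}\,N^{\beta_*-\frac12}(\log N)^{\frac1{\beta_*}},$$ where $W=W(N)$.
   Context: For $\alpha\in[0,1)$, $T_\alpha:[0,1]\to[0,1]$ is defined by $T_\alpha(x)=x(1+2^\alpha x^\alpha)$ for $x\in[0,1/2)$ and $T_\alpha(x)=2x-1$ for $x\in[1/2,1]$ (for $\alpha=0$ this is the angle-doubling map). Let $m$ be Lebesgue measure on $[0,1]$. For $\alpha\in(0,1)$, $$\mathcal{C}_*(\alpha)=\{g\in C((0,1])\cap L^1(m): g\ge0,\ g\text{ decreasing},\ x^{\alpha+1}g\text{ increasing},\ g(x)\le 2^\alpha(2+\alpha)x^{-\alpha}m(g)\}$$ (monotonicity non-strict, $m(g)=\int g\,dm$). Write $\mu(g)=\int g\,d\mu$, $T_n=T_{\alpha_n}$, $\widetilde T_n=T_n\circ\cdots\circ T_1$, $\widetilde T_0=\mathrm{id}$, and $$W=W(N)=\frac1{\sqrt N}\sum_{i=0}^{N-1}\bigl(f\circ\widetilde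 T_i-\mu(f\circ\widetilde T_i)\bigr),\qquad \sigma_N^2=\mu(W^2),\ \sigma_N\ge0,$$ with $W$ regarded as a random variable on $([0,1],\mu)$. The Wasserstein distance of two real random variables is $d_{\mathscr{W}}(Y_1,Y_2)=\sup_{h}|\mathbb{E}\,h(Y_1)-\mathbb{E}\,h(Y_2)|$, the supremum being over all $h:\mathbb{R}\to\mathbb{R}$ with $|h(x)-h(y)|\le|x-y|$. *)

theory Defs
  imports "HOL-Probability.Probability"
begin

text \<open>
  Functions on \<open>[0,1]\<close> and on \<open>(0,1]\<close> are total functions on the reals whose values outside
  these sets are irrelevant. In particular the value at \<open>0\<close> of an element of \<open>C_star\<close> does
  not matter, since \<open>{0}\<close> is Borel and a null set.
\<close>

definition unit_lborel :: "real measure" where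
  "unit_lborel = restrict_space lborel {0..1}"

text \<open>Although \<open>0 powr 0 = 0\<close> in HOL, the value at \<open>x = 0\<close> is the intended one, namely \<open>0\<close>.\<close>

definition intermittent_map :: "real \<Rightarrow> real \<Rightarrow> real" where
  "intermittent_map \<alpha> x =
     (if x < 1/2 then x * (1 + 2 powr \<alpha> * x powr \<alpha>) else 2 * x - 1)"

text \<open>The sequence of parameters is indexed from \<open>1\<close>; the entry \<open>\<alpha> 0\<close> is never used.\<close>

primrec intermittent_iter :: "(nat \<Rightarrow> real) \<Rightarrow> nat \<Rightarrow> real \<Rightarrow> real" where
  "intermittent_iter \<alpha> 0 = id"
| "intermittent_iter \<alpha> (Suc n) = intermittent_map (\<alpha> (Suc n)) \<circ> intermittent_iter \<alpha> n"

definition admissible :: "real \<Rightarrow> (nat \<Rightarrow> real) \<Rightarrow> bool" where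
  "admissible \<beta> \<alpha> \<longleftrightarrow> (\<forall>n\<ge>1. 0 \<le> \<alpha> n \<and> \<alpha> n \<le> \<beta>)"

definition C_star :: "real \<Rightarrow> (real \<Rightarrow> real) set" where
  "C_star \<alpha> = {g. continuous_on {0<..1} g \<and> integrable unit_lborel g \<and>
     (\<forall>x\<in>{0<..1}. 0 \<le> g x) \<and>
     antimono_on {0<..1} g \<and>
     mono_on {0<..1} (\<lambda>x. x powr (\<alpha> + 1) * g x) \<and>
     (\<forall>x\<in>{0<..1}. g x \<le> 2 powr \<alpha> * (2 + \<alpha>) * x powr (- \<alpha>) * (\<integral>y. g y \<partial>unit_lborel))}"

definition birkhoff_W ::
  "real measure \<Rightarrow> (nat \<Rightarrow> real) \<Rightarrow> (real \<Rightarrow> real) \<Rightarrow> nat \<Rightarrow> real \<Rightarrow> real" where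
  "birkhoff_W \<mu> \<alpha> f N x =
     1 / sqrt (real N) *
     (\<Sum>i<N. f (intermittent_iter \<alpha> i x) - (\<integral>y. f (intermittent_iter \<alpha> i y) \<partial>\<mu>))"

definition birkhoff_sigma ::
  "real measure \<Rightarrow> (nat \<Rightarrow> real) \<Rightarrow> (real \<Rightarrow> real) \<Rightarrow> nat \<Rightarrow> real" where
  "birkhoff_sigma \<mu> \<alpha> f N = sqrt (\<integral>x. (birkhoff_W \<mu> \<alpha> f N x)\<^sup>2 \<partial>\<mu>)"

text \<open>
  The two random variables may live on different probability spaces. The supremum is taken in
  the extended reals, so that it is meaningful even when it is infinite; the expectations are
  Bochner integrals, hence the definition is intended for random variables with finite first
  moment.
\<close>

definition wasserstein_dist ::
  "'a measure \<Rightarrow> ('a \<Rightarrow> real) \<Rightarrow> 'b measure \<Rightarrow> ('b \<Rightarrow> real) \<Rightarrow> ereal" where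
  "wasserstein_dist M Y\<^sub>1 P Y\<^sub>2 =
     (SUP h\<in>{h :: real \<Rightarrow> real. 1-lipschitz_on UNIV h}.
        ereal \<bar>(\<integral>x. h (Y\<^sub>1 x) \<partial>M) - (\<integral>y. h (Y\<^sub>2 y) \<partial>P)\<bar>)"

end

theory Submission
  imports Defs "HOL-Real_Asymp.Real_Asymp"
begin

text \<open>
  Both inverse branches of the maps preserve the cone of decreasing densities \<open>g\<close> for which
  \<open>x\<^bsup>1 + \<beta>\<^esup> g\<close> is increasing. Removing a constant from two such densities of equal mass and
  truncating them near the neutral fixed point, again and again, shows that they are forgotten at
  rate \<open>n\<^bsup>1 - 1/\<beta>\<^esup>\<close> up to logarithms, with an error function that is uniform over all such
  densities. Conditioning on cylinder sets keeps densities in the cone, and the cylinders of length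
  \<open>n\<close> have length at most of order \<open>n\<^bsup>-1/\<beta>\<^esup>\<close>. Hence the past of the process, approximated through
  cylinders, is nearly independent of the future after a gap.

  The Wasserstein distance is then estimated by Stein's method. Around every time \<open>n\<close> one removes
  windows of length of order \<open>k\<close> from the sum. The quadratic Taylor terms are of order \<open>k\<close> by
  summability of the covariances, and the remaining terms are small by decoupling. The choice
  \<open>k \<sim> N\<^sup>\<beta> (log N)\<^bsup>1/\<beta>\<^esup>\<close> balances the two.
\<close>

text \<open>Subtracting a constant from a density spoils the monotonicity of
  \<open>x powr (1 + \<beta>) * g x\<close>; only the exponent \<open>2 * (1 + \<beta>)\<close>
  survives. The right branch repairs this, the left branch does not, and mass close to 0 keeps using
  the left branch. This is why densities are flattened on \<open>(0, e)\<close> before each block of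
  steps. The mass cut off is of order e^(1 - \<beta>), and a block of q steps admits e of order
  q^(-1/\<beta>), so one truncation costs q^(1 - 1/\<beta>). About log n blocks must fit into n
  steps, which produces the logarithms. In Stein's method the sum stays unnormalized, with variance
  s^2 = N \<sigma>^2, so the Stein solution carries the factors 1/s and 1/s^2. Two windows around n
  are used: the product of the n-th summand with its inner window sum is itself a block of length
  about 4k, and the argument of the derivative has to avoid this block by a further gap. Bounding
  window sums trivially would give k^2 instead of k and a worse power of N. The outcome is an error
  of order k/\<sigma>^2 before the final division by sqrt N.\<close>

section \<open>Intermittent maps and their inverse branches\<close>

text \<open>
  Since \<open>powr\<close> is even in its base, this formula defines an odd bijection of the whole line,
  so that its inverse is a total monotone function.
\<close>

definition left_branch :: "real \<Rightarrow> real \<Rightarrow> real" where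
  "left_branch a y = y * (1 + (2 * y) powr a)"

definition left_inv :: "real \<Rightarrow> real \<Rightarrow> real" where
  "left_inv a = inv (left_branch a)"

text \<open>
  At \<open>y = 0\<close>, \<open>a = 0\<close> this is \<open>1\<close> instead of the derivative \<open>2\<close>, because \<open>0 powr 0 = 0\<close>.
\<close>

definition left_deriv :: "real \<Rightarrow> real \<Rightarrow> real" where
  "left_deriv a y = 1 + (1 + a) * (2 * y) powr a"

lemma left_branch_uminus [simp]: "left_branch a (- y) = - left_branch a y"
  using uminus_powr_eq[of "2 * y" a] by (simp add: left_branch_def)

lemma left_branch_0 [simp]: "left_branch a 0 = 0"
  by (simp add: left_branch_def)

lemma left_branch_half [simp]: "left_branch a (1/2) = 1"
  by (simp add: left_branch_def)

lemma strict_mono_left_branch: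
  assumes "0 \<le> a"
  shows "strict_mono (left_branch a)"
proof (rule strict_monoI)
  have pos: "left_branch a x < left_branch a y" if "0 \<le> x" "x < y" for x y
  proof -
    have "x * (1 + (2 * x) powr a) \<le> x * (1 + (2 * y) powr a)"
      using that assms by (intro mult_left_mono add_left_mono powr_mono2) auto
    also have "\<dots> < y * (1 + (2 * y) powr a)"
      using that by (intro mult_strict_right_mono) (auto intro: add_pos_nonneg)
    finally show ?thesis by (simp add: left_branch_def)
  qed
  fix x y :: real
  assume xy: "x < y"
  show "left_branch a x < left_branch a y"
  proof (cases "0 \<le> x")
    case True
    then show ?thesis using pos xy by blast
  next
    case neg: False
    show ?thesis
    proof (cases "y \<le> 0")
      case True
      then show ?thesis using pos[of "-y" "-x"] xy by simp
    next
      case False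
      then have "left_branch a 0 < left_branch a y" using pos[of 0 y] by simp
      moreover have "left_branch a x < left_branch a 0" using pos[of 0 "-x"] neg by simp
      ultimately show ?thesis by simp
    qed
  qed
qed

text \<open>The exponent 0 is treated separately: since \<open>0 powr 0 = 0\<close>, the factor
  \<open>(2 * y) powr 0\<close> jumps at 0, and only its product with \<open>y\<close> is
  continuous. For positive exponents the absolute value makes the base nonnegative, as the
  continuity rule for \<open>powr\<close> requires.\<close>

lemma continuous_left_branch:
  assumes "0 \<le> a"
  shows "continuous_on UNIV (left_branch a)"
proof (cases "a = 0")
  case True
  then have "left_branch a = (\<lambda>y. 2 * y)"
    by (auto simp: left_branch_def fun_eq_iff)
  then show ?thesis by (auto intro: continuous_intros)
next
  case False
  have "left_branch a = (\<lambda>y. y * (1 + \<bar>2 * y\<bar> powr a))"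
    using uminus_powr_eq[of "2 * y" a for y] by (auto simp: left_branch_def fun_eq_iff abs_if)
  moreover have "continuous_on UNIV (\<lambda>y::real. \<bar>2 * y\<bar> powr a)"
    using assms False by (intro continuous_on_powr' continuous_intros) auto
  then have "continuous_on UNIV (\<lambda>y. y * (1 + \<bar>2 * y\<bar> powr a))"
    by (intro continuous_on_mult continuous_on_add continuous_on_id continuous_on_const)
  ultimately show ?thesis by simp
qed

lemma left_branch_ge: "0 \<le> y \<Longrightarrow> y \<le> left_branch a y"
  by (simp add: left_branch_def mult_le_cancel_left1)

lemma surj_left_branch:
  assumes "0 \<le> a"
  shows "surj (left_branch a)"
proof -
  have "\<exists>y. left_branch a y = x" for x
  proof -
    have "left_branch a (- \<bar>x\<bar>) \<le> x" "x \<le> left_branch a \<bar>x\<bar>"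
      using left_branch_ge[of "\<bar>x\<bar>" a] by auto
    then show ?thesis
      using IVT'[of "left_branch a" "- \<bar>x\<bar>" x "\<bar>x\<bar>"] continuous_left_branch[OF assms]
      by (auto intro: continuous_on_subset)
  qed
  then show ?thesis by (metis surj_def)
qed

lemma left_branch_inv [simp]: "0 \<le> a \<Longrightarrow> left_branch a (left_inv a x) = x"
  unfolding left_inv_def by (rule surj_f_inv_f[OF surj_left_branch])

lemma left_inv_branch [simp]: "0 \<le> a \<Longrightarrow> left_inv a (left_branch a y) = y"
  unfolding left_inv_def
  by (rule inv_f_f) (rule strict_mono_imp_inj_on[OF strict_mono_left_branch])

lemma left_inv_le_iff: "0 \<le> a \<Longrightarrow> left_inv a x \<le> left_inv a y \<longleftrightarrow> x \<le> y"
  using strict_mono_less_eq[OF strict_mono_left_branch[of a], of "left_inv a x" "left_inv a y"]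
  by simp

lemma left_inv_less_iff: "0 \<le> a \<Longrightarrow> left_inv a x < left_inv a y \<longleftrightarrow> x < y"
  using strict_mono_less[OF strict_mono_left_branch[of a], of "left_inv a x" "left_inv a y"]
  by simp

lemma left_inv_0 [simp]: "0 \<le> a \<Longrightarrow> left_inv a 0 = 0"
  using left_inv_branch[of a 0] by simp

lemma left_inv_1 [simp]: "0 \<le> a \<Longrightarrow> left_inv a 1 = 1/2"
  using left_inv_branch[of a "1/2"] by simp

lemma left_inv_pos_iff [simp]: "0 \<le> a \<Longrightarrow> 0 < left_inv a x \<longleftrightarrow> 0 < x"
  using left_inv_less_iff[of a 0 x] by simp

lemma left_inv_nonneg_iff [simp]: "0 \<le> a \<Longrightarrow> 0 \<le> left_inv a x \<longleftrightarrow> 0 \<le> x"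
  using left_inv_le_iff[of a 0 x] by simp

lemma left_inv_less_half_iff [simp]: "0 \<le> a \<Longrightarrow> left_inv a x < 1/2 \<longleftrightarrow> x < 1"
  using left_inv_less_iff[of a x 1] by simp

lemma borel_measurable_left_inv [measurable]:
  assumes "0 \<le> a"
  shows "left_inv a \<in> borel_measurable borel"
  by (rule borel_measurable_mono) (auto simp: mono_def left_inv_le_iff assms)

lemma borel_measurable_left_deriv [measurable]: "left_deriv a \<in> borel_measurable borel"
  unfolding left_deriv_def by measurable

lemma left_deriv_ge_1: "0 \<le> a \<Longrightarrow> 1 \<le> left_deriv a y"
  by (simp add: left_deriv_def)

lemma left_deriv_pos: "0 \<le> a \<Longrightarrow> 0 < left_deriv a y"
  using left_deriv_ge_1[of a y] by simp

lemma left_deriv_mono: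
  assumes "0 \<le> a" "0 \<le> x" "x \<le> y"
  shows "left_deriv a x \<le> left_deriv a y"
  using assms by (auto simp: left_deriv_def intro!: mult_left_mono powr_mono2)

lemma left_branch_eq_intermittent_map:
  assumes "0 \<le> y" "y < 1/2"
  shows "intermittent_map a y = left_branch a y"
  using assms unfolding intermittent_map_def left_branch_def powr_mult by simp

lemma has_derivative_left_branch:
  assumes "0 < y"
  shows "(left_branch a has_real_derivative left_deriv a y) (at y)"
proof -
  have "((\<lambda>y. (2 * y) powr a) has_real_derivative a * (2 * y) powr (a - 1) * 2) (at y)"
  proof -
    have "((\<lambda>y. 2 * y) has_real_derivative 2) (at y)" by (auto intro!: derivative_eq_intros)
    from DERIV_fun_powr[OF this] show ?thesis using assms by simp
  qed
  then have "((\<lambda>y. y * (1 + (2 * y) powr a)) has_real_derivative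
      (1 * (1 + (2 * y) powr a) + (0 + a * (2 * y) powr (a - 1) * 2) * y)) (at y)"
    by (intro DERIV_mult DERIV_ident DERIV_add DERIV_const)
  moreover have "(0 + a * (2 * y) powr (a - 1) * 2) * y = a * ((2 * y) powr (a - 1) * (2 * y))"
    by simp
  moreover have "(2 * y) powr (a - 1) * (2 * y) = (2 * y) powr a"
    using assms powr_add[of "2 * y" "a - 1" 1] by simp
  ultimately have "((\<lambda>y. y * (1 + (2 * y) powr a)) has_real_derivative
      1 * (1 + (2 * y) powr a) + a * (2 * y) powr a) (at y)"
    by (simp only:)
  then show ?thesis
    unfolding left_branch_def[abs_def] left_deriv_def by (simp add: ring_distribs add.assoc)
qed

lemma has_derivative_left_inv:
  assumes a: "0 \<le> a" and x: "0 < x"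
  shows "(left_inv a has_real_derivative inverse (left_deriv a (left_inv a x))) (at x)"
proof (rule DERIV_inverse_function[where f = "left_branch a" and a = 0 and b = "x + 1"])
  have "isCont (left_inv a) (left_branch a (left_inv a x))"
  proof (rule isCont_inverse_function2[of "left_inv a x - 1" "left_inv a x" "left_inv a x + 1" "left_inv a" "left_branch a"])
    show "left_inv a x - 1 < left_inv a x" by linarith
    show "left_inv a x < left_inv a x + 1" by linarith
    show "left_inv a (left_branch a z) = z" for z using a by simp
    show "isCont (left_branch a) z" for z
      using continuous_left_branch[OF a] by (simp only: continuous_on_eq_continuous_at open_UNIV) simp
  qed
  then show "isCont (left_inv a) x" using a by simp
  show "(left_branch a has_real_derivative left_deriv a (left_inv a x)) (at (left_inv a x))"
    using a x by (intro has_derivative_left_branch) simp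
  show "left_deriv a (left_inv a x) \<noteq> 0"
    using left_deriv_pos[OF a, of "left_inv a x"] by simp
qed (use a x in auto)

text \<open>Dropping the end points changes no integral; in return, a bound for all
  \<open>0 < x < 1\<close> holds everywhere on this space, without almost-everywhere
  quantifiers.\<close>

definition uniform :: "real measure" where
  "uniform = restrict_space lborel {0<..<1}"

lemma space_uniform [simp]: "space uniform = {0<..<1}"
  by (simp add: uniform_def space_restrict_space)

lemma borel_measurable_uniform: "h \<in> borel_measurable borel \<Longrightarrow> h \<in> borel_measurable uniform"
  unfolding uniform_def by (rule measurable_restrict_space1) simp

lemma prob_space_uniform: "prob_space uniform"
  unfolding uniform_def by (rule prob_spaceI) (simp add: space_restrict_space emeasure_restrict_space)

lemma integral_uniform: "integral\<^sup>L uniform h = (LBINT x:{0<..<1}. h x)"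
  for h :: "real \<Rightarrow> real"
  unfolding uniform_def set_lebesgue_integral_def by (subst integral_restrict_space) auto

lemma integrable_uniform: "integrable uniform h \<longleftrightarrow> set_integrable lborel {0<..<1} h"
  for h :: "real \<Rightarrow> real"
  unfolding uniform_def set_integrable_def by (subst integrable_restrict_space) auto

text \<open>The substitution rule used here speaks about absolute integrability over
  \<open>lebesgue\<close>. For Borel functions, integrability and integrals over
  \<open>lebesgue\<close> and \<open>lborel\<close> agree, which is \<open>conv\<close>; the
  absolute value of the derivative disappears because \<open>g'\<close> is nonnegative on
  \<open>S\<close>.\<close>

lemma lborel_change_of_variables:
  fixes h :: "real \<Rightarrow> real"
  assumes S: "S \<in> sets borel" and gS: "g ` S \<in> sets borel"
    and der: "\<And>x. x \<in> S \<Longrightarrow> (g has_field_derivative g' x) (at x)"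
    and inj: "inj_on g S" and nonneg: "\<And>x. x \<in> S \<Longrightarrow> 0 \<le> g' x"
    and [measurable]: "h \<in> borel_measurable borel" "g \<in> borel_measurable borel" "g' \<in> borel_measurable borel"
    and int: "set_integrable lborel (g ` S) h"
  shows "set_integrable lborel S (\<lambda>x. g' x * h (g x))"
    and "(LBINT x:S. g' x * h (g x)) = (LBINT x:g ` S. h x)"
proof -
  have [measurable]: "S \<in> sets borel" "g ` S \<in> sets borel" by fact+
  have conv: "set_integrable lebesgue A k \<longleftrightarrow> set_integrable lborel A k"
    "(LINT x:A|lebesgue. k x) = (LBINT x:A. k x)"
    if "A \<in> sets borel" "k \<in> borel_measurable borel" for A and k :: "real \<Rightarrow> real"
    using that unfolding set_integrable_def set_lebesgue_integral_def
    by (auto intro!: integrable_completion integral_completion)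
  have ind: "(\<lambda>x. indicator S x *\<^sub>R (\<bar>g' x\<bar> * h (g x))) = (\<lambda>x. indicator S x *\<^sub>R (g' x * h (g x)))"
    using nonneg by (auto simp: fun_eq_iff indicator_def)
  have cong: "set_integrable lebesgue S (\<lambda>x. \<bar>g' x\<bar> * h (g x)) \<longleftrightarrow> set_integrable lebesgue S (\<lambda>x. g' x * h (g x))"
    "(LINT x:S|lebesgue. \<bar>g' x\<bar> * h (g x)) = (LINT x:S|lebesgue. g' x * h (g x))"
    unfolding set_integrable_def set_lebesgue_integral_def ind by auto
  have hint: "h absolutely_integrable_on g ` S"
    using int conv[OF gS] by auto
  have S': "S \<in> sets lebesgue" using S by auto
  have *: "(\<lambda>x. \<bar>g' x\<bar> * h (g x)) absolutely_integrable_on S \<and>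
      integral S (\<lambda>x. \<bar>g' x\<bar> * h (g x)) = integral (g ` S) h"
    using has_absolute_integral_change_of_variables_1'[of S g g' h "integral (g ` S) h", OF S' _ inj]
      der hint by (auto intro: DERIV_subset has_field_derivative_at_within)
  have meas: "(\<lambda>x. g' x * h (g x)) \<in> borel_measurable borel" by measurable
  show "set_integrable lborel S (\<lambda>x. g' x * h (g x))"
    using * cong(1) conv(1)[OF S meas] by simp
  have "(LBINT x:S. g' x * h (g x)) = (LINT x:S|lebesgue. \<bar>g' x\<bar> * h (g x))"
    using cong(2) conv(2)[OF S meas] by simp
  also have "\<dots> = integral S (\<lambda>x. \<bar>g' x\<bar> * h (g x))"
    using * by (intro set_lebesgue_integral_eq_integral(2)) auto
  also have "\<dots> = integral (g ` S) h" using * by simp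
  also have "\<dots> = (LINT x:g ` S|lebesgue. h x)"
    using hint by (intro set_lebesgue_integral_eq_integral(2)[symmetric]) auto
  also have "\<dots> = (LBINT x:g ` S. h x)"
    using conv(2)[OF gS] by simp
  finally show "(LBINT x:S. g' x * h (g x)) = (LBINT x:g ` S. h x)" .
qed

section \<open>Transfer operators\<close>

text \<open>The two summands of the transfer (Perron-Frobenius) operator get their own names because
  they act differently on densities: the right branch improves exponents and spreads mass, the left
  branch keeps mass near the neutral fixed point.\<close>

definition left_part :: "real \<Rightarrow> (real \<Rightarrow> real) \<Rightarrow> real \<Rightarrow> real" where
  "left_part a g x = g (left_inv a x) / left_deriv a (left_inv a x)"

definition right_part :: "(real \<Rightarrow> real) \<Rightarrow> real \<Rightarrow> real" where
  "right_part g x = g ((1 + x) / 2) / 2"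

definition transfer :: "real \<Rightarrow> (real \<Rightarrow> real) \<Rightarrow> real \<Rightarrow> real" where
  "transfer a g x = left_part a g x + right_part g x"

definition shift :: "nat \<Rightarrow> (nat \<Rightarrow> real) \<Rightarrow> nat \<Rightarrow> real" where
  "shift k \<alpha> = (\<lambda>i. \<alpha> (i + k))"

text \<open>The first map is peeled off, whereas \<open>intermittent_iter\<close> appends the last
  one. An induction then applies one transfer operator to the density and continues with the shifted
  sequence, so inductions are generalized over \<open>\<alpha>\<close>.\<close>

primrec transfer_iter :: "nat \<Rightarrow> (nat \<Rightarrow> real) \<Rightarrow> (real \<Rightarrow> real) \<Rightarrow> real \<Rightarrow> real" where
  "transfer_iter 0 \<alpha> g = g"
| "transfer_iter (Suc n) \<alpha> g = transfer_iter n (shift 1 \<alpha>) (transfer (\<alpha> 1) g)"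

lemma shift_0 [simp]: "shift 0 \<alpha> = \<alpha>"
  by (simp add: shift_def)

lemma shift_shift [simp]: "shift i (shift j \<alpha>) = shift (i + j) \<alpha>"
  by (simp add: shift_def add.assoc)

lemma admissible_shift: "admissible \<beta> \<alpha> \<Longrightarrow> admissible \<beta> (shift k \<alpha>)"
  by (auto simp: admissible_def shift_def)

lemma admissible_1: "admissible \<beta> \<alpha> \<Longrightarrow> 0 \<le> \<alpha> 1 \<and> \<alpha> 1 \<le> \<beta>"
  by (auto simp: admissible_def)

lemma intermittent_iter_Suc_shift:
  "intermittent_iter \<alpha> (Suc n) x = intermittent_iter (shift 1 \<alpha>) n (intermittent_map (\<alpha> 1) x)"
  by (induction n arbitrary: x) (simp_all add: shift_def)

lemma intermittent_iter_add:
  "intermittent_iter \<alpha> (k + n) x = intermittent_iter (shift k \<alpha>) n (intermittent_iter \<alpha> k x)"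
  by (induction n arbitrary: x) (simp_all add: shift_def add.commute)

lemma transfer_iter_add:
  "transfer_iter (m + n) \<alpha> g = transfer_iter n (shift m \<alpha>) (transfer_iter m \<alpha> g)"
  by (induction m arbitrary: \<alpha> g) simp_all

lemma measurable_intermittent_map [measurable]: "intermittent_map a \<in> borel_measurable borel"
  unfolding intermittent_map_def by measurable

lemma measurable_intermittent_iter [measurable]: "intermittent_iter \<alpha> n \<in> borel_measurable borel"
  by (induction n) (auto simp: comp_def)

lemma measurable_transfer [measurable]:
  assumes [measurable]: "g \<in> borel_measurable borel" and a: "0 \<le> a"
  shows "left_part a g \<in> borel_measurable borel" "right_part g \<in> borel_measurable borel"
    "transfer a g \<in> borel_measurable borel"
proof -
  note [measurable] = borel_measurable_left_inv[OF a]
  show "left_part a g \<in> borel_measurable borel" "right_part g \<in> borel_measurable borel"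
    unfolding left_part_def[abs_def] right_part_def[abs_def] by measurable
  then show "transfer a g \<in> borel_measurable borel"
    unfolding transfer_def[abs_def] by measurable
qed

lemma measurable_transfer_iter:
  "g \<in> borel_measurable borel \<Longrightarrow> admissible \<beta> \<alpha> \<Longrightarrow> transfer_iter n \<alpha> g \<in> borel_measurable borel"
proof (induction n arbitrary: \<alpha> g)
  case (Suc n)
  then show ?case
    using measurable_transfer(3)[of g "\<alpha> 1"] admissible_1[of \<beta> \<alpha>] admissible_shift[of \<beta> \<alpha> 1]
    by simp
qed simp

lemma left_inv_unit:
  assumes "0 \<le> a" "0 < x" "x < 1"
  shows "0 < left_inv a x" "left_inv a x < 1/2" "left_inv a x < 1"
proof -
  show "0 < left_inv a x" using assms by simp
  show "left_inv a x < 1/2" unfolding left_inv_less_half_iff[OF assms(1)] by (rule assms)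
  then show "left_inv a x < 1" by linarith
qed

lemma intermittent_map_left_inv:
  assumes "0 \<le> a" "0 < x" "x < 1"
  shows "intermittent_map a (left_inv a x) = x"
  using left_branch_eq_intermittent_map[of "left_inv a x" a] left_inv_unit[OF assms] assms
  by simp

lemma intermittent_map_right: "0 \<le> x \<Longrightarrow> intermittent_map a ((1 + x) / 2) = x"
  by (simp add: intermittent_map_def field_simps)

lemma transfer_cong:
  assumes "0 \<le> a" "\<And>x. 0 < x \<Longrightarrow> x < 1 \<Longrightarrow> g x = h x" "0 < x" "x < 1"
  shows "transfer a g x = transfer a h x"
  using assms left_inv_unit[of a x] by (simp add: transfer_def left_part_def right_part_def)

lemma transfer_iter_cong:
  assumes "admissible \<beta> \<alpha>" "\<And>x. 0 < x \<Longrightarrow> x < 1 \<Longrightarrow> g x = h x" "0 < x" "x < 1"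
  shows "transfer_iter n \<alpha> g x = transfer_iter n \<alpha> h x"
  using assms
proof (induction n arbitrary: \<alpha> g h x)
  case (Suc n)
  have "transfer_iter n (shift 1 \<alpha>) (transfer (\<alpha> 1) g) x = transfer_iter n (shift 1 \<alpha>) (transfer (\<alpha> 1) h) x"
    using Suc.prems admissible_1[of \<beta> \<alpha>]
    by (intro Suc.IH admissible_shift transfer_cong) auto
  then show ?case by simp
qed simp

lemma transfer_mono:
  assumes "0 \<le> a" "\<And>x. 0 < x \<Longrightarrow> x < 1 \<Longrightarrow> g x \<le> h x" "0 < x" "x < 1"
  shows "transfer a g x \<le> transfer a h x"
  using assms left_inv_unit[of a x] left_deriv_pos[of a "left_inv a x"]
  unfolding transfer_def left_part_def right_part_def
  by (intro add_mono divide_right_mono) auto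

lemma transfer_iter_mono:
  assumes "admissible \<beta> \<alpha>" "\<And>x. 0 < x \<Longrightarrow> x < 1 \<Longrightarrow> g x \<le> h x" "0 < x" "x < 1"
  shows "transfer_iter n \<alpha> g x \<le> transfer_iter n \<alpha> h x"
  using assms
proof (induction n arbitrary: \<alpha> g h x)
  case (Suc n)
  have "transfer_iter n (shift 1 \<alpha>) (transfer (\<alpha> 1) g) x \<le> transfer_iter n (shift 1 \<alpha>) (transfer (\<alpha> 1) h) x"
    using Suc.prems admissible_1[of \<beta> \<alpha>]
    by (intro Suc.IH admissible_shift transfer_mono) auto
  then show ?case by simp
qed simp

lemma transfer_linear:
  "transfer a (\<lambda>x. c * g x + d * h x) = (\<lambda>x. c * transfer a g x + d * transfer a h x)"
  by (simp add: fun_eq_iff transfer_def left_part_def right_part_def add_divide_distrib algebra_simps)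

lemma transfer_iter_linear:
  "transfer_iter n \<alpha> (\<lambda>x. c * g x + d * h x) = (\<lambda>x. c * transfer_iter n \<alpha> g x + d * transfer_iter n \<alpha> h x)"
  by (induction n arbitrary: \<alpha> g h) (simp_all only: transfer_iter.simps transfer_linear)

lemma transfer_iter_add_fun:
  "transfer_iter n \<alpha> (\<lambda>x. g x + h x) x = transfer_iter n \<alpha> g x + transfer_iter n \<alpha> h x"
  using transfer_iter_linear[of n \<alpha> 1 g 1 h] by simp

lemma transfer_iter_diff:
  "transfer_iter n \<alpha> (\<lambda>x. g x - h x) x = transfer_iter n \<alpha> g x - transfer_iter n \<alpha> h x"
  using transfer_iter_linear[of n \<alpha> 1 g "-1" h] by simp

lemma transfer_iter_cmult:
  "transfer_iter n \<alpha> (\<lambda>x. c * g x) x = c * transfer_iter n \<alpha> g x"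
  using transfer_iter_linear[of n \<alpha> c g 0 g] by simp

lemma transfer_iter_zero [simp]: "transfer_iter n \<alpha> (\<lambda>x. 0) x = 0"
  using transfer_iter_cmult[of n \<alpha> 0 "\<lambda>x. 0" x] by simp

lemma transfer_iter_nonneg:
  assumes "admissible \<beta> \<alpha>" "\<And>x. 0 < x \<Longrightarrow> x < 1 \<Longrightarrow> 0 \<le> g x" "0 < x" "x < 1"
  shows "0 \<le> transfer_iter n \<alpha> g x"
  using transfer_iter_mono[OF assms(1), of "\<lambda>_. 0" g x n] assms by simp

text \<open>Only points \<open>x\<close> with \<open>intermittent_iter \<alpha> n x = y\<close>
  contribute to the value at \<open>y\<close>, so the second argument can be frozen at
  \<open>y\<close>. For products this is the pull-out property of transfer operators; the joint form
  is what decoupling needs, where \<open>G\<close> is a general function of the past and the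
  present.\<close>

lemma transfer_iter_two_variable:
  assumes "admissible \<beta> \<alpha>" "0 < y" "y < 1"
  shows "transfer_iter n \<alpha> (\<lambda>x. G x (intermittent_iter \<alpha> n x)) y = transfer_iter n \<alpha> (\<lambda>x. G x y) y"
  using assms
proof (induction n arbitrary: \<alpha> G y)
  case (Suc n)
  let ?a = "\<alpha> 1" and ?s = "shift 1 \<alpha>"
  have a: "0 \<le> ?a" using admissible_1[OF Suc.prems(1)] by simp
  have "transfer_iter (Suc n) \<alpha> (\<lambda>x. G x (intermittent_iter \<alpha> (Suc n) x)) y
      = transfer_iter n ?s (transfer ?a (\<lambda>x. G x (intermittent_iter ?s n (intermittent_map ?a x)))) y"
    by (simp only: transfer_iter.simps intermittent_iter_Suc_shift)
  also have "\<dots> = transfer_iter n ?s (\<lambda>z. transfer ?a (\<lambda>x. G x (intermittent_iter ?s n z)) z) y"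
  proof (rule transfer_iter_cong[OF admissible_shift[OF Suc.prems(1)] _ Suc.prems(2,3)])
    fix z :: real assume z: "0 < z" "z < 1"
    show "transfer ?a (\<lambda>x. G x (intermittent_iter ?s n (intermittent_map ?a x))) z
        = transfer ?a (\<lambda>x. G x (intermittent_iter ?s n z)) z"
      using intermittent_map_left_inv[OF a z] intermittent_map_right[of z ?a] z
      by (simp only: transfer_def left_part_def right_part_def)
  qed
  also have "\<dots> = transfer_iter n ?s (\<lambda>z. transfer ?a (\<lambda>x. G x y) z) y"
    by (rule Suc.IH[OF admissible_shift[OF Suc.prems(1)] Suc.prems(2,3), of 1 "\<lambda>z w. transfer ?a (\<lambda>x. G x w) z"])
  finally show ?case by simp
qed simp

section \<open>Balance of mass for the two branches\<close>

lemma left_inv_less_half_iff' [simp]: "0 \<le> a \<Longrightarrow> left_inv a x * 2 < 1 \<longleftrightarrow> x < 1"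
  using left_inv_less_half_iff[of a x] by linarith

lemma left_inv_image:
  assumes a: "0 \<le> a"
  shows "left_inv a ` {z<..<1} = {left_inv a z<..<1/2}"
proof safe
  fix y :: real assume y: "y \<in> {left_inv a z<..<1/2}"
  have "left_branch a (left_inv a z) < left_branch a y" "left_branch a y < left_branch a (1/2)"
    unfolding strict_mono_less[OF strict_mono_left_branch[OF a]] using y by auto
  then have "left_branch a y \<in> {z<..<1}" using a by simp
  then show "y \<in> left_inv a ` {z<..<1}"
    using a by (intro image_eqI[of _ _ "left_branch a y"]) auto
qed (use a left_inv_less_iff[OF a] in auto)

text \<open>The lower limit \<open>z\<close> is arbitrary because \<open>transfer_iter_ge\<close>
  follows the mass beyond a left end point through the left branch; \<open>z = 0\<close> gives
  conservation of mass.\<close>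

lemma integral_left_part:
  assumes a: "0 \<le> a" and z: "0 \<le> z" and g[measurable]: "g \<in> borel_measurable borel"
    and int: "set_integrable lborel {left_inv a z<..<1/2} g"
  shows "set_integrable lborel {z<..<1} (left_part a g)"
    and "(LBINT x:{z<..<1}. left_part a g x) = (LBINT x:{left_inv a z<..<1/2}. g x)"
proof -
  note [measurable] = borel_measurable_left_inv[OF a]
  have eq: "left_part a g = (\<lambda>x. inverse (left_deriv a (left_inv a x)) * g (left_inv a x))"
    by (simp add: left_part_def fun_eq_iff divide_inverse)
  have im: "left_inv a ` {z<..<1} \<in> sets borel" using left_inv_image[OF a] by simp
  have inj: "inj_on (left_inv a) {z<..<1}"
    by (rule inj_onI) (metis left_branch_inv[OF a])
  have der: "(left_inv a has_real_derivative inverse (left_deriv a (left_inv a x))) (at x)" if "x \<in> {z<..<1}" for x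
    using has_derivative_left_inv[OF a, of x] that z by simp
  have nn: "0 \<le> inverse (left_deriv a (left_inv a x))" for x
    using left_deriv_pos[OF a, of "left_inv a x"] by simp
  have int': "set_integrable lborel (left_inv a ` {z<..<1}) g"
    using int left_inv_image[OF a] by simp
  have m: "(\<lambda>x. inverse (left_deriv a (left_inv a x))) \<in> borel_measurable borel" by measurable
  note * = lborel_change_of_variables[OF _ im der inj nn g borel_measurable_left_inv[OF a] m int']
  show "set_integrable lborel {z<..<1} (left_part a g)"
    unfolding eq using *(1) by simp
  show "(LBINT x:{z<..<1}. left_part a g x) = (LBINT x:{left_inv a z<..<1/2}. g x)"
    unfolding eq using *(2) left_inv_image[OF a] by simp
qed

lemma integral_right_part:
  assumes g[measurable]: "g \<in> borel_measurable borel"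
    and int: "set_integrable lborel {1/2<..<1} g"
  shows "set_integrable lborel {0<..<1} (right_part g)"
    and "(LBINT x:{0<..<1}. right_part g x) = (LBINT x:{1/2<..<1}. g x)"
proof -
  have eq: "right_part g = (\<lambda>x. (1/2) * g ((1 + x) / 2))"
    by (auto simp: right_part_def fun_eq_iff)
  have im: "(\<lambda>x. (1 + x) / 2) ` {0<..<1::real} = {1/2<..<1}"
  proof safe
    fix y :: real assume "y \<in> {1/2<..<1}"
    then show "y \<in> (\<lambda>x. (1 + x) / 2) ` {0<..<1::real}"
      by (intro image_eqI[of _ _ "2 * y - 1"]) auto
  qed auto
  have der: "((\<lambda>x. (1 + x) / 2) has_real_derivative 1/2) (at x)" for x :: real
    by (auto intro!: derivative_eq_intros)
  have im': "(\<lambda>x. (1 + x) / 2) ` {0<..<1::real} \<in> sets borel" unfolding im by simp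
  have int': "set_integrable lborel ((\<lambda>x. (1 + x) / 2) ` {0<..<1}) g" unfolding im by (rule int)
  have inj: "inj_on (\<lambda>x. (1 + x) / 2) {0<..<1::real}" by (auto simp: inj_on_def)
  have m: "(\<lambda>x::real. (1 + x) / 2) \<in> borel_measurable borel" by measurable
  note * = lborel_change_of_variables[of "{0<..<1}" "\<lambda>x. (1 + x) / 2" "\<lambda>_. 1/2", OF _ im' der inj _ g m _ int']
  show "set_integrable lborel {0<..<1} (right_part g)"
    unfolding eq using *(1) by simp
  show "(LBINT x:{0<..<1}. right_part g x) = (LBINT x:{1/2<..<1}. g x)"
    unfolding eq using *(2) im by simp
qed

lemma set_integral_split:
  fixes g :: "real \<Rightarrow> real"
  assumes g[measurable]: "g \<in> borel_measurable borel" and i: "set_integrable lborel {a<..<b} g"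
    and z: "a \<le> z" "z \<le> b"
  shows "set_integrable lborel {a<..<z} g" "set_integrable lborel {z<..<b} g"
    "(LBINT x:{a<..<b}. g x) = (LBINT x:{a<..<z}. g x) + (LBINT x:{z<..<b}. g x)"
proof -
  show 1: "set_integrable lborel {a<..<z} g" and 2: "set_integrable lborel {z<..<b} g"
    using z by (auto intro!: set_integrable_subset[OF i])
  have "(LBINT x:{a<..<b}. g x) = (LBINT x:({a<..<z} \<union> {z<..<b}). g x)"
    unfolding set_lebesgue_integral_def
  proof (rule integral_cong_AE)
    show "AE x in lborel. indicator {a<..<b} x *\<^sub>R g x = indicator ({a<..<z} \<union> {z<..<b}) x *\<^sub>R g x"
      using AE_lborel_singleton[of z] by eventually_elim (use z in \<open>auto simp: indicator_def\<close>)
  qed auto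
  also have "\<dots> = (LBINT x:{a<..<z}. g x) + (LBINT x:{z<..<b}. g x)"
    by (rule set_integral_Un[OF _ 1 2]) auto
  finally show "(LBINT x:{a<..<b}. g x) = (LBINT x:{a<..<z}. g x) + (LBINT x:{z<..<b}. g x)" .
qed

lemma integral_uniform_split:
  fixes g :: "real \<Rightarrow> real"
  assumes g: "g \<in> borel_measurable borel" and int: "integrable uniform g"
    and z: "0 \<le> z" "z \<le> 1"
  shows "set_integrable lborel {0<..<z} g" "set_integrable lborel {z<..<1} g"
    "integral\<^sup>L uniform g = (LBINT x:{0<..<z}. g x) + (LBINT x:{z<..<1}. g x)"
  using set_integral_split[OF g _ z] int unfolding integrable_uniform integral_uniform by auto

lemma integral_transfer:
  assumes a: "0 \<le> a" and g[measurable]: "g \<in> borel_measurable borel" and int: "integrable uniform g"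
  shows "integrable uniform (transfer a g)" "integral\<^sup>L uniform (transfer a g) = integral\<^sup>L uniform g"
proof -
  note s = integral_uniform_split[OF g int, of "1/2", simplified]
  have "set_integrable lborel {left_inv a 0<..<1/2} g" using s(1) a by simp
  note l = integral_left_part[OF a order_refl g this, unfolded left_inv_0[OF a]] and r = integral_right_part[OF g s(2)]
  show "integrable uniform (transfer a g)"
    unfolding transfer_def[abs_def] integrable_uniform by (rule set_integral_add(1)[OF l(1) r(1)])
  have "integral\<^sup>L uniform (transfer a g) = (LBINT x:{0<..<1}. left_part a g x + right_part g x)"
    unfolding transfer_def[abs_def] integral_uniform ..
  also have "\<dots> = integral\<^sup>L uniform g"
    unfolding set_integral_add(2)[OF l(1) r(1)] l(2) r(2) s(3) ..
  finally show "integral\<^sup>L uniform (transfer a g) = integral\<^sup>L uniform g" .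
qed

lemma integral_transfer_iter:
  assumes "admissible \<beta> \<alpha>" "g \<in> borel_measurable borel" "integrable uniform g"
  shows "integrable uniform (transfer_iter n \<alpha> g)"
    "integral\<^sup>L uniform (transfer_iter n \<alpha> g) = integral\<^sup>L uniform g"
proof -
  have "integrable uniform (transfer_iter n \<alpha> g) \<and>
    integral\<^sup>L uniform (transfer_iter n \<alpha> g) = integral\<^sup>L uniform g"
    using assms
  proof (induction n arbitrary: \<alpha> g)
    case (Suc n)
    have a: "0 \<le> \<alpha> 1" using admissible_1[OF Suc.prems(1)] by simp
    note t = integral_transfer[OF a Suc.prems(2,3)]
    show ?case
      using Suc.IH[OF admissible_shift[OF Suc.prems(1)] measurable_transfer(3)[OF Suc.prems(2) a] t(1)] t(2)
      by simp
  qed simp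
  then show "integrable uniform (transfer_iter n \<alpha> g)"
    "integral\<^sup>L uniform (transfer_iter n \<alpha> g) = integral\<^sup>L uniform g" by auto
qed

section \<open>Cones of densities\<close>

text \<open>
  Pointwise conditions on densities refer to the open interval: both inverse branches map it into
  itself and avoid the discontinuity at \<open>1/2\<close>.
\<close>

definition decreasing :: "(real \<Rightarrow> real) \<Rightarrow> bool" where
  "decreasing g \<longleftrightarrow> (\<forall>x y. 0 < x \<longrightarrow> x \<le> y \<longrightarrow> y < 1 \<longrightarrow> g y \<le> g x)"

text \<open>Both parameters move during the proof: subtracting a constant doubles \<open>p\<close>,
  and \<open>s < 1\<close> records that a good exponent is known so far only near the neutral fixed
  point. The class of the theorem corresponds to \<open>p = 1 + \<beta>\<close> and
  \<open>s = 1\<close>.\<close>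

definition weighted_inc :: "real \<Rightarrow> real \<Rightarrow> (real \<Rightarrow> real) \<Rightarrow> bool" where
  "weighted_inc p s g \<longleftrightarrow> (\<forall>x y. 0 < x \<longrightarrow> x \<le> y \<longrightarrow> y < s \<longrightarrow> x powr p * g x \<le> y powr p * g y)"

definition unit_nonneg :: "(real \<Rightarrow> real) \<Rightarrow> bool" where
  "unit_nonneg g \<longleftrightarrow> (\<forall>x. 0 < x \<longrightarrow> x < 1 \<longrightarrow> 0 \<le> g x)"

definition density_cone :: "real \<Rightarrow> (real \<Rightarrow> real) \<Rightarrow> bool" where
  "density_cone p g \<longleftrightarrow> unit_nonneg g \<and> decreasing g \<and> weighted_inc p 1 g"

lemma decreasingD: "decreasing g \<Longrightarrow> 0 < x \<Longrightarrow> x \<le> y \<Longrightarrow> y < 1 \<Longrightarrow> g y \<le> g x"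
  by (auto simp: decreasing_def)

lemma weighted_incD: "weighted_inc p s g \<Longrightarrow> 0 < x \<Longrightarrow> x \<le> y \<Longrightarrow> y < s \<Longrightarrow> x powr p * g x \<le> y powr p * g y"
  by (auto simp: weighted_inc_def)

lemma unit_nonnegD: "unit_nonneg g \<Longrightarrow> 0 < x \<Longrightarrow> x < 1 \<Longrightarrow> 0 \<le> g x"
  by (auto simp: unit_nonneg_def)

lemma coneD:
  assumes "density_cone p g"
  shows "unit_nonneg g" "decreasing g" "weighted_inc p 1 g"
  using assms by (auto simp: density_cone_def)

section \<open>Invariance of the cones under both branches\<close>

lemma unit_nonneg_left_part:
  assumes "0 \<le> a" "unit_nonneg g"
  shows "unit_nonneg (left_part a g)"
  using assms left_inv_unit[OF assms(1)] left_deriv_pos[OF assms(1)]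
  by (auto simp: unit_nonneg_def left_part_def intro!: divide_nonneg_pos)

lemma unit_nonneg_right_part: "unit_nonneg g \<Longrightarrow> unit_nonneg (right_part g)"
  by (auto simp: unit_nonneg_def right_part_def)

text \<open>The inverse branch is increasing and so is the derivative of the left branch; hence the
  numerator decreases while the denominator grows.\<close>

lemma decreasing_left_part:
  assumes a: "0 \<le> a" and g: "unit_nonneg g" "decreasing g"
  shows "decreasing (left_part a g)"
  unfolding decreasing_def
proof (intro allI impI)
  fix x y :: real assume x: "0 < x" and xy: "x \<le> y" and y: "y < 1"
  have S: "left_inv a x \<le> left_inv a y" using left_inv_le_iff[OF a] xy by simp
  have u: "0 < left_inv a x" "left_inv a y < 1" "0 < left_inv a y"
    using left_inv_unit[OF a] x xy y by auto
  show "left_part a g y \<le> left_part a g x"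
    unfolding left_part_def
  proof (rule frac_le)
    show "0 \<le> g (left_inv a x)" using unit_nonnegD[OF g(1), of "left_inv a x"] u S by auto
    show "g (left_inv a y) \<le> g (left_inv a x)" using decreasingD[OF g(2), of "left_inv a x" "left_inv a y"] u S by auto
    show "0 < left_deriv a (left_inv a x)" by (rule left_deriv_pos[OF a])
    show "left_deriv a (left_inv a x) \<le> left_deriv a (left_inv a y)"
      using u S by (intro left_deriv_mono[OF a]) auto
  qed
qed

lemma decreasing_right_part: "decreasing g \<Longrightarrow> decreasing (right_part g)"
  unfolding decreasing_def right_part_def by (auto intro!: divide_right_mono)

text \<open>For \<open>x = u * (1 + t)\<close> with \<open>t = (2 * u) powr a\<close>, this ratio is
  \<open>(x / u) powr p\<close> divided by the derivative of the left branch at \<open>u\<close>.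
  Its logarithm has derivative \<open>p / (1 + t) - (1 + a) / (1 + (1 + a) * t)\<close>, which is
  nonnegative because \<open>p\<close> is at least \<open>1 + a\<close>.\<close>

lemma branch_ratio_mono:
  fixes t t' a p :: real
  assumes a: "0 \<le> a" and p: "1 + a \<le> p" and t: "0 \<le> t" "t \<le> t'"
  shows "(1 + t) powr p / (1 + (1 + a) * t) \<le> (1 + t') powr p / (1 + (1 + a) * t')"
proof -
  let ?F = "\<lambda>t. p * ln (1 + t) - ln (1 + (1 + a) * t)"
  have pos: "0 < 1 + (1 + a) * s" if "0 \<le> s" for s
    using that a by (intro add_pos_nonneg mult_nonneg_nonneg) auto
  have "?F t \<le> ?F t'"
  proof (rule DERIV_nonneg_imp_nondecreasing[OF t(2)])
    fix s assume s: "t \<le> s" "s \<le> t'"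
    then have s0: "0 \<le> s" using t by simp
    have d: "(?F has_real_derivative p * (1 / (1 + s)) - (1 + a) / (1 + (1 + a) * s)) (at s)"
      using s0 pos[OF s0] by (auto intro!: derivative_eq_intros)
    have "(1 + a) / (1 + (1 + a) * s) \<le> (1 + a) * (1 / (1 + s))"
    proof -
      have "1 + s \<le> 1 + (1 + a) * s" using a s0 by (simp add: ring_distribs)
      then have "1 / (1 + (1 + a) * s) \<le> 1 / (1 + s)" using s0 by (intro divide_left_mono mult_pos_pos) (auto intro: pos)
      from mult_left_mono[OF this, of "1 + a"] show ?thesis using a by simp
    qed
    also have "\<dots> \<le> p * (1 / (1 + s))" using p s0 by (intro mult_right_mono) auto
    finally show "\<exists>y. (?F has_real_derivative y) (at s) \<and> 0 \<le> y"
      using d by (intro exI[of _ "p * (1 / (1 + s)) - (1 + a) / (1 + (1 + a) * s)"]) simp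
  qed
  then have "exp (?F t) \<le> exp (?F t')" by simp
  moreover have "exp (?F s) = (1 + s) powr p / (1 + (1 + a) * s)" if "0 \<le> s" for s
    using that pos[OF that] by (simp add: exp_diff powr_def)
  ultimately show ?thesis using t by simp
qed

text \<open>With \<open>u = left_inv a x\<close>, the weighted function factors as
  \<open>u powr p * g u\<close> times the ratio of \<open>branch_ratio_mono\<close>; both factors
  are nonnegative and increasing.\<close>

lemma weighted_inc_left_part:
  assumes a: "0 \<le> a" "1 + a \<le> p" and g: "unit_nonneg g" "weighted_inc p s g"
    and s': "s' \<le> 1" "left_inv a s' \<le> s"
  shows "weighted_inc p s' (left_part a g)"
  unfolding weighted_inc_def
proof (intro allI impI)
  fix x y :: real assume x: "0 < x" and xy: "x \<le> y" and y: "y < s'"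
  define u v where "u = left_inv a x" and "v = left_inv a y"
  have uv: "0 < u" "u \<le> v" "v < s" "v < 1"
    using left_inv_le_iff[OF a(1), of x y] left_inv_less_iff[OF a(1), of y s'] left_inv_unit(3)[OF a(1), of y]
      a x xy y s' by (auto simp: u_def v_def)
  have eq: "z powr p * left_part a g z = left_inv a z powr p * g (left_inv a z) *
     ((1 + (2 * left_inv a z) powr a) powr p / (1 + (1 + a) * (2 * left_inv a z) powr a))"
    if "0 < z" for z
  proof -
    have "z = left_inv a z * (1 + (2 * left_inv a z) powr a)"
      using left_branch_inv[OF a(1), of z] by (simp add: left_branch_def)
    then have "z powr p = left_inv a z powr p * (1 + (2 * left_inv a z) powr a) powr p"
      by (metis powr_mult)
    then show ?thesis by (simp add: left_part_def left_deriv_def)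
  qed
  have "u powr p * g u * ((1 + (2 * u) powr a) powr p / (1 + (1 + a) * (2 * u) powr a))
     \<le> v powr p * g v * ((1 + (2 * v) powr a) powr p / (1 + (1 + a) * (2 * v) powr a))"
  proof (rule mult_mono)
    show "u powr p * g u \<le> v powr p * g v" using weighted_incD[OF g(2), of u v] uv by simp
    show "(1 + (2 * u) powr a) powr p / (1 + (1 + a) * (2 * u) powr a)
        \<le> (1 + (2 * v) powr a) powr p / (1 + (1 + a) * (2 * v) powr a)"
      using uv a by (intro branch_ratio_mono powr_mono2) auto
    show "0 \<le> v powr p * g v" using unit_nonnegD[OF g(1), of v] uv by simp
    show "0 \<le> (1 + (2 * u) powr a) powr p / (1 + (1 + a) * (2 * u) powr a)"
      using a by (intro divide_nonneg_nonneg add_nonneg_nonneg mult_nonneg_nonneg) auto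
  qed
  then show "x powr p * left_part a g x \<le> y powr p * left_part a g y"
    using x xy by (simp add: eq u_def v_def)
qed

text \<open>With \<open>u = (1 + x) / 2\<close>, the weighted function is
  \<open>u powr p * g u\<close> times half of \<open>(x / u\<^sup>2) powr (p / 2)\<close>, and
  \<open>x / u\<^sup>2 = 4 * x / (1 + x)\<^sup>2\<close> is increasing on \<open>(0, 1)\<close>. The
  square in the denominator is what permits half the exponent.\<close>

lemma weighted_inc_right_part:
  assumes p: "0 \<le> p" and g: "unit_nonneg g" "weighted_inc p 1 g"
  shows "weighted_inc (p / 2) 1 (right_part g)"
  unfolding weighted_inc_def
proof (intro allI impI)
  fix x y :: real assume x: "0 < x" and xy: "x \<le> y" and y: "y < 1"
  define u v where "u = (1 + x) / 2" and "v = (1 + y) / 2"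
  have uv: "0 < u" "u \<le> v" "v < 1" using x xy y by (auto simp: u_def v_def)
  have eq: "z powr (p / 2) * right_part g z
      = ((1 + z) / 2) powr p * g ((1 + z) / 2) * (((z / ((1 + z) / 2)\<^sup>2) powr (p / 2)) / 2)"
    if "0 < z" for z
  proof -
    have "(((1 + z) / 2)\<^sup>2) powr (p / 2) = ((1 + z) / 2) powr p"
      using that powr_powr[of "(1 + z) / 2" 2 "p / 2"] by simp
    then show ?thesis using that by (simp add: right_part_def powr_divide)
  qed
  have "x / u\<^sup>2 \<le> y / v\<^sup>2"
  proof -
    have "u\<^sup>2 * y - v\<^sup>2 * x = (y - x) * (1 - x * y) / 4"
      by (simp add: u_def v_def power2_eq_square field_simps)
    moreover have "x * y \<le> 1" using x xy y mult_mono[of x 1 y 1] by simp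
    then have "0 \<le> (y - x) * (1 - x * y) / 4" using xy by (intro divide_nonneg_nonneg mult_nonneg_nonneg) auto
    ultimately have "x * v\<^sup>2 \<le> y * u\<^sup>2" by (simp add: mult.commute)
    then have "x \<le> y * u\<^sup>2 / v\<^sup>2" using uv by (subst pos_le_divide_eq) auto
    then have "x \<le> y / v\<^sup>2 * u\<^sup>2" by simp
    then show ?thesis using uv by (subst pos_divide_le_eq) auto
  qed
  then have "(x / u\<^sup>2) powr (p / 2) / 2 \<le> (y / v\<^sup>2) powr (p / 2) / 2"
    using p x uv by (intro divide_right_mono powr_mono2) auto
  then have "u powr p * g u * ((x / u\<^sup>2) powr (p / 2) / 2) \<le> v powr p * g v * ((y / v\<^sup>2) powr (p / 2) / 2)"
    using weighted_incD[OF g(2) uv] unit_nonnegD[OF g(1), of v] uv by (rule_tac mult_mono) auto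
  then show "x powr (p / 2) * right_part g x \<le> y powr (p / 2) * right_part g y"
    using x xy eq[of x] eq[of y] by (simp add: u_def v_def)
qed

lemma weighted_inc_exponent_mono:
  assumes "p \<le> q" "unit_nonneg g" "weighted_inc p s g" "s \<le> 1"
  shows "weighted_inc q s g"
  unfolding weighted_inc_def
proof (intro allI impI)
  fix x y :: real assume x: "0 < x" and xy: "x \<le> y" and y: "y < s"
  have "x powr (q - p) * (x powr p * g x) \<le> y powr (q - p) * (y powr p * g y)"
    using weighted_incD[OF assms(3) x xy y] unit_nonnegD[OF assms(2), of x] x xy y assms
    by (rule_tac mult_mono) (auto intro: powr_mono2)
  then show "x powr q * g x \<le> y powr q * g y"
    by (simp add: mult.assoc[symmetric] powr_add[symmetric])
qed

lemma weighted_inc_right_part':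
  assumes p: "0 \<le> p" and g: "unit_nonneg g" "weighted_inc p 1 g"
  shows "weighted_inc p 1 (right_part g)"
  using weighted_inc_exponent_mono[OF _ unit_nonneg_right_part[OF g(1)] weighted_inc_right_part[OF assms], of p] p
  by simp

lemma cone_add: "density_cone p g \<Longrightarrow> density_cone p h \<Longrightarrow> density_cone p (\<lambda>x. g x + h x)"
  unfolding density_cone_def unit_nonneg_def decreasing_def weighted_inc_def
  by (auto simp: ring_distribs intro!: add_mono)

lemma cone_cmult: "density_cone p g \<Longrightarrow> 0 \<le> c \<Longrightarrow> density_cone p (\<lambda>x. c * g x)"
  unfolding density_cone_def unit_nonneg_def decreasing_def weighted_inc_def
  by (auto intro!: mult_left_mono simp: mult.left_commute[of _ c])

lemma cone_cong: "density_cone p g \<Longrightarrow> (\<And>x. 0 < x \<Longrightarrow> x < 1 \<Longrightarrow> g x = h x) \<Longrightarrow> density_cone p h"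
  unfolding density_cone_def unit_nonneg_def decreasing_def weighted_inc_def
  by (smt (verit))

lemma cone_const: "0 \<le> p \<Longrightarrow> 0 \<le> c \<Longrightarrow> density_cone p (\<lambda>_. c)"
  unfolding density_cone_def unit_nonneg_def decreasing_def weighted_inc_def
  by (auto intro!: mult_right_mono powr_mono2)

lemma cone_exponent_mono: "density_cone p g \<Longrightarrow> p \<le> q \<Longrightarrow> density_cone q g"
  by (auto simp: density_cone_def intro: weighted_inc_exponent_mono)

lemma cone_left_part: "0 \<le> a \<Longrightarrow> 1 + a \<le> p \<Longrightarrow> density_cone p g \<Longrightarrow> density_cone p (left_part a g)"
  unfolding density_cone_def
  by (auto intro!: unit_nonneg_left_part decreasing_left_part weighted_inc_left_part[where s = 1])

lemma cone_right_part: "0 \<le> p \<Longrightarrow> density_cone p g \<Longrightarrow> density_cone p (right_part g)"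
  unfolding density_cone_def
  by (auto intro!: unit_nonneg_right_part decreasing_right_part weighted_inc_right_part')

lemma cone_right_part_half: "0 \<le> p \<Longrightarrow> density_cone (2 * p) g \<Longrightarrow> density_cone p (right_part g)"
  unfolding density_cone_def
  using weighted_inc_right_part[of "2 * p" g]
  by (auto intro!: unit_nonneg_right_part decreasing_right_part)

lemma cone_transfer: "0 \<le> a \<Longrightarrow> 1 + a \<le> p \<Longrightarrow> density_cone p g \<Longrightarrow> density_cone p (transfer a g)"
  unfolding transfer_def[abs_def] by (intro cone_add cone_left_part cone_right_part) auto

lemma cone_transfer_iter:
  "admissible \<beta> \<alpha> \<Longrightarrow> 1 + \<beta> \<le> p \<Longrightarrow> density_cone p g \<Longrightarrow> density_cone p (transfer_iter n \<alpha> g)"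
proof (induction n arbitrary: \<alpha> g)
  case (Suc n)
  then show ?case
    using admissible_1[of \<beta> \<alpha>] by (auto intro!: Suc.IH admissible_shift cone_transfer)
qed simp

text \<open>The right end of the cylinder of length \<open>n\<close> at the neutral fixed point: all
  \<open>n\<close> inverse branches are left ones. This cylinder turns out to control the size of
  all the others.\<close>

primrec left_end :: "nat \<Rightarrow> (nat \<Rightarrow> real) \<Rightarrow> real" where
  "left_end 0 \<alpha> = 1"
| "left_end (Suc n) \<alpha> = left_inv (\<alpha> 1) (left_end n (shift 1 \<alpha>))"

lemma left_end_bounds: "admissible \<beta> \<alpha> \<Longrightarrow> 0 < left_end n \<alpha> \<and> left_end n \<alpha> \<le> 1"
proof (induction n arbitrary: \<alpha>)
  case (Suc n)
  have a: "0 \<le> \<alpha> 1" using admissible_1[OF Suc.prems] by simp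
  have "0 < left_end n (shift 1 \<alpha>)" "left_end n (shift 1 \<alpha>) \<le> 1"
    using Suc.IH[OF admissible_shift[OF Suc.prems]] by auto
  then show ?case
    using left_inv_le_iff[OF a, of "left_end n (shift 1 \<alpha>)" 1] a by simp
qed simp

text \<open>
  The left branch cannot improve the exponent near the neutral fixed point, but the right branch
  halves it. If \<open>g\<close> already has the good exponent on \<open>(0, s)\<close>, then after \<open>q\<close> steps every branch
  has either passed through the right half or started in \<open>(0, s)\<close>.
\<close>

lemma cone_improve:
  assumes "admissible \<beta> \<alpha>" "density_cone (2 * (1 + \<beta>)) g" "0 \<le> \<beta>" "weighted_inc (1 + \<beta>) s g" "left_end q \<alpha> \<le> s"
  shows "density_cone (1 + \<beta>) (transfer_iter q \<alpha> g)"
  using assms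
proof (induction q arbitrary: \<alpha> g s)
  case 0
  then show ?case by (auto simp: density_cone_def weighted_inc_def)
next
  case (Suc q)
  note a = admissible_1[OF Suc.prems(1)]
  let ?l = "left_part (\<alpha> 1) g" and ?r = "right_part g" and ?s = "shift 1 \<alpha>"
  have adm: "admissible \<beta> ?s" by (rule admissible_shift[OF Suc.prems(1)])
  have "density_cone (1 + \<beta>) (transfer_iter q ?s ?l)"
  proof (rule Suc.IH[OF adm _ Suc.prems(3)])
    show "density_cone (2 * (1 + \<beta>)) ?l" using a Suc.prems by (intro cone_left_part) auto
    show "weighted_inc (1 + \<beta>) (left_end q ?s) ?l"
      using a Suc.prems left_end_bounds[OF adm, of q]
      by (intro weighted_inc_left_part[where s = s] coneD(1)[OF Suc.prems(2)]) auto
  qed simp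
  moreover have "density_cone (1 + \<beta>) (transfer_iter q ?s ?r)"
    using Suc.prems by (intro cone_transfer_iter[OF adm] cone_right_part_half) auto
  ultimately have "density_cone (1 + \<beta>) (\<lambda>x. transfer_iter q ?s ?l x + transfer_iter q ?s ?r x)"
    by (rule cone_add)
  then show ?case
    by (simp add: transfer_def[abs_def] transfer_iter_add_fun[abs_def])
qed

section \<open>Loss of memory\<close>

text \<open>Two uses of the bound 1/3 shape the proof: it makes the domination by
  \<open>3 * x powr - \<beta>\<close> invariant, and, read as \<open>1 / \<beta> > 3\<close>, it
  lets covariances decay at least like the inverse square of the distance in spite of the
  logarithms.\<close>

locale subcritical =
  fixes \<beta> :: real
  assumes \<beta>_pos: "0 < \<beta>" and \<beta>_less: "\<beta> < 1/3"
begin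

lemma powr_integral:
  assumes e: "0 < e"
  shows "set_integrable lborel {0<..<e} (\<lambda>x. x powr - \<beta>)"
    and "(LBINT x:{0<..<e}. x powr - \<beta>) = e powr (1 - \<beta>) / (1 - \<beta>)"
proof -
  have hi: "((\<lambda>x. x powr - \<beta>) has_integral e powr (1 - \<beta>) / (1 - \<beta>)) {0<..<e}"
    using has_integral_powr_from_0[of "- \<beta>" e] \<beta>_less e by (simp add: has_integral_Icc_iff_Ioo add.commute)
  then have ai: "(\<lambda>x. x powr - \<beta>) absolutely_integrable_on {0<..<e}"
    by (intro nonnegative_absolutely_integrable_1) auto
  have m: "(\<lambda>x. indicator {0<..<e} x *\<^sub>R x powr - \<beta>) \<in> borel_measurable borel" by measurable
  show "set_integrable lborel {0<..<e} (\<lambda>x. x powr - \<beta>)"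
    using ai m unfolding set_integrable_def by (subst (asm) integrable_completion) auto
  have "(LBINT x:{0<..<e}. x powr - \<beta>) = (LINT x:{0<..<e}|lebesgue. x powr - \<beta>)"
    using m unfolding set_lebesgue_integral_def by (subst integral_completion) auto
  also have "\<dots> = integral {0<..<e} (\<lambda>x. x powr - \<beta>)"
    by (rule set_lebesgue_integral_eq_integral(2)[OF ai])
  also have "\<dots> = e powr (1 - \<beta>) / (1 - \<beta>)" using hi by (rule integral_unique)
  finally show "(LBINT x:{0<..<e}. x powr - \<beta>) = e powr (1 - \<beta>) / (1 - \<beta>)" .
qed

text \<open>The mass may be less than 1, so that the class is closed under subtracting constants,
  truncating and weighting by cylinders, as long as the result is nonnegative and decreasing. The
  domination gives integrability and controls the mass near 0.\<close>

definition tame :: "(real \<Rightarrow> real) \<Rightarrow> bool" where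
  "tame g \<longleftrightarrow> g \<in> borel_measurable borel \<and> unit_nonneg g \<and> decreasing g \<and>
     (\<forall>x. 0 < x \<longrightarrow> x < 1 \<longrightarrow> g x \<le> 3 * x powr - \<beta>) \<and> integral\<^sup>L uniform g \<le> 1"

lemma tameD:
  assumes "tame g"
  shows "g \<in> borel_measurable borel" "unit_nonneg g" "decreasing g"
    "0 < x \<Longrightarrow> x < 1 \<Longrightarrow> g x \<le> 3 * x powr - \<beta>" "integral\<^sup>L uniform g \<le> 1"
  using assms by (auto simp: tame_def)

lemma integrable_uniform_dominated:
  assumes g: "g \<in> borel_measurable borel" and b: "\<And>x. 0 < x \<Longrightarrow> x < 1 \<Longrightarrow> \<bar>g x\<bar> \<le> c * x powr - \<beta>"
  shows "integrable uniform g"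
proof (rule Bochner_Integration.integrable_bound)
  show "integrable uniform (\<lambda>x. c * x powr - \<beta>)"
    using powr_integral(1)[of 1] by (intro integrable_mult_right) (simp add: integrable_uniform)
  show "g \<in> borel_measurable uniform" by (rule borel_measurable_uniform[OF g])
  show "AE x in uniform. norm (g x) \<le> norm (c * x powr - \<beta>)"
    using b by (intro AE_I2) (fastforce simp: space_uniform)
qed

lemma tame_integrable: "tame g \<Longrightarrow> integrable uniform g"
  using tameD[of g] unit_nonnegD[of g] by (intro integrable_uniform_dominated[where c = 3]) auto

lemma unit_nonneg_integral_nonneg:
  "unit_nonneg g \<Longrightarrow> 0 \<le> integral\<^sup>L uniform g"
  by (intro Bochner_Integration.integral_nonneg_AE AE_I2) (auto simp: unit_nonneg_def)

lemma set_integral_Ioo_nonneg: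
  assumes "unit_nonneg g" "0 \<le> a" "b \<le> 1"
  shows "0 \<le> (LBINT x:{a<..<b}. g x)"
  unfolding set_lebesgue_integral_def
  using assms by (intro Bochner_Integration.integral_nonneg_AE AE_I2) (auto simp: unit_nonneg_def indicator_def)

lemma set_integral_Ioo_const:
  fixes c :: real
  assumes "a \<le> b"
  shows "(LBINT x:{a<..<b}. c) = (b - a) * c" "set_integrable lborel {a<..<b} (\<lambda>_. c)"
  using assms by (simp_all add: set_lebesgue_integral_def set_integrable_def)

lemma set_integral_Ioo_le_const:
  fixes c :: real
  assumes "a \<le> b" "set_integrable lborel {a<..<b} g" "\<And>x. a < x \<Longrightarrow> x < b \<Longrightarrow> g x \<le> c"
  shows "(LBINT x:{a<..<b}. g x) \<le> (b - a) * c"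
  using set_integral_mono[OF assms(2) set_integral_Ioo_const(2)[OF assms(1)], of c]
    set_integral_Ioo_const(1)[OF assms(1), of c] assms(3) by auto

lemma set_integral_Ioo_ge_const:
  fixes c :: real
  assumes "a \<le> b" "set_integrable lborel {a<..<b} g" "\<And>x. a < x \<Longrightarrow> x < b \<Longrightarrow> c \<le> g x"
  shows "(b - a) * c \<le> (LBINT x:{a<..<b}. g x)"
  using set_integral_mono[OF set_integral_Ioo_const(2)[OF assms(1)] assms(2), of c]
    set_integral_Ioo_const(1)[OF assms(1), of c] assms(3) by auto

text \<open>On \<open>(0, z)\<close> the function is at least \<open>g z\<close>.\<close>

lemma decreasing_le_mass:
  assumes g: "g \<in> borel_measurable borel" "unit_nonneg g" "decreasing g" "integrable uniform g"
    and z: "0 < z" "z < 1"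
  shows "z * g z \<le> integral\<^sup>L uniform g"
proof -
  have z': "0 \<le> z" "z \<le> 1" using z by auto
  note s = integral_uniform_split[OF g(1,4) z']
  have "z * g z \<le> (LBINT x:{0<..<z}. g x)"
    using set_integral_Ioo_ge_const[OF z'(1) s(1), of "g z"] decreasingD[OF g(3), of _ z] z by auto
  then show ?thesis using s(3) set_integral_Ioo_nonneg[OF g(2) z'(1), of 1] by simp
qed

text \<open>Concavity of the power, obtained from the weighted inequality between geometric and
  arithmetic means for \<open>w\<close> and 1.\<close>

lemma powr_le_linear:
  assumes "0 \<le> b" "b \<le> 1" "0 < (w::real)"
  shows "w powr b \<le> 1 + b * (w - 1)"
  using Youngs_inequality_0[of b "1 - b" w 1] assms by (simp add: algebra_simps)

text \<open>
  The constant \<open>3\<close> is invariant for all parameters up to \<open>\<beta> < 1/3\<close> and dominates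
  \<open>2\<^sup>\<beta> (2 + \<beta>)\<close>.
\<close>

lemma dominated_transfer:
  assumes a: "0 \<le> a" "a \<le> \<beta>" and g: "tame g" and x: "0 < x" "x < 1"
  shows "transfer a g x \<le> 3 * x powr - \<beta>"
proof -
  define y t where "y = left_inv a x" and "t = (2 * y) powr a"
  have y: "0 < y" "y < 1/2" "y < 1" using left_inv_unit[OF a(1) x] by (auto simp: y_def)
  have xy: "x = y * (1 + t)"
    using left_branch_inv[OF a(1), of x] by (simp add: left_branch_def y_def t_def)
  have t: "0 \<le> t" "t \<le> 1" using y a by (auto simp: t_def intro!: powr_le1)
  define D where "D = 1 + (1 + a) * t"
  have D: "0 < D" "D \<le> 2 + a" using t a mult_left_le[of t "1 + a"] by (auto simp: D_def intro!: add_pos_nonneg)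
  have z: "0 < (1 + x) / 2" "(1 + x) / 2 < 1" using x by auto
  have "(1 + x) / 2 * g ((1 + x) / 2) \<le> 1"
    using decreasing_le_mass[OF tameD(1-3)[OF g] tame_integrable[OF g] z] tameD(5)[OF g] by linarith
  moreover have "1/2 * g ((1 + x) / 2) \<le> (1 + x) / 2 * g ((1 + x) / 2)"
    using x unit_nonnegD[OF tameD(2)[OF g] z] by (intro mult_right_mono) auto
  ultimately have r: "right_part g x \<le> 1" by (simp add: right_part_def)
  have l: "left_part a g x \<le> 3 * y powr - \<beta> / D"
    unfolding left_part_def y_def[symmetric] left_deriv_def t_def[symmetric] D_def[symmetric]
    using tameD(4)[OF g y(1,3)] D by (intro divide_right_mono) auto
  have xb: "x powr \<beta> * y powr - \<beta> = (1 + t) powr \<beta>"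
    using y t by (simp add: xy powr_mult powr_minus)
  have "(1 + t) powr \<beta> \<le> 1 + \<beta> * t"
    using powr_le_linear[of \<beta> "1 + t"] \<beta>_pos \<beta>_less t by simp
  then have "3 * (1 + t) powr \<beta> / D \<le> 3 * (1 + \<beta> * t) / D"
    using D by (intro divide_right_mono) auto
  \<comment> \<open>The right branch contributes at most 1. After multiplication with
    \<open>x powr \<beta>\<close> this must be paid for by the expansion \<open>t\<close> of the
    left branch, which works because \<open>x \<le> 2 * y < 1\<close> and
    \<open>a \<le> \<beta>\<close>.\<close>
  moreover have "x powr \<beta> \<le> t"
  proof -
    have "x \<le> 2 * y" using mult_left_mono[of "1 + t" 2 y] t y by (simp add: xy)
    then have "x powr \<beta> \<le> (2 * y) powr \<beta>" using x \<beta>_pos by (intro powr_mono2) auto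
    also have "\<dots> \<le> t" unfolding t_def using y a by (intro powr_mono') auto
    finally show ?thesis .
  qed
  \<comment> \<open>After clearing \<open>D \<le> 2 + a\<close>, the inequality reduces to
    \<open>2 + a \<le> 3 * (1 + a - \<beta>)\<close>, and this is where
    \<open>3 * \<beta> \<le> 1\<close> is needed.\<close>
  moreover have "3 * (1 + \<beta> * t) / D + t \<le> 3"
  proof -
    have "t * D \<le> t * (2 + a)" using t D by (intro mult_left_mono) auto
    also have "\<dots> \<le> t * (3 * (1 + a - \<beta>))" using t a \<beta>_less by (intro mult_left_mono) auto
    finally have "3 * (1 + \<beta> * t) + t * D \<le> 3 * D" by (simp add: D_def algebra_simps)
    then have "(3 * (1 + \<beta> * t) + t * D) / D \<le> 3" using D by (simp add: pos_divide_le_eq)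
    then show ?thesis using D by (simp add: add_divide_distrib)
  qed
  ultimately have *: "3 * (1 + t) powr \<beta> / D + x powr \<beta> \<le> 3" by linarith
  have "x powr \<beta> * transfer a g x \<le> x powr \<beta> * (3 * y powr - \<beta> / D + 1)"
    unfolding transfer_def using l r by (intro mult_left_mono) auto
  also have "\<dots> = 3 * (x powr \<beta> * y powr - \<beta>) / D + x powr \<beta>" by (simp add: ring_distribs)
  also have "\<dots> \<le> 3" using * by (simp only: xb)
  finally have "transfer a g x \<le> 3 / x powr \<beta>" using x by (simp add: pos_le_divide_eq mult.commute)
  then show ?thesis by (simp add: powr_minus divide_inverse)
qed

lemma unit_nonneg_transfer: "0 \<le> a \<Longrightarrow> unit_nonneg g \<Longrightarrow> unit_nonneg (transfer a g)"
  using unit_nonneg_left_part[of a g] unit_nonneg_right_part[of g]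
  by (auto simp: unit_nonneg_def transfer_def)

lemma decreasing_transfer: "0 \<le> a \<Longrightarrow> unit_nonneg g \<Longrightarrow> decreasing g \<Longrightarrow> decreasing (transfer a g)"
  using decreasing_left_part[of a g] decreasing_right_part[of g]
  by (auto simp: decreasing_def transfer_def intro!: add_mono)

lemma tame_transfer:
  assumes "0 \<le> a" "a \<le> \<beta>" "tame g"
  shows "tame (transfer a g)"
  using assms dominated_transfer[OF assms] unit_nonneg_transfer decreasing_transfer measurable_transfer(3)[OF tameD(1)[OF assms(3)] assms(1)]
    integral_transfer(2)[OF assms(1) tameD(1)[OF assms(3)] tame_integrable[OF assms(3)]]
  by (simp add: tame_def)

lemma tame_transfer_iter: "admissible \<beta> \<alpha> \<Longrightarrow> tame g \<Longrightarrow> tame (transfer_iter n \<alpha> g)"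
proof (induction n arbitrary: \<alpha> g)
  case (Suc n)
  then show ?case
    using admissible_1[of \<beta> \<alpha>] by (auto intro!: Suc.IH admissible_shift tame_transfer)
qed simp

lemma tame_mono:
  assumes "tame g" "h \<in> borel_measurable borel" "unit_nonneg h" "decreasing h"
    "\<And>x. 0 < x \<Longrightarrow> x < 1 \<Longrightarrow> h x \<le> g x"
  shows "tame h" "integral\<^sup>L uniform h \<le> integral\<^sup>L uniform g"
proof -
  have d: "h x \<le> 3 * x powr - \<beta>" if "0 < x" "x < 1" for x
    using assms(5)[OF that] tameD(4)[OF assms(1) that] by simp
  have i: "integrable uniform h"
    using d unit_nonnegD[OF assms(3)] by (intro integrable_uniform_dominated[OF assms(2), of 3]) auto
  show le: "integral\<^sup>L uniform h \<le> integral\<^sup>L uniform g"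
    using assms(5) by (intro integral_mono[OF i tame_integrable[OF assms(1)]]) auto
  show "tame h"
    using assms d le tameD(5)[OF assms(1)] by (auto simp: tame_def)
qed

section \<open>Lower bounds for transferred densities\<close>

lemma tame_one: "tame (\<lambda>_. 1)"
proof -
  have "1 \<le> 3 * x powr - \<beta>" if "0 < x" "x < 1" for x
  proof -
    have "1 \<le> x powr - \<beta>" using powr_mono'[of "- \<beta>" 0 x] that \<beta>_pos by simp
    then show ?thesis by linarith
  qed
  then show ?thesis
    using prob_space.prob_space[OF prob_space_uniform] by (simp add: tame_def unit_nonneg_def decreasing_def)
qed

text \<open>The domination by \<open>3 * x powr - \<beta>\<close> leaves at most half of the mass in
  \<open>(0, 1/27)\<close>, so by monotonicity the value at \<open>1/27\<close> is at least 1/2.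
  Points further left inherit it. Points further right lose at most the factor
  \<open>(1/27) powr (1 + \<beta>)\<close>, which is at least 1/81. The bound is uniform in
  \<open>n\<close> and in the parameters.\<close>

lemma transfer_iter_one_ge:
  assumes adm: "admissible \<beta> \<alpha>" and x: "0 < x" "x < 1"
  shows "1/162 \<le> transfer_iter n \<alpha> (\<lambda>_. 1) x"
proof -
  define \<gamma> where "\<gamma> = transfer_iter n \<alpha> (\<lambda>_. 1)"
  have t: "tame \<gamma>" unfolding \<gamma>_def by (rule tame_transfer_iter[OF adm tame_one])
  have c: "density_cone (1 + \<beta>) \<gamma>"
    unfolding \<gamma>_def using \<beta>_pos by (intro cone_transfer_iter[OF adm] cone_const) auto
  have int: "integral\<^sup>L uniform \<gamma> = 1"
    unfolding \<gamma>_def using integral_transfer_iter(2)[OF adm _ tame_integrable[OF tame_one]]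
      prob_space.prob_space[OF prob_space_uniform] by simp
  have d: "(0::real) \<le> 1/27" "(1::real)/27 \<le> 1" by auto
  note s = integral_uniform_split[OF tameD(1)[OF t] tame_integrable[OF t] d]
  have p: "((1::real)/27) powr r = (1/3) powr (3 * r)" for r
    using powr_powr[of "1/3" 3 r] by (simp add: power_divide)
  have "(LBINT x:{0<..<1/27}. \<gamma> x) \<le> (LBINT x:{0<..<1/27}. 3 * x powr - \<beta>)"
    using powr_integral(1)[of "1/27"] tameD(4)[OF t]
    by (intro set_integral_mono[OF s(1)]) auto
  also have "\<dots> = 3 * ((1/27) powr (1 - \<beta>) / (1 - \<beta>))"
    using powr_integral(2)[of "1/27"] by simp
  also have "\<dots> \<le> 3 * ((1/9) / (2/3))"
  proof -
    have "((1::real)/27) powr (1 - \<beta>) \<le> (1/3) powr 2"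
      unfolding p using \<beta>_less by (intro powr_mono') auto
    then show ?thesis using \<beta>_less by (intro mult_left_mono frac_le) (auto simp: power2_eq_square)
  qed
  finally have "1/2 \<le> (LBINT x:{1/27<..<1}. \<gamma> x)" using s(3) int by simp
  also have "\<dots> \<le> (1 - 1/27) * \<gamma> (1/27)"
    using decreasingD[OF tameD(3)[OF t], of "1/27"] by (intro set_integral_Ioo_le_const s(2)) auto
  finally have half: "1/2 \<le> \<gamma> (1/27)" using unit_nonnegD[OF tameD(2)[OF t], of "1/27"] by simp
  show ?thesis
  proof (cases "x \<le> 1/27")
    case True
    then show ?thesis using decreasingD[OF tameD(3)[OF t] x(1) True] half by (simp add: \<gamma>_def)
  next
    case False
    have "(1/3) powr 4 \<le> ((1::real)/27) powr (1 + \<beta>)"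
      unfolding p using \<beta>_less by (intro powr_mono') auto
    then have "1/81 * (1/2) \<le> (1/27) powr (1 + \<beta>) * \<gamma> (1/27)"
      using half by (intro mult_mono) (auto simp: power_divide)
    also have "\<dots> \<le> x powr (1 + \<beta>) * \<gamma> x"
      using weighted_incD[OF coneD(3)[OF c], of "1/27" x] False x by simp
    also have "\<dots> \<le> 1 * \<gamma> x"
      using x \<beta>_pos unit_nonnegD[OF tameD(2)[OF t] x] by (intro mult_right_mono powr_le1) auto
    finally show ?thesis by (simp add: \<gamma>_def)
  qed
qed

text \<open>On \<open>(1/2, 1)\<close> the values of a cone function vary at most by the factor 2^3
  = 8, since \<open>p \<le> 3\<close>; so each value is comparable to the mass of this half.\<close>

lemma right_part_ge:
  assumes p: "0 \<le> p" "p \<le> 3" and g: "density_cone p g" and i: "set_integrable lborel {1/2<..<1} g"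
    and x: "0 < x" "x < 1"
  shows "1/8 * (LBINT y:{1/2<..<1}. g y) \<le> right_part g x"
proof -
  define u where "u = (1 + x) / 2"
  have u: "1/2 < u" "u < 1" using x by (auto simp: u_def)
  note g' = coneD[OF g]
  have gu: "0 \<le> g u" using unit_nonnegD[OF g'(1), of u] u by simp
  have "g v \<le> 8 * g u" if v: "1/2 < v" "v < 1" for v
  proof (cases "u \<le> v")
    case True
    then show ?thesis using decreasingD[OF g'(2), of u v] u v gu by simp
  next
    case False
    have "1/8 \<le> ((1::real)/2) powr p" using powr_mono'[of p 3 "1/2"] p by (simp add: power3_eq_cube)
    also have "\<dots> \<le> v powr p" using v p by (intro powr_mono2) auto
    finally have "1/8 * g v \<le> v powr p * g v"
      using unit_nonnegD[OF g'(1), of v] v by (intro mult_right_mono) auto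
    also have "\<dots> \<le> u powr p * g u" using weighted_incD[OF g'(3), of v u] v u False by simp
    also have "\<dots> \<le> 1 * g u" using gu u p by (intro mult_right_mono powr_le1) auto
    finally show ?thesis by simp
  qed
  then have "(LBINT y:{1/2<..<1}. g y) \<le> (1 - 1/2) * (8 * g u)"
    by (intro set_integral_Ioo_le_const i) auto
  then show ?thesis by (simp add: right_part_def u_def)
qed

text \<open>
  Mass which visits the right half is spread out by the next step with a density bounded below;
  only the mass that starts in \<open>(0, left_end q \<alpha>)\<close> may fail to do so.
\<close>

lemma transfer_iter_ge:
  assumes "admissible \<beta> \<alpha>" "1 + \<beta> \<le> p" "p \<le> 3" "density_cone p g" "g \<in> borel_measurable borel" "integrable uniform g"
    "0 < x" "x < 1"
  shows "1/1296 * (LBINT y:{left_end q \<alpha><..<1}. g y) \<le> transfer_iter q \<alpha> g x"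
  using assms
proof (induction q arbitrary: \<alpha> g)
  case 0
  then show ?case using unit_nonnegD[OF coneD(1)[OF 0(4)], of x] by (simp add: set_lebesgue_integral_def)
next
  case (Suc q)
  let ?l = "left_part (\<alpha> 1) g" and ?r = "right_part g" and ?s = "shift 1 \<alpha>"
  have a: "0 \<le> \<alpha> 1" "\<alpha> 1 \<le> \<beta>" using admissible_1[OF Suc.prems(1)] by auto
  have adm: "admissible \<beta> ?s" by (rule admissible_shift[OF Suc.prems(1)])
  define z where "z = left_end q ?s"
  have z: "0 \<le> z" "z \<le> 1" using left_end_bounds[OF adm, of q] by (auto simp: z_def)
  have Sz: "0 \<le> left_inv (\<alpha> 1) z" "left_inv (\<alpha> 1) z \<le> 1/2"
    using left_inv_le_iff[OF a(1), of z 1] a z by auto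
  have half: "(0::real) \<le> 1/2" "(1/2::real) \<le> 1" by auto
  note s1 = integral_uniform_split[OF Suc.prems(5,6) half]
  have "set_integrable lborel {left_inv (\<alpha> 1) z<..<1} g"
    using integral_uniform_split(2)[OF Suc.prems(5,6) Sz(1)] Sz by simp
  note s2 = set_integral_split[OF Suc.prems(5) this Sz(2) half(2)]
  have li: "set_integrable lborel {left_inv (\<alpha> 1) 0<..<1/2} g" using s1(1) a by simp
  have lint: "integrable uniform ?l"
    unfolding integrable_uniform
    using integral_left_part(1)[OF a(1) order_refl Suc.prems(5) li] by simp
  have "1/1296 * (LBINT y:{z<..<1}. ?l y) \<le> transfer_iter q ?s ?l x"
    unfolding z_def using Suc.prems a
    by (intro Suc.IH adm lint cone_left_part measurable_transfer(1)) auto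
  then have l: "1/1296 * (LBINT y:{left_inv (\<alpha> 1) z<..<1/2}. g y) \<le> transfer_iter q ?s ?l x"
    using integral_left_part(2)[OF a(1) z(1) Suc.prems(5) s2(1)] by simp
  \<comment> \<open>The constant is 1/1296 = 1/8 * 1/162: the right branch spreads its mass with
    density at least \<open>c\<close>, and the remaining steps keep a constant density above 1/162
    of itself.\<close>
  define c where "c = 1/8 * (LBINT y:{1/2<..<1}. g y)"
  have c: "0 \<le> c" unfolding c_def
    using set_integral_Ioo_nonneg[OF coneD(1)[OF Suc.prems(4)] half(1) order_refl] by simp
  have "c * transfer_iter q ?s (\<lambda>_. 1) x = transfer_iter q ?s (\<lambda>_. c * 1) x"
    by (rule transfer_iter_cmult[symmetric])
  also have "\<dots> \<le> transfer_iter q ?s ?r x"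
    using right_part_ge[OF _ Suc.prems(3,4) s1(2)] Suc.prems(2,7,8) \<beta>_pos
    by (intro transfer_iter_mono[OF adm]) (auto simp: c_def)
  finally have "c * (1/162) \<le> transfer_iter q ?s ?r x"
    using mult_left_mono[OF transfer_iter_one_ge[OF adm Suc.prems(7,8), of q] c] by linarith
  then have r: "1/1296 * (LBINT y:{1/2<..<1}. g y) \<le> transfer_iter q ?s ?r x" by (simp add: c_def)
  have "transfer_iter (Suc q) \<alpha> g x = transfer_iter q ?s ?l x + transfer_iter q ?s ?r x"
    by (simp add: transfer_def[abs_def] transfer_iter_add_fun)
  then show ?case using l r s2(3) unfolding left_end.simps z_def[symmetric] by linarith
qed

definition end_bound :: "nat \<Rightarrow> real" where
  "end_bound n = (1 + \<beta> / 2 * real n) powr (- 1 / \<beta>)"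

text \<open>Each backward step along the left branch increases \<open>y powr - \<beta>\<close> by at
  least \<open>\<beta> / 2\<close>. Indeed the image of \<open>y\<close> is at least
  \<open>y * (1 + (2 * y) powr \<beta>)\<close>, because \<open>2 * y \<le> 1\<close> and the
  parameter is at most \<open>\<beta>\<close>; the rest is concavity. Starting from 1, this gives a
  bound that does not depend on the sequence.\<close>

lemma left_end_le:
  assumes "admissible \<beta> \<alpha>"
  shows "left_end n \<alpha> \<le> end_bound n"
proof -
  have "1 + \<beta> / 2 * real n \<le> left_end n \<alpha> powr - \<beta>"
    using assms
  proof (induction n arbitrary: \<alpha>)
    case (Suc n)
    have a: "0 \<le> \<alpha> 1" "\<alpha> 1 \<le> \<beta>" using admissible_1[OF Suc.prems] by auto
    have adm: "admissible \<beta> (shift 1 \<alpha>)" by (rule admissible_shift[OF Suc.prems(1)])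
    define x y where "x = left_end n (shift 1 \<alpha>)" and "y = left_inv (\<alpha> 1) x"
    have x: "0 < x" "x \<le> 1" using left_end_bounds[OF adm, of n] by (auto simp: x_def)
    have y: "0 < y" "y \<le> 1/2" using left_inv_le_iff[OF a(1), of x 1] x a by (auto simp: y_def)
    define s where "s = (2 * y) powr \<beta>"
    have s: "0 < s" "s \<le> 1" using y \<beta>_pos by (auto simp: s_def intro!: powr_le1)
    have "(2 * y) powr \<beta> \<le> (2 * y) powr \<alpha> 1" using y a by (intro powr_mono') auto
    then have "y * (1 + s) \<le> left_branch (\<alpha> 1) y"
      using y by (simp add: left_branch_def s_def)
    then have xs: "y * (1 + s) \<le> x" using a by (simp add: y_def)
    have "x powr - \<beta> \<le> (y * (1 + s)) powr - \<beta>"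
      using xs y s x \<beta>_pos by (intro powr_mono2') auto
    also have "\<dots> = y powr - \<beta> * (1 / (1 + s)) powr \<beta>"
      using s y by (simp add: powr_mult powr_minus_divide powr_divide)
    also have "\<dots> \<le> y powr - \<beta> * (1 - \<beta> * s / 2)"
    proof (rule mult_left_mono)
      have "(1 / (1 + s)) powr \<beta> \<le> 1 + \<beta> * (1 / (1 + s) - 1)"
        using \<beta>_pos \<beta>_less s by (intro powr_le_linear) auto
      also have "1 / (1 + s) - 1 \<le> - s / 2"
      proof -
        have "1 / (1 + s) - 1 = - (s / (1 + s))" using s by (simp add: field_simps)
        moreover have "s / 2 \<le> s / (1 + s)" using s by (intro divide_left_mono) auto
        ultimately show ?thesis by simp
      qed
      then have "1 + \<beta> * (1 / (1 + s) - 1) \<le> 1 - \<beta> * s / 2"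
        using mult_left_mono[of "1 / (1 + s) - 1" "- s / 2" \<beta>] \<beta>_pos by simp
      finally show "(1 / (1 + s)) powr \<beta> \<le> 1 - \<beta> * s / 2" .
    qed simp
    also have "\<dots> = y powr - \<beta> - \<beta> / 2 * 2 powr \<beta>"
      using y by (simp add: s_def powr_mult powr_minus field_simps)
    also have "\<dots> \<le> y powr - \<beta> - \<beta> / 2 * 1"
      using \<beta>_pos ge_one_powr_ge_zero[of 2 \<beta>] by (intro diff_left_mono mult_left_mono) auto
    finally have "x powr - \<beta> + \<beta> / 2 \<le> y powr - \<beta>" by simp
    moreover have "1 + \<beta> / 2 * real n \<le> x powr - \<beta>" unfolding x_def by (rule Suc.IH[OF adm])
    ultimately show ?case
      unfolding left_end.simps x_def[symmetric] y_def[symmetric] by (simp add: ring_distribs)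
  qed simp
  then have "(left_end n \<alpha> powr - \<beta>) powr (- 1 / \<beta>) \<le> (1 + \<beta> / 2 * real n) powr (- 1 / \<beta>)"
    using \<beta>_pos by (intro powr_mono2') (auto intro!: add_pos_nonneg)
  then show ?thesis
    using left_end_bounds[OF assms, of n] \<beta>_pos by (simp add: powr_powr end_bound_def)
qed

text \<open>For decreasing \<open>g\<close> this makes the function constant on
  \<open>(0, e]\<close> and leaves it unchanged on the rest of the interval.\<close>

definition truncate :: "real \<Rightarrow> (real \<Rightarrow> real) \<Rightarrow> real \<Rightarrow> real" where
  "truncate e g x = min (g x) (g e)"

text \<open>A bound for what truncation at \<open>e\<close> removes from any tame function. That it
  is one function for all of them is the source of the uniformity of the final error.\<close>

definition excess :: "real \<Rightarrow> real \<Rightarrow> real" where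
  "excess e x = indicator {0<..<e} x * (3 * x powr - \<beta>)"

definition flat :: "real \<Rightarrow> (real \<Rightarrow> real) \<Rightarrow> bool" where
  "flat e g \<longleftrightarrow> (\<forall>x. 0 < x \<longrightarrow> x \<le> e \<longrightarrow> g x = g e)"

text \<open>The invariant at the beginning of a block of steps: the exponent is still doubled from
  the last subtraction, but the function is constant near 0.\<close>

definition stage :: "real \<Rightarrow> (real \<Rightarrow> real) \<Rightarrow> bool" where
  "stage e g \<longleftrightarrow> tame g \<and> density_cone (2 * (1 + \<beta>)) g \<and> flat e g"

definition excess_mass :: "real \<Rightarrow> real" where
  "excess_mass e = 3 * e powr (1 - \<beta>) / (1 - \<beta>)"

lemma measurable_excess [measurable]: "excess e \<in> borel_measurable borel"
  unfolding excess_def by measurable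

lemma excess_nonneg: "0 \<le> excess e x"
  by (simp add: excess_def)

lemma excess_mass_nonneg: "0 \<le> excess_mass e"
  using \<beta>_less by (simp add: excess_mass_def)

lemma integral_excess:
  assumes "0 < e" "e \<le> 1"
  shows "integrable uniform (excess e)" "integral\<^sup>L uniform (excess e) = excess_mass e"
proof -
  show "integrable uniform (excess e)"
    by (intro integrable_uniform_dominated[where c = 3]) (auto simp: excess_def indicator_def)
  have "integral\<^sup>L uniform (excess e) = (LBINT x:{0<..<e}. 3 * x powr - \<beta>)"
    unfolding integral_uniform set_lebesgue_integral_def excess_def
    using assms by (intro Bochner_Integration.integral_cong) (auto simp: indicator_def)
  also have "\<dots> = excess_mass e"
    using powr_integral(2)[OF assms(1)] by (simp add: excess_mass_def)
  finally show "integral\<^sup>L uniform (excess e) = excess_mass e" .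
qed

lemma truncate_cone:
  assumes g: "density_cone p g" and e: "0 < e" "e < 1" and p: "0 \<le> p"
  shows "density_cone p (truncate e g)" "flat e (truncate e g)"
proof -
  note g' = coneD[OF g]
  have ge: "0 \<le> g e" using unit_nonnegD[OF g'(1) e] .
  show "density_cone p (truncate e g)"
    unfolding density_cone_def
  proof (intro conjI)
    show "unit_nonneg (truncate e g)"
      using g'(1) ge by (auto simp: unit_nonneg_def truncate_def)
    show "decreasing (truncate e g)"
      unfolding decreasing_def truncate_def
      by (intro allI impI min.mono order_refl) (rule decreasingD[OF g'(2)])
    show "weighted_inc p 1 (truncate e g)"
      unfolding weighted_inc_def
    proof (intro allI impI)
      fix x y :: real assume xy: "0 < x" "x \<le> y" "y < 1"
      have "x powr p * truncate e g x \<le> x powr p * g x" "x powr p * truncate e g x \<le> x powr p * g e"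
        by (auto simp: truncate_def intro!: mult_left_mono)
      moreover have "x powr p * g e \<le> y powr p * g e"
        using xy ge p by (intro mult_right_mono powr_mono2) auto
      ultimately show "x powr p * truncate e g x \<le> y powr p * truncate e g y"
        using weighted_incD[OF g'(3) xy] by (simp add: truncate_def min_def)
    qed
  qed
  show "flat e (truncate e g)"
    unfolding flat_def truncate_def
  proof (intro allI impI)
    fix x assume "0 < x" "x \<le> e"
    then show "min (g x) (g e) = min (g e) (g e)" using decreasingD[OF g'(2), of x e] e by simp
  qed
qed

lemma truncate_excess:
  assumes g: "decreasing g" "\<And>x. 0 < x \<Longrightarrow> x < 1 \<Longrightarrow> g x \<le> 3 * x powr - \<beta>" "unit_nonneg g"
    and e: "0 < e" "e < 1" and x: "0 < x" "x < 1"
  shows "truncate e g x \<le> g x" "g x \<le> truncate e g x + excess e x"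
proof -
  show "truncate e g x \<le> g x" by (simp add: truncate_def)
  show "g x \<le> truncate e g x + excess e x"
  proof (cases "x < e")
    case True
    then show ?thesis
      using g(2)[OF x] unit_nonnegD[OF g(3) e] unit_nonnegD[OF g(3) x] x by (simp add: truncate_def excess_def)
  next
    case False
    then show ?thesis using decreasingD[OF g(1), of e x] e x by (simp add: truncate_def excess_def)
  qed
qed

text \<open>Put \<open>X = x powr p\<close> and \<open>Y = y powr p\<close>. Bounding
  \<open>X * v x\<close> by \<open>Y * v y\<close> leaves the difference
  \<open>(Y - X) * (Y * v y - k * (Y + X))\<close>, which is nonnegative since
  \<open>Y + X \<le> 2 * Y\<close> and \<open>2 * k \<le> v y\<close>. Hence only half of the lower
  bound for \<open>v\<close> may be removed.\<close>

lemma subtract_const_cone: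
  assumes v: "density_cone p v" and k: "0 \<le> k" "\<And>x. 0 < x \<Longrightarrow> x < 1 \<Longrightarrow> 2 * k \<le> v x" and p: "0 \<le> p"
  shows "density_cone (2 * p) (\<lambda>x. v x - k)"
  unfolding density_cone_def
proof (intro conjI)
  note v' = coneD[OF v]
  show "unit_nonneg (\<lambda>x. v x - k)"
    using k by (fastforce simp: unit_nonneg_def)
  show "decreasing (\<lambda>x. v x - k)" using v'(2) by (auto simp: decreasing_def)
  show "weighted_inc (2 * p) 1 (\<lambda>x. v x - k)"
    unfolding weighted_inc_def
  proof (intro allI impI)
    fix x y :: real assume xy: "0 < x" "x \<le> y" "y < 1"
    define X Y where "X = x powr p" and "Y = y powr p"
    have XY: "0 < X" "X \<le> Y" using xy p by (auto simp: X_def Y_def intro!: powr_mono2)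
    have le: "X * v x \<le> Y * v y" unfolding X_def Y_def by (rule weighted_incD[OF v'(3) xy])
    have vy: "2 * k \<le> v y" using k xy by auto
    have "X\<^sup>2 * (v x - k) = X * (X * v x) - X\<^sup>2 * k" by (simp add: power2_eq_square algebra_simps)
    also have "\<dots> \<le> X * (Y * v y) - X\<^sup>2 * k" using le XY by (intro diff_right_mono mult_left_mono) auto
    also have "\<dots> \<le> Y\<^sup>2 * (v y - k)"
    proof -
      have "Y\<^sup>2 * (v y - k) - (X * (Y * v y) - X\<^sup>2 * k) = (Y - X) * (Y * v y - k * (Y + X))"
        by (simp add: power2_eq_square algebra_simps)
      moreover have "k * (Y + X) \<le> k * (2 * Y)" using XY k by (intro mult_left_mono) auto
      moreover have "k * (2 * Y) \<le> Y * v y" using mult_left_mono[OF vy, of Y] XY by (simp add: mult_ac)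
      ultimately show ?thesis using XY
        by (smt (verit) mult_nonneg_nonneg)
    qed
    finally have "X\<^sup>2 * (v x - k) \<le> Y\<^sup>2 * (v y - k)" .
    moreover have "z powr (2 * p) = (z powr p)\<^sup>2" for z :: real
      by (simp add: power2_eq_square powr_add[symmetric])
    ultimately show "x powr (2 * p) * (v x - k) \<le> y powr (2 * p) * (v y - k)"
      by (simp add: X_def Y_def)
  qed
qed

text \<open>A function that is constant on \<open>(0, e]\<close> has no more mass on
  \<open>(0, z)\<close> than on \<open>(z, e)\<close> when \<open>z \<le> e / 2\<close>. The lower
  bound \<open>transfer_iter_ge\<close> counts only mass beyond the left end point, and flatness
  guarantees that this is at least half.\<close>

lemma flat_half_mass:
  assumes g: "stage e g" and e: "0 < e" "e < 1" and z: "0 \<le> z" "z \<le> e / 2"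
  shows "1/2 * integral\<^sup>L uniform g \<le> (LBINT x:{z<..<1}. g x)"
proof -
  have t: "tame g" and f: "flat e g" using g by (auto simp: stage_def)
  note t' = tameD(1,2)[OF t]
  have z1: "z \<le> 1" "z \<le> e" "e \<le> 1" using z e by auto
  note s = integral_uniform_split[OF t'(1) tame_integrable[OF t] z(1) z1(1)]
  note s' = set_integral_split[OF t'(1) s(2) z1(2,3)]
  have fe: "g x \<le> g e" "g e \<le> g x" if "0 < x" "x \<le> e" for x
    using f that unfolding flat_def by (metis order_refl)+
  have "(LBINT x:{0<..<z}. g x) \<le> (z - 0) * g e"
    using z by (intro set_integral_Ioo_le_const s(1) fe(1)) auto
  also have "\<dots> \<le> (e - z) * g e"
    using z unit_nonnegD[OF t'(2) e] by (intro mult_right_mono) auto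
  also have "\<dots> \<le> (LBINT x:{z<..<e}. g x)"
    using z by (intro set_integral_Ioo_ge_const s'(1) fe(2)) auto
  also have "\<dots> \<le> (LBINT x:{z<..<1}. g x)"
    using s'(3) set_integral_Ioo_nonneg[OF t'(2), of e 1] e by simp
  finally show ?thesis using s(3) by simp
qed

text \<open>
  Subtracting a constant doubles the exponent, which the next \<open>q\<close> steps repair by
  \<open>cone_improve\<close>; truncation at \<open>e\<close> restores the flatness needed for that at the cost of \<open>excess e\<close>.
\<close>

lemma stage_step:
  assumes adm: "admissible \<beta> \<alpha>" and g: "stage e g" and e: "0 < e" "e < 1"
    and q: "end_bound q \<le> e / 2" and k: "0 \<le> k" "k \<le> 1/5184 * integral\<^sup>L uniform g"
  obtains u where "stage e u"
    "\<And>x. 0 < x \<Longrightarrow> x < 1 \<Longrightarrow> 0 \<le> transfer_iter q \<alpha> g x - k - u x \<and> transfer_iter q \<alpha> g x - k - u x \<le> excess e x"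
    "integral\<^sup>L uniform u \<le> integral\<^sup>L uniform g - k"
    "integral\<^sup>L uniform g - k - excess_mass e \<le> integral\<^sup>L uniform u"
proof -
  have t: "tame g" and f: "flat e g" and c: "density_cone (2 * (1 + \<beta>)) g"
    using g by (auto simp: stage_def)
  define v where "v = transfer_iter q \<alpha> g"
  define w where "w = (\<lambda>x. v x - k)"
  define u where "u = truncate e w"
  have le: "left_end q \<alpha> \<le> e / 2" using left_end_le[OF adm, of q] q by simp
  have le0: "0 \<le> left_end q \<alpha>" using left_end_bounds[OF adm, of q] by simp
  have "weighted_inc (1 + \<beta>) (e / 2) g"
    unfolding weighted_inc_def
  proof (intro allI impI)
    fix x y :: real assume xy: "0 < x" "x \<le> y" "y < e / 2"
    have "g x = g e" using f[unfolded flat_def, rule_format, of x] xy by linarith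
    moreover have "g y = g e" using f[unfolded flat_def, rule_format, of y] xy by linarith
    moreover have "0 \<le> g e" using unit_nonnegD[OF tameD(2)[OF t] e] .
    ultimately show "x powr (1 + \<beta>) * g x \<le> y powr (1 + \<beta>) * g y"
      using xy \<beta>_pos by (auto intro!: mult_right_mono powr_mono2)
  qed
  then have vc: "density_cone (1 + \<beta>) v"
    unfolding v_def using \<beta>_pos le by (intro cone_improve[OF adm c]) auto
  have vt: "tame v" unfolding v_def by (rule tame_transfer_iter[OF adm t])
  have vi: "integral\<^sup>L uniform v = integral\<^sup>L uniform g"
    unfolding v_def by (rule integral_transfer_iter(2)[OF adm tameD(1)[OF t] tame_integrable[OF t]])
  \<comment> \<open>The constant is 1/5184 = 1/1296 * 1/2 * 1/2: the spreading bound, the half of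
    the mass that it sees, and the factor 2 demanded by \<open>subtract_const_cone\<close>.\<close>
  have v2k: "2 * k \<le> v x" if x: "0 < x" "x < 1" for x
  proof -
    have "2 * k \<le> 1/1296 * (1/2 * integral\<^sup>L uniform g)" using k by simp
    also have "\<dots> \<le> 1/1296 * (LBINT y:{left_end q \<alpha><..<1}. g y)"
      by (intro mult_left_mono flat_half_mass[OF g e le0 le]) auto
    also have "\<dots> \<le> v x"
      unfolding v_def using \<beta>_pos \<beta>_less x
      by (intro transfer_iter_ge[OF adm _ _ c tameD(1)[OF t] tame_integrable[OF t]]) auto
    finally show ?thesis .
  qed
  have wc: "density_cone (2 * (1 + \<beta>)) w"
    unfolding w_def using \<beta>_pos v2k k by (intro subtract_const_cone[OF vc]) auto
  have wm: "w \<in> borel_measurable borel" unfolding w_def using tameD(1)[OF vt] by measurable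
  have "w x \<le> v x" for x using k by (simp add: w_def)
  then have wt: "tame w" by (intro tame_mono(1)[OF vt wm]) (use coneD[OF wc] in auto)
  have wi: "integral\<^sup>L uniform w = integral\<^sup>L uniform g - k"
    unfolding w_def using tame_integrable[OF vt] vi prob_space.prob_space[OF prob_space_uniform]
      prob_space.finite_measure[OF prob_space_uniform]
    by (subst Bochner_Integration.integral_diff) (auto intro: finite_measure.integrable_const)
  have uc: "density_cone (2 * (1 + \<beta>)) u" "flat e u"
    unfolding u_def using truncate_cone[OF wc e] \<beta>_pos by auto
  have um: "u \<in> borel_measurable borel" unfolding u_def truncate_def[abs_def] using wm by measurable
  have tr: "u x \<le> w x" "w x \<le> u x + excess e x" if "0 < x" "x < 1" for x
    unfolding u_def using truncate_excess[OF tameD(3)[OF wt] tameD(4)[OF wt] tameD(2)[OF wt] e that] by auto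
  have ut: "tame u" "integral\<^sup>L uniform u \<le> integral\<^sup>L uniform w"
    using tame_mono[OF wt um coneD(1,2)[OF uc(1)]] tr(1) by auto
  have "integral\<^sup>L uniform w \<le> integral\<^sup>L uniform (\<lambda>x. u x + excess e x)"
    using tr(2) e by (intro integral_mono tame_integrable[OF wt] Bochner_Integration.integrable_add tame_integrable[OF ut(1)] integral_excess) auto
  also have "\<dots> = integral\<^sup>L uniform u + excess_mass e"
    using integral_excess[of e] e tame_integrable[OF ut(1)] by simp
  finally have "integral\<^sup>L uniform g - k - excess_mass e \<le> integral\<^sup>L uniform u" using wi by simp
  moreover have "0 \<le> transfer_iter q \<alpha> g x - k - u x \<and> transfer_iter q \<alpha> g x - k - u x \<le> excess e x"
    if "0 < x" "x < 1" for x
    using tr[OF that] by (auto simp: w_def v_def)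
  ultimately show thesis
    using that[of u] uc ut wi by (auto simp: stage_def)
qed

text \<open>The pieces cut off at the end of each of \<open>k\<close> blocks, all carried forward to
  the common time \<open>k * q\<close>.\<close>

primrec excess_sum :: "real \<Rightarrow> nat \<Rightarrow> nat \<Rightarrow> (nat \<Rightarrow> real) \<Rightarrow> real \<Rightarrow> real" where
  "excess_sum e q 0 \<alpha> = (\<lambda>x. 0)"
| "excess_sum e q (Suc k) \<alpha> = (\<lambda>x. transfer_iter (k * q) (shift q \<alpha>) (excess e) x + excess_sum e q k (shift q \<alpha>) x)"

lemma excess_sum:
  assumes "0 < e" "e \<le> 1" "admissible \<beta> \<alpha>"
  shows "excess_sum e q k \<alpha> \<in> borel_measurable borel" "integrable uniform (excess_sum e q k \<alpha>)"
    "integral\<^sup>L uniform (excess_sum e q k \<alpha>) = real k * excess_mass e"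
    "0 < x \<Longrightarrow> x < 1 \<Longrightarrow> 0 \<le> excess_sum e q k \<alpha> x"
proof -
  have "excess_sum e q k \<alpha> \<in> borel_measurable borel \<and> integrable uniform (excess_sum e q k \<alpha>) \<and>
    integral\<^sup>L uniform (excess_sum e q k \<alpha>) = real k * excess_mass e \<and>
    (\<forall>x. 0 < x \<longrightarrow> x < 1 \<longrightarrow> 0 \<le> excess_sum e q k \<alpha> x)"
    using assms(3)
  proof (induction k arbitrary: \<alpha>)
    case (Suc k)
    have adm: "admissible \<beta> (shift q \<alpha>)" by (rule admissible_shift[OF Suc.prems])
    note IH = Suc.IH[OF adm]
    note m = measurable_transfer_iter[OF measurable_excess adm, of "k * q" e]
    note i = integral_transfer_iter[OF adm measurable_excess integral_excess(1)[OF assms(1,2)], of "k * q"]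
    have nn: "0 \<le> transfer_iter (k * q) (shift q \<alpha>) (excess e) x" if "0 < x" "x < 1" for x
      using that by (intro transfer_iter_nonneg[OF adm]) (auto simp: excess_nonneg)
    show ?case
      using IH m i nn integral_excess(2)[OF assms(1,2)] by (auto simp: ring_distribs)
  qed simp
  then show "excess_sum e q k \<alpha> \<in> borel_measurable borel" "integrable uniform (excess_sum e q k \<alpha>)"
    "integral\<^sup>L uniform (excess_sum e q k \<alpha>) = real k * excess_mass e"
    "0 < x \<Longrightarrow> x < 1 \<Longrightarrow> 0 \<le> excess_sum e q k \<alpha> x" by auto
qed

text \<open>In each block the same constant, the fraction \<open>c\<close> of the smaller mass, is
  subtracted from both functions, so it cancels in the difference. The truncations are done
  separately and let the masses drift apart by at most \<open>excess_mass e\<close> per block. As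
  the smaller mass is at least either mass minus \<open>d\<close>, the bound evolves by
  \<open>M \<mapsto> (1 - c) * M + c * d\<close>.\<close>

lemma stage_iterate:
  fixes c :: real
  defines "c \<equiv> 1/5184"
  assumes e: "0 < e" "e < 1" and q: "end_bound q \<le> e / 2"
    and "admissible \<beta> \<alpha>" "stage e g" "stage e h"
    and "integral\<^sup>L uniform g \<le> M" "integral\<^sup>L uniform h \<le> M"
    and "\<bar>integral\<^sup>L uniform g - integral\<^sup>L uniform h\<bar> \<le> d"
  shows "\<exists>g' h'. stage e g' \<and> stage e h' \<and>
    integral\<^sup>L uniform g' \<le> (1 - c) ^ k * M + (1 - (1 - c) ^ k) * d + real k * excess_mass e \<and>
    integral\<^sup>L uniform h' \<le> (1 - c) ^ k * M + (1 - (1 - c) ^ k) * d + real k * excess_mass e \<and>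
    (\<forall>x. 0 < x \<longrightarrow> x < 1 \<longrightarrow>
      \<bar>transfer_iter (k * q) \<alpha> g x - transfer_iter (k * q) \<alpha> h x - (g' x - h' x)\<bar> \<le> excess_sum e q k \<alpha> x)"
  using assms(5-)
proof (induction k arbitrary: \<alpha> g h M d)
  case 0
  then show ?case by auto
next
  case (Suc k)
  define \<kappa> where "\<kappa> = c * min (integral\<^sup>L uniform g) (integral\<^sup>L uniform h)"
  have nn: "0 \<le> integral\<^sup>L uniform g" "0 \<le> integral\<^sup>L uniform h"
    using Suc.prems(2,3) by (auto simp: stage_def tame_def intro!: unit_nonneg_integral_nonneg)
  have \<kappa>: "0 \<le> \<kappa>" "\<kappa> \<le> 1/5184 * integral\<^sup>L uniform g" "\<kappa> \<le> 1/5184 * integral\<^sup>L uniform h"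
    using nn by (auto simp: \<kappa>_def c_def)
  have adm: "admissible \<beta> (shift q \<alpha>)" by (rule admissible_shift[OF Suc.prems(1)])
  obtain g1 where g1: "stage e g1"
    "\<And>x. 0 < x \<Longrightarrow> x < 1 \<Longrightarrow> 0 \<le> transfer_iter q \<alpha> g x - \<kappa> - g1 x \<and> transfer_iter q \<alpha> g x - \<kappa> - g1 x \<le> excess e x"
    "integral\<^sup>L uniform g1 \<le> integral\<^sup>L uniform g - \<kappa>"
    "integral\<^sup>L uniform g - \<kappa> - excess_mass e \<le> integral\<^sup>L uniform g1"
    using stage_step[OF Suc.prems(1,2) e q \<kappa>(1,2)] by blast
  obtain h1 where h1: "stage e h1"
    "\<And>x. 0 < x \<Longrightarrow> x < 1 \<Longrightarrow> 0 \<le> transfer_iter q \<alpha> h x - \<kappa> - h1 x \<and> transfer_iter q \<alpha> h x - \<kappa> - h1 x \<le> excess e x"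
    "integral\<^sup>L uniform h1 \<le> integral\<^sup>L uniform h - \<kappa>"
    "integral\<^sup>L uniform h - \<kappa> - excess_mass e \<le> integral\<^sup>L uniform h1"
    using stage_step[OF Suc.prems(1,3) e q \<kappa>(1,3)] by blast
  let ?M = "(1 - c) * M + c * d" and ?d = "d + excess_mass e"
  have d: "0 \<le> d" using Suc.prems(6) by simp
  have mn: "integral\<^sup>L uniform g - d \<le> min (integral\<^sup>L uniform g) (integral\<^sup>L uniform h)"
    "integral\<^sup>L uniform h - d \<le> min (integral\<^sup>L uniform g) (integral\<^sup>L uniform h)"
    using Suc.prems(6) by auto
  have c: "0 \<le> c" "0 \<le> 1 - c" by (auto simp: c_def)
  have gM: "integral\<^sup>L uniform g1 \<le> ?M"
  proof -
    have "integral\<^sup>L uniform g1 \<le> integral\<^sup>L uniform g - c * (integral\<^sup>L uniform g - d)"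
      using g1(3) mult_left_mono[OF mn(1) c(1)] by (simp add: \<kappa>_def)
    also have "\<dots> = (1 - c) * integral\<^sup>L uniform g + c * d" by (simp add: algebra_simps)
    also have "\<dots> \<le> ?M" using mult_left_mono[OF Suc.prems(4) c(2)] by simp
    finally show ?thesis .
  qed
  have hM: "integral\<^sup>L uniform h1 \<le> ?M"
  proof -
    have "integral\<^sup>L uniform h1 \<le> integral\<^sup>L uniform h - c * (integral\<^sup>L uniform h - d)"
      using h1(3) mult_left_mono[OF mn(2) c(1)] by (simp add: \<kappa>_def)
    also have "\<dots> = (1 - c) * integral\<^sup>L uniform h + c * d" by (simp add: algebra_simps)
    also have "\<dots> \<le> ?M" using mult_left_mono[OF Suc.prems(5) c(2)] by simp
    finally show ?thesis .
  qed
  have dd: "\<bar>integral\<^sup>L uniform g1 - integral\<^sup>L uniform h1\<bar> \<le> ?d"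
    using g1(3,4) h1(3,4) Suc.prems(6) by linarith
  obtain g' h' where gh: "stage e g'" "stage e h'"
    "integral\<^sup>L uniform g' \<le> (1 - c) ^ k * ?M + (1 - (1 - c) ^ k) * ?d + real k * excess_mass e"
    "integral\<^sup>L uniform h' \<le> (1 - c) ^ k * ?M + (1 - (1 - c) ^ k) * ?d + real k * excess_mass e"
    "\<And>x. 0 < x \<Longrightarrow> x < 1 \<Longrightarrow>
      \<bar>transfer_iter (k * q) (shift q \<alpha>) g1 x - transfer_iter (k * q) (shift q \<alpha>) h1 x - (g' x - h' x)\<bar>
        \<le> excess_sum e q k (shift q \<alpha>) x"
    using Suc.IH[OF adm g1(1) h1(1) gM hM dd] by blast
  have bound: "(1 - c) ^ k * ?M + (1 - (1 - c) ^ k) * ?d + real k * excess_mass e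
    \<le> (1 - c) ^ Suc k * M + (1 - (1 - c) ^ Suc k) * d + real (Suc k) * excess_mass e"
  proof -
    have "(1 - (1 - c) ^ k) * excess_mass e \<le> 1 * excess_mass e"
      using c by (intro mult_right_mono excess_mass_nonneg) auto
    then show ?thesis by (simp add: algebra_simps)
  qed
  have "\<bar>transfer_iter (Suc k * q) \<alpha> g x - transfer_iter (Suc k * q) \<alpha> h x - (g' x - h' x)\<bar> \<le> excess_sum e q (Suc k) \<alpha> x"
    if x: "0 < x" "x < 1" for x
  proof -
    let ?L = "transfer_iter (k * q) (shift q \<alpha>)" and ?G = "transfer_iter q \<alpha> g" and ?H = "transfer_iter q \<alpha> h"
    \<comment> \<open>Both truncation errors lie between 0 and \<open>excess e\<close>, so their
      difference is bounded by \<open>excess e\<close> and not merely by its double.\<close>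
    have "\<bar>?L ?G x - ?L ?H x - (?L g1 x - ?L h1 x)\<bar> \<le> ?L (excess e) x"
    proof -
      have eq: "?L ?G x - ?L ?H x - (?L g1 x - ?L h1 x) = ?L (\<lambda>y. (?G y - ?H y) - (g1 y - h1 y)) x"
        by (simp only: transfer_iter_diff)
      have "?L (\<lambda>y. (?G y - ?H y) - (g1 y - h1 y)) x \<le> ?L (excess e) x"
        using g1(2) h1(2) x by (intro transfer_iter_mono[OF adm]) (auto, smt (verit))
      moreover have "?L (\<lambda>y. (-1) * excess e y) x \<le> ?L (\<lambda>y. (?G y - ?H y) - (g1 y - h1 y)) x"
        using g1(2) h1(2) x by (intro transfer_iter_mono[OF adm]) (auto, smt (verit))
      ultimately show ?thesis unfolding eq transfer_iter_cmult by simp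
    qed
    moreover have "transfer_iter (Suc k * q) \<alpha> f = ?L (transfer_iter q \<alpha> f)" for f
      by (simp add: transfer_iter_add)
    ultimately show ?thesis using gh(5)[OF x] by simp
  qed
  then show ?case using gh(1-4) bound by (intro exI[of _ g'] exI[of _ h']) auto
qed

text \<open>A density with the good exponent enters the first block after a single truncation; this
  accounts for the initial mass difference of at most \<open>excess_mass e\<close>.\<close>

lemma stage_truncate:
  assumes g: "tame g" "density_cone (1 + \<beta>) g" and e: "0 < e" "e < 1"
  shows "stage e (truncate e g)" "integral\<^sup>L uniform (truncate e g) \<le> integral\<^sup>L uniform g"
    "integral\<^sup>L uniform g \<le> integral\<^sup>L uniform (truncate e g) + excess_mass e"
proof -
  have m: "truncate e g \<in> borel_measurable borel"
    unfolding truncate_def[abs_def] using tameD(1)[OF g(1)] by measurable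
  have p: "0 \<le> 1 + \<beta>" using \<beta>_pos by simp
  note c = truncate_cone[OF g(2) e p]
  have tr: "truncate e g x \<le> g x" "g x \<le> truncate e g x + excess e x" if "0 < x" "x < 1" for x
    using truncate_excess[OF tameD(3)[OF g(1)] tameD(4)[OF g(1)] tameD(2)[OF g(1)] e that] by auto
  note t = tame_mono[OF g(1) m coneD(1,2)[OF c(1)] tr(1)]
  show "stage e (truncate e g)"
    using t(1) c cone_exponent_mono[OF c(1), of "2 * (1 + \<beta>)"] p by (simp add: stage_def)
  show "integral\<^sup>L uniform (truncate e g) \<le> integral\<^sup>L uniform g" using t(2) by simp
  have "integral\<^sup>L uniform g \<le> integral\<^sup>L uniform (\<lambda>x. truncate e g x + excess e x)"
    using tr(2) e t(1) by (intro integral_mono tame_integrable[OF g(1)] Bochner_Integration.integrable_add tame_integrable integral_excess) auto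
  also have "\<dots> = integral\<^sup>L uniform (truncate e g) + excess_mass e"
    using integral_excess[of e] e tame_integrable[OF t(1)] by simp
  finally show "integral\<^sup>L uniform g \<le> integral\<^sup>L uniform (truncate e g) + excess_mass e" .
qed

text \<open>A decreasing function of mass \<open>\<eta>\<close> lies below
  \<open>\<eta> / x\<close>. Turning the mass left after all blocks into a pointwise bound in this
  way costs the factor \<open>ln (1 / e)\<close>.\<close>

lemma integral_inverse_tail:
  assumes e: "0 < e" "e < 1"
  shows "integrable uniform (\<lambda>x. indicator {e..1} x * (\<eta> / x))"
    "integral\<^sup>L uniform (\<lambda>x. indicator {e..1} x * (\<eta> / x)) = \<eta> * ln (1 / e)"
proof -
  have "has_bochner_integral lborel (\<lambda>x. 1 / x * indicator {e..1} x) (ln 1 - ln e)"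
    using e by (intro has_bochner_integral_FTC_Icc_real)
      (auto intro!: derivative_eq_intros continuous_intros)
  then have *: "has_bochner_integral lborel (\<lambda>x. \<eta> * (1 / x * indicator {e..1} x)) (\<eta> * (ln 1 - ln e))"
    by (rule has_bochner_integral_mult_right)
  have "AE x in lborel. \<eta> * (1 / x * indicator {e..1} x) = indicator {0<..<1} x *\<^sub>R (indicator {e..1} x * (\<eta> / x))"
    using AE_lborel_singleton[of 1] by eventually_elim (use e in \<open>auto simp: indicator_def\<close>)
  then have "has_bochner_integral lborel (\<lambda>x. indicator {0<..<1} x *\<^sub>R (indicator {e..1} x * (\<eta> / x))) (\<eta> * (ln 1 - ln e))"
    using * by (subst has_bochner_integral_cong_AE[symmetric]) auto
  then show "integrable uniform (\<lambda>x. indicator {e..1} x * (\<eta> / x))"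
    "integral\<^sup>L uniform (\<lambda>x. indicator {e..1} x * (\<eta> / x)) = \<eta> * ln (1 / e)"
    using e by (auto simp: integrable_uniform integral_uniform set_integrable_def set_lebesgue_integral_def
        has_bochner_integral_iff ln_div)
qed

text \<open>
  The error function \<open>E\<close> does not depend on the densities. This makes it possible to let the
  density depend on the terminal point in the decoupling estimate.
\<close>

lemma memory_loss_stages:
  fixes k q n :: nat and e :: real
  defines "\<eta> \<equiv> (1 - 1/5184) ^ k + real (k + 1) * excess_mass e"
  assumes e: "0 < e" "e < 1" and q: "end_bound q \<le> e / 2" and adm: "admissible \<beta> \<alpha>" and n: "k * q \<le> n"
  obtains E where "E \<in> borel_measurable borel" "integrable uniform E"
    "integral\<^sup>L uniform E \<le> real (k + 3) * excess_mass e + 2 * \<eta> * ln (1 / e)"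
    "\<And>g h x. tame g \<Longrightarrow> density_cone (1 + \<beta>) g \<Longrightarrow> tame h \<Longrightarrow> density_cone (1 + \<beta>) h \<Longrightarrow>
      integral\<^sup>L uniform g = integral\<^sup>L uniform h \<Longrightarrow> 0 < x \<Longrightarrow> x < 1 \<Longrightarrow>
      \<bar>transfer_iter n \<alpha> g x - transfer_iter n \<alpha> h x\<bar> \<le> E x"
proof -
  \<comment> \<open>\<open>H\<close> dominates every function in \<open>stage e\<close> of mass at
    most \<open>\<eta>\<close>: below \<open>e\<close> by the tame bound, above \<open>e\<close> by
    the mass bound for decreasing functions.\<close>
  define H where "H = (\<lambda>x. excess e x + indicator {e..1} x * (\<eta> / x))"
  \<comment> \<open>The three summands pay for the initial truncation, for the truncations of the
    \<open>k\<close> blocks, and for the two functions that remain.\<close>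
  define E0 where "E0 = (\<lambda>x. transfer_iter (k * q) \<alpha> (excess e) x + excess_sum e q k \<alpha> x + 2 * H x)"
  define E where "E = transfer_iter (n - k * q) (shift (k * q) \<alpha>) E0"
  have e1: "e \<le> 1" using e by simp
  have adm': "admissible \<beta> (shift (k * q) \<alpha>)" by (rule admissible_shift[OF adm])
  have Hm: "H \<in> borel_measurable borel" unfolding H_def by measurable
  have Hi: "integrable uniform H" "integral\<^sup>L uniform H = excess_mass e + \<eta> * ln (1 / e)"
    unfolding H_def using integral_excess[OF e(1) e1] integral_inverse_tail[OF e, of \<eta>] by auto
  note S = excess_sum[OF e(1) e1 adm, of q k]
  note T = integral_transfer_iter[OF adm measurable_excess integral_excess(1)[OF e(1) e1], of "k * q"]
  have E0m: "E0 \<in> borel_measurable borel"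
    unfolding E0_def using S(1) Hm measurable_transfer_iter[OF measurable_excess adm, of "k * q" e] by measurable
  have E0i: "integrable uniform E0" unfolding E0_def using S(2) T(1) Hi(1) by simp
  have "integral\<^sup>L uniform E0 = excess_mass e + real k * excess_mass e + 2 * (excess_mass e + \<eta> * ln (1 / e))"
    unfolding E0_def using S(2,3) T Hi integral_excess(2)[OF e(1) e1] by simp
  also have "\<dots> = real (k + 3) * excess_mass e + 2 * \<eta> * ln (1 / e)" by (simp add: algebra_simps)
  finally have E0int: "integral\<^sup>L uniform E0 = real (k + 3) * excess_mass e + 2 * \<eta> * ln (1 / e)" .
  have uH: "u x \<le> H x" if u: "stage e u" "integral\<^sup>L uniform u \<le> \<eta>" and x: "0 < x" "x < 1" for u x
  proof -
    have t: "tame u" using u(1) by (simp add: stage_def)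
    show ?thesis
    proof (cases "x < e")
      case True
      then show ?thesis using tameD(4)[OF t x] x by (simp add: H_def excess_def)
    next
      case False
      have "x * u x \<le> \<eta>"
        using decreasing_le_mass[OF tameD(1-3)[OF t] tame_integrable[OF t] x] u(2) by linarith
      then have "u x \<le> \<eta> / x" using x by (simp add: pos_le_divide_eq mult.commute)
      then show ?thesis using False x by (simp add: H_def excess_def)
    qed
  qed
  have main: "\<bar>transfer_iter (k * q) \<alpha> g x - transfer_iter (k * q) \<alpha> h x\<bar> \<le> E0 x"
    if g: "tame g" "density_cone (1 + \<beta>) g" and h: "tame h" "density_cone (1 + \<beta>) h"
      and eq: "integral\<^sup>L uniform g = integral\<^sup>L uniform h" and x: "0 < x" "x < 1" for g h x
  proof -
    let ?u = "truncate e g" and ?v = "truncate e h" and ?L = "transfer_iter (k * q) \<alpha>"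
    note u = stage_truncate[OF g e] and v = stage_truncate[OF h e]
    have M: "integral\<^sup>L uniform ?u \<le> 1" "integral\<^sup>L uniform ?v \<le> 1"
      using u v tameD(5)[OF g(1)] tameD(5)[OF h(1)] by auto
    have d: "\<bar>integral\<^sup>L uniform ?u - integral\<^sup>L uniform ?v\<bar> \<le> excess_mass e"
      using u v eq by auto
    obtain g' h' where gh: "stage e g'" "stage e h'"
      "integral\<^sup>L uniform g' \<le> (1 - 1/5184) ^ k * 1 + (1 - (1 - 1/5184) ^ k) * excess_mass e + real k * excess_mass e"
      "integral\<^sup>L uniform h' \<le> (1 - 1/5184) ^ k * 1 + (1 - (1 - 1/5184) ^ k) * excess_mass e + real k * excess_mass e"
      "\<bar>?L ?u x - ?L ?v x - (g' x - h' x)\<bar> \<le> excess_sum e q k \<alpha> x"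
      using stage_iterate[OF e q adm u(1) v(1) M d, of k] x by blast
    have "(1 - (1 - 1/5184) ^ k) * excess_mass e \<le> 1 * excess_mass e"
      by (intro mult_right_mono excess_mass_nonneg) auto
    then have le: "integral\<^sup>L uniform g' \<le> \<eta>" "integral\<^sup>L uniform h' \<le> \<eta>"
      using gh(3,4) by (auto simp: \<eta>_def ring_distribs)
    have nn: "0 \<le> g' x" "0 \<le> h' x"
      using gh(1,2) x by (auto simp: stage_def tame_def unit_nonneg_def)
    have tr: "0 \<le> f y - truncate e f y \<and> f y - truncate e f y \<le> excess e y"
      if "tame f" "0 < y" "y < 1" for f y
      using truncate_excess[OF tameD(3)[OF that(1)] tameD(4)[OF that(1)] tameD(2)[OF that(1)] e that(2,3)] by auto
    have "\<bar>?L g x - ?L h x - (?L ?u x - ?L ?v x)\<bar> \<le> ?L (excess e) x"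
    proof -
      have eq: "?L g x - ?L h x - (?L ?u x - ?L ?v x) = ?L (\<lambda>y. (g y - h y) - (?u y - ?v y)) x"
        by (simp only: transfer_iter_diff)
      have "?L (\<lambda>y. (g y - h y) - (?u y - ?v y)) x \<le> ?L (excess e) x"
      proof (rule transfer_iter_mono[OF adm _ x])
        fix y :: real assume "0 < y" "y < 1"
        then show "(g y - h y) - (?u y - ?v y) \<le> excess e y" using tr[OF g(1), of y] tr[OF h(1), of y] by linarith
      qed
      moreover have "?L (\<lambda>y. (-1) * excess e y) x \<le> ?L (\<lambda>y. (g y - h y) - (?u y - ?v y)) x"
      proof (rule transfer_iter_mono[OF adm _ x])
        fix y :: real assume "0 < y" "y < 1"
        then show "(-1) * excess e y \<le> (g y - h y) - (?u y - ?v y)" using tr[OF g(1), of y] tr[OF h(1), of y] by linarith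
      qed
      ultimately show ?thesis unfolding eq transfer_iter_cmult by simp
    qed
    then show ?thesis
      using gh(5) uH[OF gh(1) le(1) x] uH[OF gh(2) le(2) x] nn unfolding E0_def by linarith
  qed
  show thesis
  proof (rule that[of E])
    show "E \<in> borel_measurable borel" unfolding E_def by (rule measurable_transfer_iter[OF E0m adm'])
    show "integrable uniform E" "integral\<^sup>L uniform E \<le> real (k + 3) * excess_mass e + 2 * \<eta> * ln (1 / e)"
      unfolding E_def using integral_transfer_iter[OF adm' E0m E0i] E0int by auto
  next
    fix g h :: "real \<Rightarrow> real" and x :: real
    assume *: "tame g" "density_cone (1 + \<beta>) g" "tame h" "density_cone (1 + \<beta>) h"
      "integral\<^sup>L uniform g = integral\<^sup>L uniform h" "0 < x" "x < 1"
    let ?R = "transfer_iter (n - k * q) (shift (k * q) \<alpha>)" and ?L = "transfer_iter (k * q) \<alpha>"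
    have split: "transfer_iter n \<alpha> f = ?R (?L f)" for f
      using transfer_iter_add[of "k * q" "n - k * q" \<alpha> f] n by simp
    have eq: "transfer_iter n \<alpha> g x - transfer_iter n \<alpha> h x = ?R (\<lambda>y. ?L g y - ?L h y) x"
      unfolding split by (simp only: transfer_iter_diff)
    have "?R (\<lambda>y. ?L g y - ?L h y) x \<le> ?R E0 x"
      using main[OF *(1-5)] *(6,7) by (intro transfer_iter_mono[OF adm']) (auto simp: abs_le_iff)
    moreover have "?R (\<lambda>y. (-1) * E0 y) x \<le> ?R (\<lambda>y. ?L g y - ?L h y) x"
    proof (rule transfer_iter_mono[OF adm' _ *(6,7)])
      fix y :: real assume "0 < y" "y < 1"
      then show "(-1) * E0 y \<le> ?L g y - ?L h y" using main[OF *(1-5), of y] by linarith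
    qed
    ultimately show "\<bar>transfer_iter n \<alpha> g x - transfer_iter n \<alpha> h x\<bar> \<le> E x"
      unfolding eq E_def transfer_iter_cmult by simp
  qed
qed

section \<open>Polynomial rate of the loss of memory\<close>

definition loss_rate :: "nat \<Rightarrow> real" where
  "loss_rate n = (real n / ln (real n)) powr (1 - 1 / \<beta>) * (ln (real n))\<^sup>2"

definition loss_bound :: "(nat \<Rightarrow> real) \<Rightarrow> nat \<Rightarrow> real \<Rightarrow> bool" where
  "loss_bound \<alpha> n r \<longleftrightarrow> (\<exists>E. E \<in> borel_measurable borel \<and> integrable uniform E \<and> integral\<^sup>L uniform E \<le> r \<and>
    (\<forall>g h x. tame g \<longrightarrow> density_cone (1 + \<beta>) g \<longrightarrow> tame h \<longrightarrow> density_cone (1 + \<beta>) h \<longrightarrow>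
      integral\<^sup>L uniform g = integral\<^sup>L uniform h \<longrightarrow> 0 < x \<longrightarrow> x < 1 \<longrightarrow>
      \<bar>transfer_iter n \<alpha> g x - transfer_iter n \<alpha> h x\<bar> \<le> E x))"

lemma loss_bound_mono: "loss_bound \<alpha> n r \<Longrightarrow> r \<le> s \<Longrightarrow> loss_bound \<alpha> n s"
  unfolding loss_bound_def by (meson order_trans)

lemma loss_bound_trivial:
  assumes adm: "admissible \<beta> \<alpha>"
  shows "loss_bound \<alpha> n (3 / (1 - \<beta>))"
proof -
  let ?E = "\<lambda>x::real. 3 * x powr - \<beta>"
  have i: "integrable uniform ?E"
    by (rule integrable_uniform_dominated[where c = 3]) auto
  have "integral\<^sup>L uniform ?E = 3 * (1 / (1 - \<beta>))"
    using powr_integral(2)[of 1] by (simp add: integral_uniform)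
  moreover have "\<bar>transfer_iter n \<alpha> g x - transfer_iter n \<alpha> h x\<bar> \<le> ?E x"
    if "tame g" "tame h" "0 < x" "x < 1" for g h x
    using tameD(4)[OF tame_transfer_iter[OF adm that(1)] that(3,4), of n]
      tameD(4)[OF tame_transfer_iter[OF adm that(2)] that(3,4), of n]
      unit_nonnegD[OF tameD(2)[OF tame_transfer_iter[OF adm that(1)]] that(3,4), of n]
      unit_nonnegD[OF tameD(2)[OF tame_transfer_iter[OF adm that(2)]] that(3,4), of n] by linarith
  ultimately show ?thesis
    unfolding loss_bound_def using i by (intro exI[of _ ?E]) auto
qed

text \<open>About \<open>A * ln n\<close> blocks of length \<open>q = n div k\<close> are used, so
  \<open>q\<close> is of order \<open>n / ln n\<close> and \<open>excess_mass e\<close> of order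
  \<open>(n / ln n) powr (1 - 1 / \<beta>)\<close>, because \<open>e\<close> is of order
  \<open>q powr (- 1 / \<beta>)\<close>. One further logarithm is the number of blocks and the other
  one is \<open>ln (1 / e)\<close>.\<close>

lemma memory_loss:
  obtains C where "0 < C" "\<And>\<alpha> n. admissible \<beta> \<alpha> \<Longrightarrow> 2 \<le> n \<Longrightarrow> loss_bound \<alpha> n (C * loss_rate n)"
proof -
  define a where "a = 1 / \<beta>"
  define c :: real where "c = 1/5184"
  \<comment> \<open>With at least \<open>A * ln n\<close> blocks,
    \<open>(1 - c) ^ k \<le> exp (- c * k) \<le> real n powr - a\<close>, which is smaller than the
    cost of the truncations.\<close>
  define A where "A = a / c"
  define A1 where "A1 = A + 1 / ln 2"
  define A2 where "A2 = A1 + 3 / ln 2"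
  define b0 where "b0 = \<beta> / (4 * A1)"
  define C1 where "C1 = 9 * b0 powr (1 - a)"
  define c3 where "c3 = (ln 2 :: real) powr (1 - a)"
  define C2 where "C2 = A2 * C1 / ln 2 + 4 * a * (c3 / ln 2 + A2 * C1)"
  define y0 where "y0 = A1 * (2 / \<beta> + 1)"
  define C3 where "C3 = 3 / (1 - \<beta>) / (y0 powr (1 - a) * (ln 2)\<^sup>2)"
  have a: "3 < a" using \<beta>_pos \<beta>_less by (simp add: a_def field_simps)
  have ln2: "0 < ln (2::real)" "ln (2::real) \<le> 1" using ln_2_less_1 by auto
  have A: "0 < A" "0 < A1" "0 < A2" using a ln2 by (auto simp: A_def A1_def A2_def c_def intro!: add_pos_pos)
  have b0: "0 < b0" using A \<beta>_pos by (simp add: b0_def)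
  have C1: "0 < C1" using b0 by (simp add: C1_def)
  have c3: "0 < c3" using ln2 by (simp add: c3_def)
  have C2: "0 < C2" using A C1 c3 ln2 a by (auto simp: C2_def intro!: add_pos_pos mult_pos_pos)
  have y0: "0 < y0" using A \<beta>_pos by (auto simp: y0_def intro!: mult_pos_pos add_pos_pos)
  have C3: "0 < C3" using y0 ln2 \<beta>_less by (simp add: C3_def)
  show thesis
  proof (rule that[of "max C2 C3"])
    show "0 < max C2 C3" using C2 by simp
    fix \<alpha> and n :: nat assume adm: "admissible \<beta> \<alpha>" and n: "2 \<le> n"
    define L where "L = ln (real n)"
    define y where "y = real n / L"
    define Y where "Y = y powr (1 - a)"
    have L: "ln 2 \<le> L" "0 < L" using n ln2 by (auto simp: L_def)
    have y: "0 < y" using n L by (simp add: y_def)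
    have Y: "0 < Y" using y by (simp add: Y_def)
    have rate: "loss_rate n = Y * L\<^sup>2" by (simp add: loss_rate_def Y_def y_def L_def a_def)
    define k where "k = nat \<lceil>A * L\<rceil>"
    define q where "q = n div k"
    have AL: "0 < A * L" using A L by simp
    have k: "A * L \<le> real k" "real k \<le> A * L + 1"
      unfolding k_def using AL by linarith+
    have k0: "0 < k" using k(1) AL by linarith
    have one: "1 \<le> 1 / ln 2 * L" using L ln2 by (simp add: field_simps)
    have AL1: "A1 * L = A * L + 1 / ln 2 * L" "A2 * L = A1 * L + 3 * (1 / ln 2 * L)"
      by (simp_all add: A1_def A2_def algebra_simps)
    have kA: "real k \<le> A1 * L" using k(2) one AL1 by linarith
    have kA2: "real k + 3 \<le> A2 * L" using kA one AL1 by linarith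
    show "loss_bound \<alpha> n (max C2 C3 * loss_rate n)"
    proof (cases "real q \<ge> 2 / \<beta>")
      \<comment> \<open>Blocks this short need not admit a cut below 1. But then
        \<open>n / ln n\<close> is at most \<open>y0\<close>, the claimed rate is bounded below, and
        \<open>C3\<close> is chosen so that the trivial bound suffices.\<close>
      case False
      have "real n < real k * (real q + 1)"
        using k0 dividend_less_div_times[of k n] unfolding q_def
        by (metis (no_types, opaque_lifting) add.commute distrib_left mult.commute mult.right_neutral of_nat_1 of_nat_add of_nat_less_iff of_nat_mult)
      also have "\<dots> \<le> (A1 * L) * (2 / \<beta> + 1)" using kA False by (intro mult_mono) auto
      finally have "y \<le> y0" using L by (simp add: y_def y0_def pos_divide_le_eq mult_ac)
      then have "y0 powr (1 - a) \<le> Y" unfolding Y_def using y a by (intro powr_mono2') auto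
      then have "y0 powr (1 - a) * (ln 2)\<^sup>2 \<le> Y * L\<^sup>2"
        using L ln2 Y by (intro mult_mono power_mono) auto
      then have "C3 * (y0 powr (1 - a) * (ln 2)\<^sup>2) \<le> C3 * loss_rate n"
        unfolding rate using C3 by (intro mult_left_mono) auto
      moreover have "C3 * (y0 powr (1 - a) * (ln 2)\<^sup>2) = 3 / (1 - \<beta>)"
        using y0 ln2 by (simp add: C3_def)
      moreover have "C3 * loss_rate n \<le> max C2 C3 * loss_rate n"
        using Y by (intro mult_right_mono) (auto simp: rate)
      ultimately show ?thesis by (intro loss_bound_mono[OF loss_bound_trivial[OF adm]]) linarith
    next
      case True
      \<comment> \<open>The smallest cut that a block of \<open>q\<close> steps admits; the case
        assumption on \<open>q\<close> makes it less than 1.\<close>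
      define e where "e = 2 * end_bound q"
      have bq: "1 \<le> \<beta> / 2 * real q" using True \<beta>_pos by (simp add: field_simps)
      have e0: "0 < e" using \<beta>_pos by (simp add: e_def end_bound_def add_nonneg_eq_0_iff)
      have e1: "e < 1"
      proof -
        have "end_bound q = (1 + \<beta> / 2 * real q) powr (- a)" by (simp add: end_bound_def a_def)
        also have "\<dots> \<le> 2 powr (- a)" using bq a by (intro powr_mono2') auto
        also have "\<dots> < 2 powr (- 1)" using a by (intro powr_less_mono) auto
        finally show ?thesis by (simp add: e_def)
      qed
      have q1: "1 \<le> real q" using True a by (simp add: a_def field_simps)
      have "real n \<le> real k * (2 * real q)"
      proof -
        have "real n < real k * (real q + 1)"
          using k0 dividend_less_div_times[of k n] unfolding q_def
          by (metis (no_types, opaque_lifting) add.commute distrib_left mult.commute mult.right_neutral of_nat_1 of_nat_add of_nat_less_iff of_nat_mult)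
        also have "\<dots> \<le> real k * (2 * real q)" using q1 by (intro mult_left_mono) auto
        finally show ?thesis by simp
      qed
      also have "\<dots> \<le> (A1 * L) * (2 * real q)" using kA by (intro mult_right_mono) auto
      finally have "y \<le> A1 * (2 * real q)" using L by (simp add: y_def pos_divide_le_eq mult_ac)
      then have "b0 * y \<le> b0 * (A1 * (2 * real q))" using b0 by (intro mult_left_mono) auto
      also have "\<dots> \<le> 1 + \<beta> / 2 * real q" using A by (simp add: b0_def)
      finally have ylow: "b0 * y \<le> 1 + \<beta> / 2 * real q" .
      have eb: "e powr (1 - \<beta>) \<le> 2 * (b0 powr (1 - a) * Y)"
      proof -
        have ex: "- 1 / \<beta> * (1 - \<beta>) = 1 - a" using \<beta>_pos by (simp add: a_def field_simps)
        have "e powr (1 - \<beta>) = 2 powr (1 - \<beta>) * (1 + \<beta> / 2 * real q) powr (1 - a)"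
          unfolding e_def end_bound_def powr_mult powr_powr ex ..
        also have "\<dots> \<le> 2 powr 1 * (b0 * y) powr (1 - a)"
          using ylow b0 y a \<beta>_pos by (intro mult_mono powr_mono powr_mono2') auto
        also have "\<dots> = 2 * (b0 powr (1 - a) * Y)" by (simp add: powr_mult Y_def)
        finally show ?thesis .
      qed
      have d: "excess_mass e \<le> C1 * Y"
      proof -
        have "excess_mass e \<le> 3 * (2 * (b0 powr (1 - a) * Y)) / (2/3)"
          unfolding excess_mass_def
        proof (rule frac_le)
          show "0 \<le> 3 * (2 * (b0 powr (1 - a) * Y))" using Y by simp
          show "3 * e powr (1 - \<beta>) \<le> 3 * (2 * (b0 powr (1 - a) * Y))" using eb by linarith
        qed (use \<beta>_less in auto)
        then show ?thesis by (simp add: C1_def mult_ac)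
      qed
      have kpow: "(1 - c) ^ k \<le> c3 * Y"
      proof -
        have "(1 - c) ^ k \<le> exp (- c) ^ k"
          using exp_ge_add_one_self[of "- c"] by (intro power_mono) (auto simp: c_def)
        also have "\<dots> = exp (- (c * real k))" by (simp add: exp_of_nat_mult[symmetric] mult.commute)
        also have "\<dots> \<le> exp (- a * L)"
        proof -
          have "a * L = c * (A * L)" by (simp add: A_def c_def)
          also have "\<dots> \<le> c * real k" using k(1) by (intro mult_left_mono) (auto simp: c_def)
          finally show ?thesis by simp
        qed
        also have "\<dots> = real n powr (- a)" using n by (simp add: powr_def L_def)
        also have "\<dots> \<le> real n powr (1 - a)" using n by (intro powr_mono) auto
        also have "\<dots> = (y * L) powr (1 - a)" using L by (simp add: y_def)
        also have "\<dots> = Y * L powr (1 - a)" by (simp add: powr_mult Y_def)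
        also have "\<dots> \<le> Y * c3" unfolding c3_def using Y L ln2 a by (intro mult_left_mono powr_mono2') auto
        finally show ?thesis by (simp add: mult.commute)
      qed
      have lne: "ln (1 / e) \<le> 2 * a * L"
      proof -
        have "1 / e \<le> (real n * real n) powr a"
        proof -
          have "1 / e = (1 + \<beta> / 2 * real q) powr a / 2"
            by (simp add: e_def end_bound_def a_def powr_minus_divide)
          also have "\<dots> \<le> (1 + \<beta> / 2 * real q) powr a" by simp
          also have "\<dots> \<le> (real n * real n) powr a"
          proof (rule powr_mono2)
            have "\<beta> / 2 * real q \<le> 1 * real n"
              using \<beta>_pos \<beta>_less div_le_dividend[of n k] by (intro mult_mono) (auto simp: q_def)
            moreover have "1 + real n \<le> real n * real n"
            proof -
              have "2 * real n \<le> real n * real n" using n by (intro mult_right_mono) auto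
              then show ?thesis using n by linarith
            qed
            ultimately show "1 + \<beta> / 2 * real q \<le> real n * real n" by simp
          qed (use a \<beta>_pos in auto)
          finally show ?thesis .
        qed
        then have "ln (1 / e) \<le> ln ((real n * real n) powr a)" using e0 n by (subst ln_le_cancel_iff) auto
        also have "\<dots> = 2 * a * L" using n by (simp add: ln_mult L_def)
        finally show ?thesis .
      qed
      define \<eta> where "\<eta> = (1 - 1/5184) ^ k + real (k + 1) * excess_mass e"
      have \<eta>: "\<eta> \<le> (c3 / ln 2 + A2 * C1) * (L * Y)"
      proof -
        have "\<eta> \<le> c3 * Y + (A2 * L) * (C1 * Y)"
          unfolding \<eta>_def using kpow kA2 d A L C1 Y excess_mass_nonneg[of e]
          by (intro add_mono mult_mono) (auto simp: c_def)
        moreover have "c3 * Y * 1 \<le> c3 * Y * (1 / ln 2 * L)"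
          using one c3 Y by (intro mult_left_mono) auto
        ultimately show ?thesis by (simp add: algebra_simps)
      qed
      have \<eta>0: "0 \<le> \<eta>" using excess_mass_nonneg[of e] by (auto simp: \<eta>_def)
      have lb: "loss_bound \<alpha> n (real (k + 3) * excess_mass e + 2 * \<eta> * ln (1 / e))"
      proof -
        have "end_bound q \<le> e / 2" by (simp add: e_def)
        moreover have "k * q \<le> n" by (simp add: q_def)
        ultimately obtain E where "E \<in> borel_measurable borel" "integrable uniform E"
          "integral\<^sup>L uniform E \<le> real (k + 3) * excess_mass e + 2 * \<eta> * ln (1 / e)"
          "\<And>g h x. tame g \<Longrightarrow> density_cone (1 + \<beta>) g \<Longrightarrow> tame h \<Longrightarrow> density_cone (1 + \<beta>) h \<Longrightarrow>
            integral\<^sup>L uniform g = integral\<^sup>L uniform h \<Longrightarrow> 0 < x \<Longrightarrow> x < 1 \<Longrightarrow>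
            \<bar>transfer_iter n \<alpha> g x - transfer_iter n \<alpha> h x\<bar> \<le> E x"
          using memory_loss_stages[OF e0 e1 _ adm, of q k n] unfolding \<eta>_def by metis
        then show ?thesis unfolding loss_bound_def by blast
      qed
      have "real (k + 3) * excess_mass e \<le> (A2 * L) * (C1 * Y)"
        using kA2 d A L C1 Y excess_mass_nonneg[of e] by (intro mult_mono) auto
      also have "\<dots> \<le> (A2 * L) * (C1 * Y) * (1 / ln 2 * L)"
        using mult_left_mono[OF one, of "(A2 * L) * (C1 * Y)"] A L C1 Y by simp
      finally have p1: "real (k + 3) * excess_mass e \<le> A2 * C1 / ln 2 * (Y * L\<^sup>2)"
        by (simp add: power2_eq_square mult_ac)
      have "2 * \<eta> * ln (1 / e) \<le> 2 * ((c3 / ln 2 + A2 * C1) * (L * Y)) * (2 * a * L)"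
        using \<eta> \<eta>0 lne e0 e1 by (intro mult_mono mult_left_mono) auto
      also have "\<dots> = 4 * a * (c3 / ln 2 + A2 * C1) * (Y * L\<^sup>2)"
        by (simp add: power2_eq_square mult_ac)
      finally have "real (k + 3) * excess_mass e + 2 * \<eta> * ln (1 / e) \<le> C2 * (Y * L\<^sup>2)"
        using p1 by (simp add: C2_def ring_distribs)
      also have "\<dots> \<le> max C2 C3 * loss_rate n"
        unfolding rate using Y by (intro mult_right_mono) auto
      finally show ?thesis by (rule loss_bound_mono[OF lb])
    qed
  qed
qed

end

section \<open>Cylinder approximations and decoupling\<close>

text \<open>A canonical representative of the cylinder of length \<open>m\<close> that contains
  \<open>x\<close>: the point with the same first \<open>m\<close> branches whose
  \<open>m\<close>-th image is 1/2. Evaluating at this point takes the place of conditioning on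
  cylinders.\<close>

primrec proj :: "nat \<Rightarrow> (nat \<Rightarrow> real) \<Rightarrow> real \<Rightarrow> real" where
  "proj 0 \<alpha> x = 1/2"
| "proj (Suc m) \<alpha> x =
    (if x < 1/2 then left_inv (\<alpha> 1) (proj m (shift 1 \<alpha>) (intermittent_map (\<alpha> 1) x))
     else (1 + proj m (shift 1 \<alpha>) (intermittent_map (\<alpha> 1) x)) / 2)"

lemma proj_unit: "admissible \<beta> \<alpha> \<Longrightarrow> 0 < proj m \<alpha> x \<and> proj m \<alpha> x < 1"
proof (induction m arbitrary: \<alpha> x)
  case (Suc m)
  have a: "0 \<le> \<alpha> 1" using admissible_1[OF Suc.prems] by simp
  have "0 < proj m (shift 1 \<alpha>) y \<and> proj m (shift 1 \<alpha>) y < 1" for y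
    by (rule Suc.IH[OF admissible_shift[OF Suc.prems]])
  then show ?case using left_inv_unit[OF a] by (auto simp: add_pos_pos)
qed simp

lemma intermittent_map_unit:
  assumes "0 \<le> a" "0 \<le> x" "x \<le> 1"
  shows "0 \<le> intermittent_map a x" "intermittent_map a x \<le> 1"
proof -
  have "0 \<le> intermittent_map a x \<and> intermittent_map a x \<le> 1"
  proof (cases "x < 1/2")
    case True
    have "left_branch a 0 \<le> left_branch a x" "left_branch a x \<le> left_branch a (1/2)"
      unfolding strict_mono_less_eq[OF strict_mono_left_branch[OF assms(1)]] using assms True by auto
    then show ?thesis using left_branch_eq_intermittent_map[OF assms(2) True, of a] by simp
  next
    case False
    then show ?thesis using assms by (simp add: intermittent_map_def)
  qed
  then show "0 \<le> intermittent_map a x" "intermittent_map a x \<le> 1" by auto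
qed

lemma intermittent_iter_unit:
  "admissible \<beta> \<alpha> \<Longrightarrow> 0 \<le> x \<Longrightarrow> x \<le> 1 \<Longrightarrow> 0 \<le> intermittent_iter \<alpha> n x \<and> intermittent_iter \<alpha> n x \<le> 1"
proof (induction n)
  case (Suc n)
  then show ?case using intermittent_map_unit[of "\<alpha> (Suc n)"] by (auto simp: admissible_def)
qed simp

text \<open>The left branch is superadditive on nonnegative numbers, so its inverse is subadditive:
  among intervals of a given length, the one touching 0 has the longest preimage.\<close>

lemma left_inv_diff_le:
  assumes a: "0 \<le> a" and u: "0 \<le> u" "u \<le> w"
  shows "left_inv a w - left_inv a u \<le> left_inv a (w - u)"
proof -
  define p r where "p = left_inv a u" and "r = left_inv a w - left_inv a u"
  have pr: "0 \<le> p" "0 \<le> r" using a u left_inv_le_iff[OF a, of u w] by (auto simp: p_def r_def)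
  have "left_branch a p + left_branch a r \<le> left_branch a (p + r)"
  proof -
    have "p * (1 + (2 * p) powr a) + r * (1 + (2 * r) powr a)
        \<le> p * (1 + (2 * (p + r)) powr a) + r * (1 + (2 * (p + r)) powr a)"
      using pr a by (intro add_mono mult_left_mono powr_mono2 add_left_mono) auto
    then show ?thesis by (simp add: left_branch_def ring_distribs)
  qed
  then have "left_branch a r \<le> w - u" using a by (simp add: p_def r_def)
  then have "left_inv a (left_branch a r) \<le> left_inv a (w - u)" using left_inv_le_iff[OF a] by simp
  then show ?thesis using a by (simp add: r_def)
qed

lemma abs_left_inv_diff_le:
  assumes a: "0 \<le> a" and u: "0 \<le> u" "0 \<le> w" "\<bar>u - w\<bar> \<le> d"
  shows "\<bar>left_inv a u - left_inv a w\<bar> \<le> left_inv a d"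
proof (cases "u \<le> w")
  case True
  have "left_inv a (w - u) \<le> left_inv a d" using left_inv_le_iff[OF a] u True by simp
  then show ?thesis using left_inv_diff_le[OF a u(1) True] left_inv_le_iff[OF a, of u w] True by simp
next
  case False
  have "left_inv a (u - w) \<le> left_inv a d" using left_inv_le_iff[OF a] u False by simp
  then show ?thesis using left_inv_diff_le[OF a u(2), of u] left_inv_le_iff[OF a, of w u] False by simp
qed

lemma half_le_left_inv:
  assumes a: "0 \<le> a" and t: "0 \<le> t" "t \<le> 1"
  shows "t / 2 \<le> left_inv a t"
proof -
  have "left_branch a (t / 2) \<le> t / 2 * 2"
    unfolding left_branch_def using t a by (intro mult_left_mono) (auto intro: powr_le1)
  then have "left_inv a (left_branch a (t / 2)) \<le> left_inv a t" using left_inv_le_iff[OF a] by simp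
  then show ?thesis using a by simp
qed

text \<open>In a left step the distance grows backwards at most as it does at 0, by subadditivity of
  the inverse. In a right step it is halved, which by \<open>half_le_left_inv\<close> is no worse.
  Hence the cylinder at the neutral fixed point is the extreme case.\<close>

lemma proj_dist:
  "admissible \<beta> \<alpha> \<Longrightarrow> 0 \<le> x \<Longrightarrow> x \<le> 1 \<Longrightarrow> \<bar>x - proj m \<alpha> x\<bar> \<le> left_end m \<alpha>"
proof (induction m arbitrary: \<alpha> x)
  case 0
  then show ?case by (simp add: abs_if)
next
  case (Suc m)
  have a: "0 \<le> \<alpha> 1" using admissible_1[OF Suc.prems(1)] by simp
  have adm: "admissible \<beta> (shift 1 \<alpha>)" by (rule admissible_shift[OF Suc.prems(1)])
  let ?T = "intermittent_map (\<alpha> 1) x"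
  note T = intermittent_map_unit[OF a Suc.prems(2,3)]
  note IH = Suc.IH[OF adm T]
  show ?case
  proof (cases "x < 1/2")
    case True
    have x: "x = left_inv (\<alpha> 1) ?T"
      using left_branch_eq_intermittent_map[OF Suc.prems(2) True, of "\<alpha> 1"] left_inv_branch[OF a, of x] by simp
    have "\<bar>left_inv (\<alpha> 1) ?T - left_inv (\<alpha> 1) (proj m (shift 1 \<alpha>) ?T)\<bar> \<le> left_inv (\<alpha> 1) (left_end m (shift 1 \<alpha>))"
      using proj_unit[OF adm, of m ?T] T IH by (intro abs_left_inv_diff_le[OF a]) auto
    then show ?thesis by (simp only: proj.simps left_end.simps True if_True x[symmetric])
  next
    case False
    have x: "x = (1 + ?T) / 2" using False by (simp add: intermittent_map_def)
    have "\<bar>x - (1 + proj m (shift 1 \<alpha>) ?T) / 2\<bar> = \<bar>?T - proj m (shift 1 \<alpha>) ?T\<bar> / 2"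
      by (subst x) (simp add: abs_if field_simps)
    also have "\<dots> \<le> left_end m (shift 1 \<alpha>) / 2" using IH by simp
    also have "\<dots> \<le> left_inv (\<alpha> 1) (left_end m (shift 1 \<alpha>))"
      using left_end_bounds[OF adm, of m] by (intro half_le_left_inv[OF a]) auto
    finally show ?thesis using False by simp
  qed
qed

lemma intermittent_map_proj:
  assumes adm: "admissible \<beta> \<alpha>"
  shows "intermittent_map (\<alpha> 1) (proj (Suc m) \<alpha> x) = proj m (shift 1 \<alpha>) (intermittent_map (\<alpha> 1) x)"
proof -
  have a: "0 \<le> \<alpha> 1" using admissible_1[OF adm] by simp
  have p: "0 < proj m (shift 1 \<alpha>) y" "proj m (shift 1 \<alpha>) y < 1" for y
    using proj_unit[OF admissible_shift[OF adm]] by auto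
  show ?thesis
    using intermittent_map_left_inv[OF a p] intermittent_map_right[OF less_imp_le[OF p(1)]] by simp
qed

lemma intermittent_iter_proj:
  "admissible \<beta> \<alpha> \<Longrightarrow> i \<le> m \<Longrightarrow>
    intermittent_iter \<alpha> i (proj m \<alpha> x) = proj (m - i) (shift i \<alpha>) (intermittent_iter \<alpha> i x)"
proof (induction i arbitrary: \<alpha> m x)
  case (Suc i)
  then obtain m' where m: "m = Suc m'" "i \<le> m'" by (cases m) auto
  have "intermittent_iter \<alpha> (Suc i) (proj m \<alpha> x)
      = intermittent_iter (shift 1 \<alpha>) i (intermittent_map (\<alpha> 1) (proj (Suc m') \<alpha> x))"
    unfolding intermittent_iter_Suc_shift m(1) ..
  also have "\<dots> = proj (m' - i) (shift i (shift 1 \<alpha>)) (intermittent_iter (shift 1 \<alpha>) i (intermittent_map (\<alpha> 1) x))"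
    unfolding intermittent_map_proj[OF Suc.prems(1)]
    by (rule Suc.IH[OF admissible_shift[OF Suc.prems(1)] m(2)])
  finally show ?case unfolding intermittent_iter_Suc_shift m(1) by simp
qed simp

text \<open>The representative takes only finitely many values, each on a Borel set, so any function
  of it is Borel. The induction uses this freedom by letting \<open>\<Phi>\<close> absorb the
  inverse branches.\<close>

lemma measurable_proj:
  "admissible \<beta> \<alpha> \<Longrightarrow> (\<lambda>x. \<Phi> (proj m \<alpha> x) :: real) \<in> borel_measurable borel"
proof (induction m arbitrary: \<alpha> \<Phi>)
  case (Suc m)
  note IH = Suc.IH[OF admissible_shift[OF Suc.prems]]
  have [measurable]: "(\<lambda>x. \<Phi> (left_inv (\<alpha> 1) (proj m (shift 1 \<alpha>) (intermittent_map (\<alpha> 1) x)))) \<in> borel_measurable borel"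
    by (rule measurable_compose[OF measurable_intermittent_map IH[of "\<lambda>p. \<Phi> (left_inv (\<alpha> 1) p)"]])
  have [measurable]: "(\<lambda>x. \<Phi> ((1 + proj m (shift 1 \<alpha>) (intermittent_map (\<alpha> 1) x)) / 2)) \<in> borel_measurable borel"
    by (rule measurable_compose[OF measurable_intermittent_map IH[of "\<lambda>p. \<Phi> ((1 + p) / 2)"]])
  have eq: "(\<lambda>x. \<Phi> (proj (Suc m) \<alpha> x)) =
     (\<lambda>x. if x < 1/2 then \<Phi> (left_inv (\<alpha> 1) (proj m (shift 1 \<alpha>) (intermittent_map (\<alpha> 1) x)))
       else \<Phi> ((1 + proj m (shift 1 \<alpha>) (intermittent_map (\<alpha> 1) x)) / 2))"
    by (auto simp: fun_eq_iff)
  show ?case unfolding eq by measurable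
qed simp

text \<open>Weights that are constant on cylinder sets preserve the cone, because each inverse branch
  preserves it separately.\<close>

lemma cone_transfer_iter_proj:
  assumes "admissible \<beta> \<alpha>" "1 + \<beta> \<le> p" "density_cone p g" "\<And>y. 0 \<le> \<Phi> y"
  shows "density_cone p (transfer_iter m \<alpha> (\<lambda>x. \<Phi> (proj m \<alpha> x) * g x))"
  using assms
proof (induction m arbitrary: \<alpha> g \<Phi>)
  case 0
  then show ?case using cone_cmult[of p g "\<Phi> (1/2)"] by simp
next
  case (Suc m)
  let ?s = "shift 1 \<alpha>" and ?a = "\<alpha> 1"
  have a: "0 \<le> ?a" "?a \<le> \<beta>" using admissible_1[OF Suc.prems(1)] by auto
  have adm: "admissible \<beta> ?s" by (rule admissible_shift[OF Suc.prems(1)])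
  let ?G = "\<lambda>x. \<Phi> (left_inv ?a (proj m ?s x)) * left_part ?a g x"
  let ?H = "\<lambda>x. \<Phi> ((1 + proj m ?s x) / 2) * right_part g x"
  have "density_cone p (transfer_iter m ?s ?G)"
    using Suc.prems a by (intro Suc.IH[OF adm, where \<Phi> = "\<lambda>y. \<Phi> (left_inv ?a y)"] cone_left_part) auto
  moreover have "density_cone p (transfer_iter m ?s ?H)"
    using Suc.prems a by (intro Suc.IH[OF adm, where \<Phi> = "\<lambda>y. \<Phi> ((1 + y) / 2)"] cone_right_part) auto
  ultimately have "density_cone p (\<lambda>x. transfer_iter m ?s ?G x + transfer_iter m ?s ?H x)"
    by (rule cone_add)
  then have c: "density_cone p (transfer_iter m ?s (\<lambda>x. ?G x + ?H x))"
    by (simp only: transfer_iter_add_fun[abs_def])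
  have eq: "?G x + ?H x = transfer ?a (\<lambda>x. \<Phi> (proj (Suc m) \<alpha> x) * g x) x" if x: "0 < x" "x < 1" for x
  proof -
    have l: "proj (Suc m) \<alpha> (left_inv ?a x) = left_inv ?a (proj m ?s x)"
      unfolding proj.simps using left_inv_unit(2)[OF a(1) x] intermittent_map_left_inv[OF a(1) x] by simp
    have r: "proj (Suc m) \<alpha> ((1 + x) / 2) = (1 + proj m ?s x) / 2"
      unfolding proj.simps using x intermittent_map_right[of x ?a] by simp
    show ?thesis
      unfolding transfer_def left_part_def right_part_def l r by simp
  qed
  show ?case
    unfolding transfer_iter.simps
    by (rule cone_cong[OF c]) (rule transfer_iter_cong[OF adm eq])
qed

context subcritical
begin

lemma tame_transfer_iter_proj:
  assumes adm: "admissible \<beta> \<alpha>" and g: "tame g" "density_cone (1 + \<beta>) g"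
    and \<Phi>: "\<And>y. 0 \<le> \<Phi> y" "\<And>y. \<Phi> y \<le> 1"
  shows "tame (transfer_iter m \<alpha> (\<lambda>x. \<Phi> (proj m \<alpha> x) * g x))"
proof (rule tame_mono(1)[OF tame_transfer_iter[OF adm g(1)]])
  have [measurable]: "(\<lambda>x. \<Phi> (proj m \<alpha> x)) \<in> borel_measurable borel" by (rule measurable_proj[OF adm])
  have [measurable]: "g \<in> borel_measurable borel" by (rule tameD(1)[OF g(1)])
  show "transfer_iter m \<alpha> (\<lambda>x. \<Phi> (proj m \<alpha> x) * g x) \<in> borel_measurable borel"
    by (rule measurable_transfer_iter[OF _ adm]) measurable
  have "density_cone (1 + \<beta>) (transfer_iter m \<alpha> (\<lambda>x. \<Phi> (proj m \<alpha> x) * g x))"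
    by (rule cone_transfer_iter_proj[where \<Phi> = \<Phi>, OF adm order_refl g(2) \<Phi>(1)])
  note c = coneD[OF this]
  show "unit_nonneg (transfer_iter m \<alpha> (\<lambda>x. \<Phi> (proj m \<alpha> x) * g x))"
    "decreasing (transfer_iter m \<alpha> (\<lambda>x. \<Phi> (proj m \<alpha> x) * g x))" by (rule c)+
  show "transfer_iter m \<alpha> (\<lambda>x. \<Phi> (proj m \<alpha> x) * g x) x \<le> transfer_iter m \<alpha> g x" if "0 < x" "x < 1" for x
  proof (rule transfer_iter_mono[OF adm _ that])
    fix y :: real assume "0 < y" "y < 1"
    then show "\<Phi> (proj m \<alpha> y) * g y \<le> g y"
      using \<Phi> unit_nonnegD[OF tameD(2)[OF g(1)], of y] by (intro mult_left_le_one_le) auto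
  qed
qed

end

section \<open>Decoupling of the past from the present\<close>

locale subcritical_system = subcritical +
  fixes \<alpha> :: "nat \<Rightarrow> real" and g :: "real \<Rightarrow> real"
  assumes adm: "admissible \<beta> \<alpha>" and g_tame: "tame g" and g_cone: "density_cone (1 + \<beta>) g"
    and g_mass: "integral\<^sup>L uniform g = 1"
begin

definition \<nu> :: "real measure" where
  "\<nu> = density uniform (\<lambda>x. ennreal (g x))"

lemma space_\<nu> [simp]: "space \<nu> = {0<..<1}"
  by (simp add: \<nu>_def)

lemma measurable_\<nu>: "h \<in> borel_measurable borel \<Longrightarrow> h \<in> borel_measurable \<nu>"
  unfolding \<nu>_def measurable_density_eq1 by (rule borel_measurable_uniform)

lemma g_nonneg: "0 < x \<Longrightarrow> x < 1 \<Longrightarrow> 0 \<le> g x"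
  using unit_nonnegD[OF tameD(2)[OF g_tame]] .

lemma g_measurable: "g \<in> borel_measurable uniform" "g \<in> borel_measurable borel"
  using tameD(1)[OF g_tame] borel_measurable_uniform by auto

lemma prob_space_\<nu>: "prob_space \<nu>"
proof (rule prob_spaceI)
  have "emeasure \<nu> (space \<nu>) = (\<integral>\<^sup>+ x. ennreal (g x) \<partial>uniform)"
    unfolding \<nu>_def using g_measurable sets.top[of uniform]
    by (subst emeasure_density) (auto intro!: nn_integral_cong)
  also have "\<dots> = ennreal (integral\<^sup>L uniform g)"
    by (rule nn_integral_eq_integral[OF tame_integrable[OF g_tame]]) (auto intro!: AE_I2 g_nonneg)
  finally show "emeasure \<nu> (space \<nu>) = 1" using g_mass by simp
qed

sublocale \<nu>: prob_space \<nu> by (rule prob_space_\<nu>)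

lemma integral_\<nu>:
  fixes \<phi> :: "real \<Rightarrow> real"
  assumes "\<phi> \<in> borel_measurable borel"
  shows "integral\<^sup>L \<nu> \<phi> = (\<integral>x. g x * \<phi> x \<partial>uniform)"
  unfolding \<nu>_def using g_measurable(1) borel_measurable_uniform[OF assms]
  by (subst integral_density) (auto intro!: AE_I2 g_nonneg)

lemma integrable_\<nu>_bounded:
  fixes \<phi> :: "real \<Rightarrow> real"
  assumes "\<phi> \<in> borel_measurable borel" "\<And>x. \<bar>\<phi> x\<bar> \<le> B"
  shows "integrable \<nu> \<phi>"
  using \<nu>.integrable_const_bound[of \<phi> B] measurable_\<nu>[OF assms(1)] assms(2) by auto

lemma integrable_bounded_density:
  fixes \<phi> :: "real \<Rightarrow> real"
  assumes "\<phi> \<in> borel_measurable borel" "\<And>x. \<bar>\<phi> x\<bar> \<le> B"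
  shows "integrable uniform (\<lambda>x. g x * \<phi> x)"
proof (rule Bochner_Integration.integrable_bound)
  show "integrable uniform (\<lambda>x. B * g x)" using tame_integrable[OF g_tame] by simp
  show "(\<lambda>x. g x * \<phi> x) \<in> borel_measurable uniform"
    using g_measurable(1) borel_measurable_uniform[OF assms(1)] by simp
  show "AE x in uniform. norm (g x * \<phi> x) \<le> norm (B * g x)"
  proof (rule AE_I2)
    fix x assume "x \<in> space uniform"
    then have "0 \<le> g x" using g_nonneg by simp
    moreover have "0 \<le> B" using assms(2)[of 0] by linarith
    ultimately show "norm (g x * \<phi> x) \<le> norm (B * g x)"
      using mult_left_mono[OF assms(2), of "g x"] by (simp add: abs_mult mult.commute)
  qed
qed

text \<open>The integrand times \<open>g\<close> is pushed forward by \<open>n\<close> steps, which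
  preserves the integral; then the terminal point is frozen by
  \<open>transfer_iter_two_variable\<close>.\<close>

lemma integral_\<nu>_two_variable:
  assumes F: "case_prod F \<in> borel_measurable (borel \<Otimes>\<^sub>M borel)" and B: "\<And>p y. \<bar>F p y\<bar> \<le> B"
    and P: "P \<in> borel_measurable borel"
  shows "(\<integral>x. F (P x) (intermittent_iter \<alpha> n x) \<partial>\<nu>)
      = (\<integral>y. transfer_iter n \<alpha> (\<lambda>x. F (P x) y * g x) y \<partial>uniform)"
    and "integrable uniform (\<lambda>y. transfer_iter n \<alpha> (\<lambda>x. F (P x) y * g x) y)"
proof -
  let ?f = "\<lambda>x. F (P x) (intermittent_iter \<alpha> n x)"
  have m: "?f \<in> borel_measurable borel"
    using measurable_compose[OF measurable_Pair[OF P measurable_intermittent_iter] F] by simp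
  have gm: "(\<lambda>x. g x * ?f x) \<in> borel_measurable borel"
    using g_measurable(2) m by measurable
  have i: "integrable uniform (\<lambda>x. g x * ?f x)"
    using B by (intro integrable_bounded_density[OF m])
  note t = integral_transfer_iter[OF adm gm i, of n]
  have eq: "transfer_iter n \<alpha> (\<lambda>x. g x * ?f x) y = transfer_iter n \<alpha> (\<lambda>x. F (P x) y * g x) y"
    if "0 < y" "y < 1" for y
    using transfer_iter_two_variable[OF adm that, of n "\<lambda>x y. F (P x) y * g x"] by (simp add: mult.commute)
  have "(\<integral>x. ?f x \<partial>\<nu>) = (\<integral>x. g x * ?f x \<partial>uniform)" by (rule integral_\<nu>[OF m])
  also have "\<dots> = (\<integral>y. transfer_iter n \<alpha> (\<lambda>x. g x * ?f x) y \<partial>uniform)" by (rule t(2)[symmetric])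
  also have "\<dots> = (\<integral>y. transfer_iter n \<alpha> (\<lambda>x. F (P x) y * g x) y \<partial>uniform)"
    by (rule Bochner_Integration.integral_cong[OF refl]) (use eq in auto)
  finally show "(\<integral>x. ?f x \<partial>\<nu>) = (\<integral>y. transfer_iter n \<alpha> (\<lambda>x. F (P x) y * g x) y \<partial>uniform)" .
  show "integrable uniform (\<lambda>y. transfer_iter n \<alpha> (\<lambda>x. F (P x) y * g x) y)"
    using t(1) eq by (subst Bochner_Integration.integrable_cong[OF refl, of _ _ "transfer_iter n \<alpha> (\<lambda>x. g x * ?f x)"]) auto
qed

text \<open>For fixed \<open>y\<close>, push \<open>F (proj m \<alpha> x) y * g x\<close> and
  \<open>\<theta> y * g x\<close> forward by \<open>m\<close> steps, where \<open>\<theta> y\<close>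
  is the mass of the first. Both results are tame, lie in the cone and have equal mass, so the next
  \<open>j\<close> steps make them close at every point, in particular at \<open>y\<close> itself.
  Integrating over \<open>y\<close> compares the joint law with the product of the
  marginals.\<close>

lemma decoupling_unit:
  assumes L: "loss_bound (shift m \<alpha>) j r"
    and F: "case_prod F \<in> borel_measurable (borel \<Otimes>\<^sub>M borel)" and B: "\<And>p y. 0 \<le> F p y" "\<And>p y. F p y \<le> 1"
  shows "\<bar>(\<integral>x. F (proj m \<alpha> x) (intermittent_iter \<alpha> (m + j) x) \<partial>\<nu>)
    - (\<integral>z. (\<integral>x. F (proj m \<alpha> x) (intermittent_iter \<alpha> (m + j) z) \<partial>\<nu>) \<partial>\<nu>)\<bar> \<le> r"
proof -
  obtain E where E: "E \<in> borel_measurable borel" "integrable uniform E" "integral\<^sup>L uniform E \<le> r"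
    "\<And>g h x. tame g \<Longrightarrow> density_cone (1 + \<beta>) g \<Longrightarrow> tame h \<Longrightarrow> density_cone (1 + \<beta>) h \<Longrightarrow>
      integral\<^sup>L uniform g = integral\<^sup>L uniform h \<Longrightarrow> 0 < x \<Longrightarrow> x < 1 \<Longrightarrow>
      \<bar>transfer_iter j (shift m \<alpha>) g x - transfer_iter j (shift m \<alpha>) h x\<bar> \<le> E x"
    using L unfolding loss_bound_def by blast
  have adm': "admissible \<beta> (shift m \<alpha>)" by (rule admissible_shift[OF adm])
  have P: "proj m \<alpha> \<in> borel_measurable borel" using measurable_proj[OF adm, of "\<lambda>x. x"] by simp
  have aB: "\<bar>F p y\<bar> \<le> 1" for p y using B[of p y] by simp
  define \<theta> where "\<theta> y = (\<integral>x. F (proj m \<alpha> x) y \<partial>\<nu>)" for y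
  have Fx: "(\<lambda>x. F (proj m \<alpha> x) y) \<in> borel_measurable borel" for y
    by (rule measurable_proj[OF adm])
  have \<theta>: "0 \<le> \<theta> y" "\<theta> y \<le> 1" for y
  proof -
    show "0 \<le> \<theta> y" unfolding \<theta>_def using B by (intro Bochner_Integration.integral_nonneg) auto
    show "\<theta> y \<le> 1" unfolding \<theta>_def
      using \<nu>.integral_le_const[of "\<lambda>x. F (proj m \<alpha> x) y" 1] integrable_\<nu>_bounded[OF Fx aB] B by auto
  qed
  have "(\<lambda>(y, x). F (proj m \<alpha> x) y) \<in> borel_measurable (borel \<Otimes>\<^sub>M \<nu>)"
  proof -
    have P': "proj m \<alpha> \<in> borel_measurable \<nu>" by (rule measurable_\<nu>[OF P])
    have "(\<lambda>z. (proj m \<alpha> (snd z), fst z)) \<in> measurable (borel \<Otimes>\<^sub>M \<nu>) (borel \<Otimes>\<^sub>M borel)"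
      using measurable_compose[OF measurable_snd P'] by (intro measurable_Pair) auto
    from measurable_compose[OF this F] show ?thesis by (simp add: split_beta')
  qed
  then have \<theta>m: "\<theta> \<in> borel_measurable borel"
    unfolding \<theta>_def by (rule \<nu>.borel_measurable_lebesgue_integral)
  have F\<theta>: "case_prod (\<lambda>p y. \<theta> y) \<in> borel_measurable (borel \<Otimes>\<^sub>M borel)"
    using measurable_compose[OF measurable_snd[of borel borel] \<theta>m] by (simp add: split_beta')
  have a\<theta>: "\<bar>\<theta> y\<bar> \<le> 1" for y using \<theta>[of y] by simp
  note i1 = integral_\<nu>_two_variable[OF F aB P, of "m + j"]
  note i2 = integral_\<nu>_two_variable[OF F\<theta> a\<theta> P, of "m + j"]
  have point: "\<bar>transfer_iter (m + j) \<alpha> (\<lambda>x. F (proj m \<alpha> x) y * g x) y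
      - transfer_iter (m + j) \<alpha> (\<lambda>x. \<theta> y * g x) y\<bar> \<le> E y" if y: "0 < y" "y < 1" for y
  proof -
    have mg: "(\<lambda>x. F (proj m \<alpha> x) y * g x) \<in> borel_measurable borel"
      using Fx[of y] g_measurable(2) by measurable
    have ig: "integrable uniform (\<lambda>x. F (proj m \<alpha> x) y * g x)"
      using integrable_bounded_density[OF Fx aB, of y] by (simp add: mult.commute)
    have "integral\<^sup>L uniform (transfer_iter m \<alpha> (\<lambda>x. F (proj m \<alpha> x) y * g x)) = \<theta> y"
      unfolding integral_transfer_iter(2)[OF adm mg ig] \<theta>_def integral_\<nu>[OF Fx] by (simp add: mult.commute)
    moreover have "integral\<^sup>L uniform (transfer_iter m \<alpha> (\<lambda>x. \<theta> y * g x)) = \<theta> y"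
      using integral_transfer_iter(2)[OF adm _ integrable_mult_right[OF tame_integrable[OF g_tame]], of "\<theta> y" m]
        g_measurable(2) g_mass by simp
    ultimately have "\<bar>transfer_iter j (shift m \<alpha>) (transfer_iter m \<alpha> (\<lambda>x. F (proj m \<alpha> x) y * g x)) y
      - transfer_iter j (shift m \<alpha>) (transfer_iter m \<alpha> (\<lambda>x. \<theta> y * g x)) y\<bar> \<le> E y"
      using B \<theta>
        tame_transfer_iter_proj[OF adm g_tame g_cone, where \<Phi> = "\<lambda>p. F p y"]
        cone_transfer_iter_proj[OF adm order_refl g_cone, where \<Phi> = "\<lambda>p. F p y"]
        tame_transfer_iter_proj[OF adm g_tame g_cone, where \<Phi> = "\<lambda>p. \<theta> y"]
        cone_transfer_iter_proj[OF adm order_refl g_cone, where \<Phi> = "\<lambda>p. \<theta> y"]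
      by (intro E(4) y) auto
    then show ?thesis by (simp add: transfer_iter_add)
  qed
  have "\<bar>(\<integral>x. F (proj m \<alpha> x) (intermittent_iter \<alpha> (m + j) x) \<partial>\<nu>) - (\<integral>z. \<theta> (intermittent_iter \<alpha> (m + j) z) \<partial>\<nu>)\<bar>
    = \<bar>\<integral>y. (transfer_iter (m + j) \<alpha> (\<lambda>x. F (proj m \<alpha> x) y * g x) y
      - transfer_iter (m + j) \<alpha> (\<lambda>x. \<theta> y * g x) y) \<partial>uniform\<bar>"
    unfolding i1(1) i2(1) by (subst Bochner_Integration.integral_diff[OF i1(2) i2(2)]) simp
  also have "\<dots> \<le> (\<integral>y. \<bar>transfer_iter (m + j) \<alpha> (\<lambda>x. F (proj m \<alpha> x) y * g x) y
      - transfer_iter (m + j) \<alpha> (\<lambda>x. \<theta> y * g x) y\<bar> \<partial>uniform)"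
    by (rule integral_abs_bound)
  also have "\<dots> \<le> integral\<^sup>L uniform E"
    using point i1(2) i2(2) by (intro integral_mono E(2) integrable_abs Bochner_Integration.integrable_diff) auto
  finally show ?thesis using E(3) by (simp add: \<theta>_def)
qed

text \<open>The affine change \<open>(F + B) / (2 * B)\<close> has values in \<open>[0, 1]\<close>;
  the additive constant cancels and the scale gives the factor \<open>2 * B\<close>.\<close>

lemma decoupling:
  assumes L: "loss_bound (shift m \<alpha>) j r"
    and F: "case_prod F \<in> borel_measurable (borel \<Otimes>\<^sub>M borel)" and B: "\<And>p y. \<bar>F p y\<bar> \<le> B"
  shows "\<bar>(\<integral>x. F (proj m \<alpha> x) (intermittent_iter \<alpha> (m + j) x) \<partial>\<nu>)
    - (\<integral>z. (\<integral>x. F (proj m \<alpha> x) (intermittent_iter \<alpha> (m + j) z) \<partial>\<nu>) \<partial>\<nu>)\<bar> \<le> 2 * B * r"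
proof (cases "B = 0")
  case True
  then have "F p y = 0" for p y using B[of p y] by simp
  then show ?thesis using True by simp
next
  case False
  have Bp: "0 < B" using B[of 0 0] False by linarith
  define G where "G p y = (F p y + B) / (2 * B)" for p y
  have FG: "F p y = 2 * B * G p y - B" for p y using Bp by (simp add: G_def)
  have G: "0 \<le> G p y" "G p y \<le> 1" for p y
    using B[of p y] Bp by (auto simp: G_def abs_le_iff field_simps)
  have Gm: "case_prod G \<in> borel_measurable (borel \<Otimes>\<^sub>M borel)"
  proof -
    have "case_prod G = (\<lambda>z. (case_prod F z + B) / (2 * B))" by (auto simp: G_def)
    then show ?thesis using F by simp
  qed
  have aG: "\<bar>G p y\<bar> \<le> 1" for p y using G[of p y] by simp
  have P: "proj m \<alpha> \<in> borel_measurable borel" using measurable_proj[OF adm, of "\<lambda>x. x"] by simp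
  have m1: "(\<lambda>x. G (proj m \<alpha> x) (intermittent_iter \<alpha> (m + j) x)) \<in> borel_measurable borel"
    using measurable_compose[OF measurable_Pair[OF P measurable_intermittent_iter] Gm] by simp
  have m2: "(\<lambda>x. G (proj m \<alpha> x) y) \<in> borel_measurable borel" for y by (rule measurable_proj[OF adm])
  let ?\<theta> = "\<lambda>z. (\<integral>x. G (proj m \<alpha> x) (intermittent_iter \<alpha> (m + j) z) \<partial>\<nu>)"
  have e1: "(\<integral>x. F (proj m \<alpha> x) (intermittent_iter \<alpha> (m + j) x) \<partial>\<nu>)
     = 2 * B * (\<integral>x. G (proj m \<alpha> x) (intermittent_iter \<alpha> (m + j) x) \<partial>\<nu>) - B"
    unfolding FG using integrable_\<nu>_bounded[OF m1 aG] \<nu>.prob_space by simp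
  have e2: "(\<integral>x. F (proj m \<alpha> x) y \<partial>\<nu>) = 2 * B * (\<integral>x. G (proj m \<alpha> x) y \<partial>\<nu>) - B" for y
    unfolding FG using integrable_\<nu>_bounded[OF m2 aG] \<nu>.prob_space by simp
  have "(\<lambda>(y, x). G (proj m \<alpha> x) (intermittent_iter \<alpha> (m + j) y)) \<in> borel_measurable (borel \<Otimes>\<^sub>M \<nu>)"
  proof -
    have P': "proj m \<alpha> \<in> borel_measurable \<nu>" by (rule measurable_\<nu>[OF P])
    have "(\<lambda>z. (proj m \<alpha> (snd z), intermittent_iter \<alpha> (m + j) (fst z))) \<in> measurable (borel \<Otimes>\<^sub>M \<nu>) (borel \<Otimes>\<^sub>M borel)"
      using measurable_compose[OF measurable_snd P'] measurable_compose[OF measurable_fst measurable_intermittent_iter]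
      by (intro measurable_Pair) auto
    from measurable_compose[OF this Gm] show ?thesis by (simp add: split_beta')
  qed
  then have \<theta>m: "?\<theta> \<in> borel_measurable borel"
    by (rule \<nu>.borel_measurable_lebesgue_integral)
  have "\<bar>?\<theta> z\<bar> \<le> 1" for z
  proof -
    have "0 \<le> ?\<theta> z" using G by (intro Bochner_Integration.integral_nonneg) auto
    moreover have "?\<theta> z \<le> 1"
      using \<nu>.integral_le_const[of "\<lambda>x. G (proj m \<alpha> x) (intermittent_iter \<alpha> (m + j) z)" 1] integrable_\<nu>_bounded[OF m2 aG] G by auto
    ultimately show ?thesis by simp
  qed
  from integrable_\<nu>_bounded[OF \<theta>m this]
  have e3: "(\<integral>z. (\<integral>x. F (proj m \<alpha> x) (intermittent_iter \<alpha> (m + j) z) \<partial>\<nu>) \<partial>\<nu>)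
    = 2 * B * (\<integral>z. ?\<theta> z \<partial>\<nu>) - B"
    unfolding e2 using \<nu>.prob_space by simp
  have "\<bar>2 * B * (\<integral>x. G (proj m \<alpha> x) (intermittent_iter \<alpha> (m + j) x) \<partial>\<nu>) - B - (2 * B * (\<integral>z. ?\<theta> z \<partial>\<nu>) - B)\<bar>
    = 2 * B * \<bar>(\<integral>x. G (proj m \<alpha> x) (intermittent_iter \<alpha> (m + j) x) \<partial>\<nu>) - (\<integral>z. ?\<theta> z \<partial>\<nu>)\<bar>"
    using Bp by (simp add: right_diff_distrib[symmetric] abs_mult)
  also have "\<dots> \<le> 2 * B * r"
    using decoupling_unit[OF L Gm G] Bp by (intro mult_left_mono) auto
  finally show ?thesis unfolding e1 e3 .
qed

end

section \<open>Stein's equation for the normal distribution\<close>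

definition gauss :: "real \<Rightarrow> real" where
  "gauss x = exp (- x\<^sup>2 / 2) / sqrt (2 * pi)"

lemma gauss_eq: "gauss = std_normal_density"
  by (simp add: fun_eq_iff gauss_def std_normal_density_def)

lemma gauss_pos: "0 < gauss x"
  by (simp add: gauss_def)

lemma gauss_even [simp]: "gauss (- x) = gauss x"
  by (simp add: gauss_def)

lemma gauss_derivative: "(gauss has_real_derivative - x * gauss x) (at x)"
  unfolding gauss_def[abs_def] by (auto intro!: derivative_eq_intros simp: field_simps)

lemma measurable_gauss [measurable]: "gauss \<in> borel_measurable borel"
  unfolding gauss_def[abs_def] by measurable

lemma continuous_gauss: "isCont gauss x"
  using gauss_derivative by (rule DERIV_isCont)

lemma integrable_gauss_power: "integrable lborel (\<lambda>x. x ^ k * gauss x)"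
  using integrable_std_normal_moment[of k] by (simp add: gauss_eq mult.commute)

lemma integrable_gauss: "integrable lborel gauss"
  using integrable_gauss_power[of 0] by simp

lemma integrable_mult_gauss: "integrable lborel (\<lambda>x. x * gauss x)"
  using integrable_gauss_power[of 1] by simp

lemma integral_gauss: "integral\<^sup>L lborel gauss = 1"
  using integral_std_normal_moment_even[of 0] by (simp add: gauss_eq)

section \<open>Tail integrals of the Gaussian density\<close>

lemma tail_FTC:
  fixes F f :: "real \<Rightarrow> real"
  assumes F: "\<And>x. (F has_real_derivative f x) (at x)" and f: "\<And>x. isCont f x"
    and i: "integrable lborel f" and lim: "(F \<longlongrightarrow> 0) at_top"
  shows "(LBINT x:{w<..}. f x) = - F w"
proof -
  have "(LBINT x=ereal w..\<infinity>. f x) = 0 - F w"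
  proof (rule interval_integral_FTC_integrable)
    show "(F has_vector_derivative f x) (at x)" for x
      using F by (simp add: has_real_derivative_iff_has_vector_derivative)
    show "set_integrable lborel (einterval (ereal w) \<infinity>) f"
      using i unfolding set_integrable_def by (intro integrable_mult_indicator) auto
    have "isCont F w" using F by (rule DERIV_isCont)
    then show "((F \<circ> real_of_ereal) \<longlongrightarrow> F w) (at_right (ereal w))"
      by (simp add: ereal_tendsto_simps isCont_def tendsto_within_subset filterlim_at_split)
    show "((F \<circ> real_of_ereal) \<longlongrightarrow> 0) (at_left \<infinity>)"
      using lim by (simp add: ereal_tendsto_simps)
  qed (use f in auto)
  then show ?thesis
    by (simp add: interval_lebesgue_integral_def einterval_def greaterThan_def)
qed

lemma gauss_tail_first: "(LBINT x:{w<..}. x * gauss x) = gauss w"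
proof -
  have "(LBINT x:{w<..}. x * gauss x) = - (- gauss w)"
  proof (rule tail_FTC)
    show "((\<lambda>x. - gauss x) has_real_derivative x * gauss x) (at x)" for x
      using gauss_derivative[of x] by (auto intro!: derivative_eq_intros)
    show "((\<lambda>x. - gauss x) \<longlongrightarrow> 0) at_top" unfolding gauss_def by real_asymp
    show "isCont (\<lambda>x. x * gauss x) x" for x
      using continuous_gauss by (intro continuous_intros)
  qed (rule integrable_mult_gauss)
  then show ?thesis by simp
qed

lemma gauss_tail_second: "(LBINT x:{w<..}. x\<^sup>2 * gauss x - gauss x) = w * gauss w"
proof -
  have "(LBINT x:{w<..}. x\<^sup>2 * gauss x - gauss x) = - (- w * gauss w)"
  proof (rule tail_FTC)
    show "((\<lambda>x. - x * gauss x) has_real_derivative x\<^sup>2 * gauss x - gauss x) (at x)" for x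
      using gauss_derivative[of x]
      by (auto intro!: derivative_eq_intros simp: power2_eq_square algebra_simps)
    show "((\<lambda>x. - x * gauss x) \<longlongrightarrow> 0) at_top" unfolding gauss_def by real_asymp
    show "isCont (\<lambda>x. x\<^sup>2 * gauss x - gauss x) x" for x
      using continuous_gauss by (intro continuous_intros)
    show "integrable lborel (\<lambda>x. x\<^sup>2 * gauss x - gauss x)"
      using integrable_gauss_power[of 2] integrable_gauss by simp
  qed
  then show ?thesis by simp
qed

lemma set_integrable_tail: "integrable lborel f \<Longrightarrow> set_integrable lborel {w<..} f"
  for f :: "real \<Rightarrow> real"
  unfolding set_integrable_def by (intro integrable_mult_indicator) auto

definition gauss_tail :: "real \<Rightarrow> real" where
  "gauss_tail w = (LBINT x:{w<..}. gauss x)"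

text \<open>The expectation of the positive part of \<open>X - w\<close> for a standard normal
  \<open>X\<close>.\<close>

definition gauss_gap :: "real \<Rightarrow> real" where
  "gauss_gap w = (LBINT x:{w<..}. (x - w) * gauss x)"

lemma gauss_gap_eq: "gauss_gap w = gauss w - w * gauss_tail w"
proof -
  have "gauss_gap w = (LBINT x:{w<..}. x * gauss x - w * gauss x)"
    by (simp add: gauss_gap_def left_diff_distrib)
  also have "\<dots> = gauss w - w * gauss_tail w"
    using set_integrable_tail[OF integrable_mult_gauss] set_integrable_tail[OF integrable_gauss]
    by (subst set_integral_diff(2)) (auto simp: gauss_tail_first gauss_tail_def)
  finally show ?thesis .
qed

lemma gauss_tail_nonneg: "0 \<le> gauss_tail w"
  unfolding gauss_tail_def set_lebesgue_integral_def
  by (intro Bochner_Integration.integral_nonneg) (auto simp: less_imp_le[OF gauss_pos])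

lemma gauss_tail_le_1: "gauss_tail w \<le> 1"
proof -
  have "gauss_tail w \<le> integral\<^sup>L lborel gauss"
    unfolding gauss_tail_def set_lebesgue_integral_def
    using set_integrable_tail[OF integrable_gauss] integrable_gauss less_imp_le[OF gauss_pos]
    by (intro integral_mono) (auto simp: set_integrable_def indicator_def)
  then show ?thesis by (simp add: integral_gauss)
qed

lemma gauss_gap_nonneg: "0 \<le> gauss_gap w"
  unfolding gauss_gap_def set_lebesgue_integral_def
  by (intro Bochner_Integration.integral_nonneg) (auto simp: less_imp_le[OF gauss_pos] indicator_def)

text \<open>
  The second bound integrates \<open>w (x - w) \<le> x (x - w)\<close> against the Gaussian density.
\<close>

lemma gauss_gap_bounds:
  assumes w: "0 \<le> w"
  shows "gauss_gap w \<le> gauss w" "w\<^sup>2 * gauss_gap w \<le> gauss w"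
proof -
  show 1: "gauss_gap w \<le> gauss w" using w gauss_tail_nonneg[of w] by (simp add: gauss_gap_eq)
  have i2: "set_integrable lborel {w<..} (\<lambda>x. x\<^sup>2 * gauss x - gauss x)"
    using integrable_gauss_power[of 2] integrable_gauss by (intro set_integrable_tail) simp
  note i0 = set_integrable_tail[OF integrable_gauss, of w]
  note i1 = set_integrable_tail[OF integrable_mult_gauss, of w]
  have "(LBINT x:{w<..}. w * (x * gauss x - w * gauss x))
      \<le> (LBINT x:{w<..}. (x\<^sup>2 * gauss x - gauss x) + gauss x - w * (x * gauss x))"
  proof (rule set_integral_mono)
    show "set_integrable lborel {w<..} (\<lambda>x. w * (x * gauss x - w * gauss x))"
      using i0 i1 by (intro set_integrable_mult_right set_integral_diff(1)) auto
    show "set_integrable lborel {w<..} (\<lambda>x. (x\<^sup>2 * gauss x - gauss x) + gauss x - w * (x * gauss x))"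
      using i1 by (intro set_integral_diff(1)[OF set_integral_add(1)[OF i2 i0]] set_integrable_mult_right) auto
    fix x assume x: "x \<in> {w<..}"
    have "(x\<^sup>2 * gauss x - gauss x) + gauss x - w * (x * gauss x) - w * (x * gauss x - w * gauss x)
        = (x - w)\<^sup>2 * gauss x" by (simp add: power2_eq_square algebra_simps)
    then show "w * (x * gauss x - w * gauss x) \<le> (x\<^sup>2 * gauss x - gauss x) + gauss x - w * (x * gauss x)"
      using mult_nonneg_nonneg[OF zero_le_power2[of "x - w"] less_imp_le[OF gauss_pos[of x]]] by linarith
  qed
  also have "\<dots> = (w * gauss w + gauss_tail w) - w * gauss w"
  proof -
    note a = set_integral_add[OF i2 i0]
    have m: "set_integrable lborel {w<..} (\<lambda>x. w * (x * gauss x))" using i1 by (intro set_integrable_mult_right) auto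
    show ?thesis
      unfolding set_integral_diff(2)[OF a(1) m] a(2) gauss_tail_second gauss_tail_def[symmetric]
      using gauss_tail_first[of w] by (simp add: set_integral_mult_right)
  qed
  also have "(LBINT x:{w<..}. w * (x * gauss x - w * gauss x)) = w * gauss_gap w"
    unfolding gauss_gap_def by (simp add: set_integral_mult_right left_diff_distrib)
  finally have "w * gauss_gap w \<le> gauss_tail w" by simp
  then have "w * (w * gauss_gap w) \<le> w * gauss_tail w" using w by (intro mult_left_mono)
  also have "\<dots> \<le> gauss w" using gauss_gap_nonneg[of w] by (simp add: gauss_gap_eq)
  finally show "w\<^sup>2 * gauss_gap w \<le> gauss w" by (simp add: power2_eq_square mult.assoc)
qed

text \<open>For \<open>w \<ge> 1\<close> this follows from Mills' inequality
  \<open>w * gauss_tail w \<le> gauss w\<close>. For smaller \<open>w\<close> the tail is at most 1,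
  while the density is at least (1/2)/3.\<close>

lemma gauss_tail_le:
  assumes w: "0 \<le> w"
  shows "gauss_tail w \<le> 6 * gauss w"
proof (cases "1 \<le> w")
  case True
  have "gauss_tail w \<le> w * gauss_tail w" using True gauss_tail_nonneg[of w] by (simp add: mult_le_cancel_right1)
  also have "\<dots> \<le> gauss w" using gauss_gap_nonneg[of w] by (simp add: gauss_gap_eq)
  also have "\<dots> \<le> 6 * gauss w" using gauss_pos[of w] by simp
  finally show ?thesis .
next
  case False
  have "w\<^sup>2 \<le> 1" using w False by (simp add: power_le_one)
  then have "1/2 \<le> exp (- w\<^sup>2 / 2)" using exp_ge_add_one_self[of "- w\<^sup>2 / 2"] by simp
  moreover have "sqrt (2 * pi) \<le> 3"
    using pi_less_4 by (intro real_le_lsqrt) auto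
  ultimately have "(1/2) / 3 \<le> gauss w" unfolding gauss_def by (intro frac_le) auto
  then show ?thesis using gauss_tail_le_1[of w] by simp
qed

section \<open>Stein's equation for a Lipschitz test function\<close>

locale lipschitz_test =
  fixes h :: "real \<Rightarrow> real"
  assumes h_lip: "\<And>x y. \<bar>h x - h y\<bar> \<le> \<bar>x - y\<bar>"
begin

definition gauss_mean :: real where
  "gauss_mean = (LBINT x. h x * gauss x)"

definition stein_weight :: "real \<Rightarrow> real" where
  "stein_weight x = (h x - gauss_mean) * gauss x"

text \<open>The bounded solution \<open>u\<close> of
  \<open>u' w - w * u w = h w - gauss_mean\<close>. Writing it with the upper tail suits
  \<open>w \<ge> 0\<close>; negative arguments are reached by reflection.\<close>

definition stein_sol :: "real \<Rightarrow> real" where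
  "stein_sol w = - (LBINT x:{w<..}. stein_weight x) / gauss w"

text \<open>The derivative of \<open>stein_sol\<close> as dictated by Stein's equation;
  \<open>stein_sol_derivative\<close> confirms it.\<close>

definition stein_deriv :: "real \<Rightarrow> real" where
  "stein_deriv w = w * stein_sol w + h w - gauss_mean"

lemma continuous_h: "isCont h x"
  unfolding isCont_def
proof (rule Lim_null_comparison[THEN Lim_null[THEN iffD2]])
  show "\<forall>\<^sub>F y in at x. norm (h y - h x) \<le> \<bar>y - x\<bar>" using h_lip by auto
  show "((\<lambda>y. \<bar>y - x\<bar>) \<longlongrightarrow> 0) (at x)" by (auto intro!: tendsto_eq_intros)
qed

lemma measurable_h [measurable]: "h \<in> borel_measurable borel"
  using continuous_h by (intro borel_measurable_continuous_onI) (simp add: continuous_on_eq_continuous_at)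

lemma integrable_h_gauss: "integrable lborel (\<lambda>x. h x * gauss x)"
proof (rule Bochner_Integration.integrable_bound)
  show "integrable lborel (\<lambda>x. \<bar>h 0\<bar> * gauss x + \<bar>x * gauss x\<bar>)"
    using integrable_gauss integrable_mult_gauss by auto
  show "AE x in lborel. norm (h x * gauss x) \<le> norm (\<bar>h 0\<bar> * gauss x + \<bar>x * gauss x\<bar>)"
  proof (rule AE_I2)
    fix x :: real
    have "\<bar>h x\<bar> \<le> \<bar>h 0\<bar> + \<bar>x\<bar>" using h_lip[of x 0] by simp
    then have "\<bar>h x\<bar> * gauss x \<le> (\<bar>h 0\<bar> + \<bar>x\<bar>) * gauss x" using gauss_pos[of x] by (intro mult_right_mono) auto
    then show "norm (h x * gauss x) \<le> norm (\<bar>h 0\<bar> * gauss x + \<bar>x * gauss x\<bar>)"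
      using gauss_pos[of x] by (simp add: abs_mult ring_distribs)
  qed
qed measurable

lemma integrable_stein_weight: "integrable lborel stein_weight"
  unfolding stein_weight_def[abs_def] left_diff_distrib
  using integrable_h_gauss integrable_gauss by auto

lemma continuous_stein_weight: "isCont stein_weight x"
  unfolding stein_weight_def[abs_def] using continuous_h continuous_gauss by (intro continuous_intros)

lemma integral_stein_weight: "integral\<^sup>L lborel stein_weight = 0"
  unfolding stein_weight_def[abs_def] left_diff_distrib
  using integrable_h_gauss integrable_gauss integral_gauss
  by (subst Bochner_Integration.integral_diff) (auto simp: gauss_mean_def)

text \<open>The Lipschitz bound is averaged over a standard normal \<open>X\<close>, whose mean
  absolute value is at most 1 because \<open>\<bar>x\<bar> \<le> 1/2 + x\<^sup>2 / 2\<close> and the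
  second moment is 1.\<close>

lemma h_mean_bound: "\<bar>h w - gauss_mean\<bar> \<le> \<bar>w\<bar> + 1"
proof -
  have "h w - gauss_mean = (LBINT x. h w * gauss x) - (LBINT x. h x * gauss x)"
    by (simp add: gauss_mean_def integral_gauss)
  also have "\<dots> = (LBINT x. h w * gauss x - h x * gauss x)"
    using integrable_gauss integrable_h_gauss by (subst Bochner_Integration.integral_diff) auto
  finally have "\<bar>h w - gauss_mean\<bar> \<le> (LBINT x. \<bar>h w * gauss x - h x * gauss x\<bar>)"
    using integral_abs_bound[of lborel "\<lambda>x. h w * gauss x - h x * gauss x"] by simp
  also have "\<dots> \<le> (LBINT x. \<bar>w\<bar> * gauss x + (1/2 * gauss x + 1/2 * (x\<^sup>2 * gauss x)))"
  proof (rule integral_mono)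
    show "integrable lborel (\<lambda>x. \<bar>h w * gauss x - h x * gauss x\<bar>)"
      using integrable_gauss integrable_h_gauss by auto
    show "integrable lborel (\<lambda>x. \<bar>w\<bar> * gauss x + (1/2 * gauss x + 1/2 * (x\<^sup>2 * gauss x)))"
      using integrable_gauss integrable_gauss_power[of 2] by auto
    fix x :: real
    have "\<bar>x\<bar> \<le> 1/2 + 1/2 * x\<^sup>2"
      using zero_le_power2[of "\<bar>x\<bar> - 1"] by (simp add: power2_eq_square algebra_simps)
    then have "\<bar>h w - h x\<bar> \<le> \<bar>w\<bar> + (1/2 + 1/2 * x\<^sup>2)" using h_lip[of w x] by linarith
    then have "\<bar>h w - h x\<bar> * gauss x \<le> (\<bar>w\<bar> + (1/2 + 1/2 * x\<^sup>2)) * gauss x"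
      using gauss_pos[of x] by (intro mult_right_mono) auto
    moreover have "\<bar>h w * gauss x - h x * gauss x\<bar> = \<bar>h w - h x\<bar> * gauss x"
      using gauss_pos[of x] by (simp add: left_diff_distrib[symmetric] abs_mult)
    ultimately show "\<bar>h w * gauss x - h x * gauss x\<bar> \<le> \<bar>w\<bar> * gauss x + (1/2 * gauss x + 1/2 * (x\<^sup>2 * gauss x))"
      by (simp add: algebra_simps)
  qed
  also have "\<dots> = \<bar>w\<bar> + 1"
    using integrable_gauss integrable_gauss_power[of 2] integral_gauss integral_std_normal_moment_even[of 1]
    by (simp add: gauss_eq[symmetric] mult.commute[of "gauss _"])
  finally show ?thesis .
qed

lemma stein_tail_derivative:
  "((\<lambda>w. LBINT x:{w<..}. stein_weight x) has_real_derivative - stein_weight w) (at w)"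
proof -
  define a b where "a = w - 1" and "b = w + 1"
  let ?R = "\<lambda>u. LBINT x:{u<..}. stein_weight x"
  have split: "?R u = ?R a - (LBINT y=a..u. stein_weight y)" if "a \<le> u" for u
  proof -
    have i: "set_integrable lborel A stein_weight" if "A \<in> sets borel" for A
      using integrable_stein_weight that unfolding set_integrable_def by (intro integrable_mult_indicator) auto
    have "?R a = (LBINT x:({a<..u} \<union> {u<..}). stein_weight x)" using that by (simp add: ivl_disj_un)
    also have "\<dots> = (LBINT x:{a<..u}. stein_weight x) + ?R u"
      by (intro set_integral_Un i) auto
    also have "(LBINT x:{a<..u}. stein_weight x) = (LBINT y=a..u. stein_weight y)"
      using that by (simp add: interval_integral_Ioc)
    finally show ?thesis by simp
  qed
  have "((\<lambda>u. LBINT y=a..u. stein_weight y) has_vector_derivative stein_weight w) (at w within {a..b})"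
    using continuous_stein_weight
    by (intro interval_integral_FTC2) (auto simp: a_def b_def intro: continuous_at_imp_continuous_on)
  then have "((\<lambda>u. LBINT y=a..u. stein_weight y) has_vector_derivative stein_weight w) (at w)"
    by (subst (asm) at_within_interior) (auto simp: a_def b_def)
  then have "((\<lambda>u. ?R a - (LBINT y=a..u. stein_weight y)) has_real_derivative - stein_weight w) (at w)"
    by (auto intro!: derivative_eq_intros simp: has_real_derivative_iff_has_vector_derivative[symmetric])
  then show ?thesis
  proof (rule has_field_derivative_transform_within_open)
    show "?R a - (LBINT y=a..u. stein_weight y) = ?R u" if "u \<in> {a<..<b}" for u
      using split[of u] that by simp
  qed (auto simp: a_def b_def)
qed

lemma stein_sol_derivative: "(stein_sol has_real_derivative stein_deriv w) (at w)"
proof -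
  let ?R = "\<lambda>u. LBINT x:{u<..}. stein_weight x"
  have g: "gauss w \<noteq> 0" using gauss_pos[of w] by simp
  have "((\<lambda>w. - ?R w / gauss w) has_real_derivative
      ((stein_weight w) * gauss w - (- ?R w) * (- w * gauss w)) / (gauss w * gauss w)) (at w)"
    by (rule DERIV_divide[OF _ gauss_derivative g])
      (use DERIV_minus[OF stein_tail_derivative[of w]] in simp)
  moreover have "((stein_weight w) * gauss w - (- ?R w) * (- w * gauss w)) / (gauss w * gauss w) = stein_deriv w"
    using g by (simp add: stein_deriv_def stein_sol_def stein_weight_def field_simps)
  ultimately show ?thesis unfolding stein_sol_def[abs_def] by simp
qed

text \<open>On the tail the centered test function is at most \<open>x + 1\<close>. The first
  summand integrates to \<open>gauss w\<close>, the second to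
  \<open>gauss_tail w \<le> 6 * gauss w\<close>; together they give 7.\<close>

lemma stein_sol_bound_pos:
  assumes w: "0 \<le> w"
  shows "\<bar>stein_sol w\<bar> \<le> 7"
proof -
  have "\<bar>LBINT x:{w<..}. stein_weight x\<bar> \<le> (LBINT x:{w<..}. \<bar>stein_weight x\<bar>)"
    unfolding set_lebesgue_integral_def
    using integral_abs_bound[of lborel "\<lambda>x. indicator {w<..} x *\<^sub>R stein_weight x"] by (simp add: abs_mult)
  also have "\<dots> \<le> (LBINT x:{w<..}. x * gauss x + gauss x)"
  proof (rule set_integral_mono)
    show "set_integrable lborel {w<..} (\<lambda>x. \<bar>stein_weight x\<bar>)"
      using integrable_stein_weight by (intro set_integrable_tail) auto
    show "set_integrable lborel {w<..} (\<lambda>x. x * gauss x + gauss x)"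
      using integrable_gauss integrable_mult_gauss by (intro set_integrable_tail) auto
    fix x assume "x \<in> {w<..}"
    then have "\<bar>h x - gauss_mean\<bar> * gauss x \<le> (x + 1) * gauss x"
      using h_mean_bound[of x] w gauss_pos[of x] by (intro mult_right_mono) auto
    moreover have "\<bar>stein_weight x\<bar> = \<bar>h x - gauss_mean\<bar> * gauss x"
      using gauss_pos[of x] by (simp add: stein_weight_def abs_mult)
    ultimately show "\<bar>stein_weight x\<bar> \<le> x * gauss x + gauss x"
      by (simp add: ring_distribs)
  qed
  also have "\<dots> = gauss w + gauss_tail w"
    using set_integral_add(2)[OF set_integrable_tail[OF integrable_mult_gauss] set_integrable_tail[OF integrable_gauss]]
    by (simp add: gauss_tail_first gauss_tail_def)
  also have "\<dots> \<le> 7 * gauss w" using gauss_tail_le[OF w] by simp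
  finally have "\<bar>LBINT x:{w<..}. stein_weight x\<bar> / gauss w \<le> 7"
    using gauss_pos[of w] by (simp add: pos_divide_le_eq)
  then show ?thesis using gauss_pos[of w] by (simp add: stein_sol_def)
qed

text \<open>
  Writing \<open>h w - gauss_mean\<close> as an integral against \<open>x * gauss x\<close> expresses the derivative through
  \<open>(x - w) (h w - gauss_mean) - w (h x - h w)\<close>, which needs no derivative of \<open>h\<close>.
\<close>

lemma stein_deriv_bound_pos:
  assumes w: "0 \<le> w"
  shows "\<bar>stein_deriv w\<bar> \<le> 3" "\<bar>w * stein_deriv w\<bar> \<le> 3"
proof -
  let ?c = "h w - gauss_mean"
  have i1: "set_integrable lborel {w<..} (\<lambda>x. ?c * (x * gauss x))"
    using integrable_mult_gauss by (intro set_integrable_tail) auto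
  have i2: "set_integrable lborel {w<..} (\<lambda>x. w * stein_weight x)"
    using integrable_stein_weight by (intro set_integrable_tail) auto
  have "stein_deriv w * gauss w = ?c * gauss w - w * (LBINT x:{w<..}. stein_weight x)"
    using gauss_pos[of w] by (simp add: stein_deriv_def stein_sol_def field_simps)
  also have "\<dots> = (LBINT x:{w<..}. ?c * (x * gauss x)) - (LBINT x:{w<..}. w * stein_weight x)"
    by (simp add: set_integral_mult_right gauss_tail_first)
  also have "\<dots> = (LBINT x:{w<..}. ?c * (x * gauss x) - w * stein_weight x)"
    by (rule set_integral_diff(2)[OF i1 i2, symmetric])
  finally have eq: "stein_deriv w * gauss w = (LBINT x:{w<..}. ?c * (x * gauss x) - w * stein_weight x)" .
  have "\<bar>stein_deriv w\<bar> * gauss w = \<bar>stein_deriv w * gauss w\<bar>" using gauss_pos[of w] by (simp add: abs_mult)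
  also have "\<dots> \<le> (LBINT x:{w<..}. \<bar>?c * (x * gauss x) - w * stein_weight x\<bar>)"
    unfolding eq set_lebesgue_integral_def
    using integral_abs_bound[of lborel "\<lambda>x. indicator {w<..} x *\<^sub>R (?c * (x * gauss x) - w * stein_weight x)"]
    by (simp add: abs_mult)
  also have "\<dots> \<le> (LBINT x:{w<..}. (2 * w + 1) * ((x - w) * gauss x))"
  proof (rule set_integral_mono)
    show "set_integrable lborel {w<..} (\<lambda>x. \<bar>?c * (x * gauss x) - w * stein_weight x\<bar>)"
      using integrable_mult_gauss integrable_stein_weight by (intro set_integrable_tail) auto
    show "set_integrable lborel {w<..} (\<lambda>x. (2 * w + 1) * ((x - w) * gauss x))"
      using integrable_mult_gauss integrable_gauss unfolding left_diff_distrib[of _ _ "gauss _"]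
      by (intro set_integrable_tail) auto
    fix x assume x: "x \<in> {w<..}"
    have "?c * (x * gauss x) - w * stein_weight x = ((x - w) * ?c - w * (h x - h w)) * gauss x"
      by (simp add: stein_weight_def algebra_simps)
    moreover have "\<bar>(x - w) * ?c - w * (h x - h w)\<bar> \<le> (2 * w + 1) * (x - w)"
    proof -
      have "\<bar>(x - w) * ?c\<bar> \<le> (x - w) * (w + 1)"
        using h_mean_bound[of w] x w unfolding abs_mult by (intro mult_mono) auto
      moreover have "\<bar>w * (h x - h w)\<bar> \<le> w * (x - w)"
        using h_lip[of x w] x w unfolding abs_mult by (intro mult_mono) auto
      ultimately show ?thesis by (simp add: algebra_simps)
    qed
    ultimately show "\<bar>?c * (x * gauss x) - w * stein_weight x\<bar> \<le> (2 * w + 1) * ((x - w) * gauss x)"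
      using gauss_pos[of x] by (simp add: abs_mult mult.assoc[symmetric])
  qed
  also have "\<dots> = (2 * w + 1) * gauss_gap w" by (simp add: set_integral_mult_right gauss_gap_def)
  finally have b: "\<bar>stein_deriv w\<bar> * gauss w \<le> (2 * w + 1) * gauss_gap w" .
  note gap = gauss_gap_bounds[OF w] gauss_gap_nonneg[of w]
  have ww: "2 * w \<le> 1 + w\<^sup>2" using zero_le_power2[of "w - 1"] by (simp add: power2_eq_square algebra_simps)
  have "2 * w * gauss_gap w \<le> (1 + w\<^sup>2) * gauss_gap w" using ww gap(3) by (rule mult_right_mono)
  then have c: "2 * w * gauss_gap w \<le> 2 * gauss w" using gap by (simp add: ring_distribs)
  then have "\<bar>stein_deriv w\<bar> * gauss w \<le> 3 * gauss w" using b gap by (simp add: ring_distribs)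
  then show "\<bar>stein_deriv w\<bar> \<le> 3" using gauss_pos[of w] by simp
  have "w * (\<bar>stein_deriv w\<bar> * gauss w) \<le> w * ((2 * w + 1) * gauss_gap w)" using b w by (rule mult_left_mono)
  also have "\<dots> = 2 * (w\<^sup>2 * gauss_gap w) + w * gauss_gap w" by (simp add: power2_eq_square algebra_simps)
  also have "\<dots> \<le> 3 * gauss w" using gap c by simp
  finally have "\<bar>w * stein_deriv w\<bar> * gauss w \<le> 3 * gauss w" using w by (simp add: abs_mult)
  then show "\<bar>w * stein_deriv w\<bar> \<le> 3" using gauss_pos[of w] by simp
qed

end

text \<open>Reflection exchanges the upper and the lower tail integral, and these differ only in
  sign because \<open>stein_weight\<close> has total integral 0. This carries the bounds from
  \<open>w \<ge> 0\<close> to the whole line.\<close>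

lemma lipschitz_test_reflect:
  assumes "lipschitz_test h"
  shows "lipschitz_test (\<lambda>x. h (- x))"
    and "lipschitz_test.stein_sol h w = - lipschitz_test.stein_sol (\<lambda>x. h (- x)) (- w)"
    and "lipschitz_test.stein_deriv h w = lipschitz_test.stein_deriv (\<lambda>x. h (- x)) (- w)"
proof -
  interpret h: lipschitz_test h by fact
  show "lipschitz_test (\<lambda>x. h (- x))"
  proof
    show "\<bar>h (- x) - h (- y)\<bar> \<le> \<bar>x - y\<bar>" for x y using h.h_lip[of "- x" "- y"] by simp
  qed
  then interpret r: lipschitz_test "\<lambda>x. h (- x)" .
  have mean: "r.gauss_mean = h.gauss_mean"
    unfolding r.gauss_mean_def h.gauss_mean_def
    using lborel_integral_real_affine[of "-1" "\<lambda>x. h x * gauss x" 0] by simp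
  have weight: "r.stein_weight x = h.stein_weight (- x)" for x
    by (simp add: r.stein_weight_def h.stein_weight_def mean)
  have i: "set_integrable lborel A h.stein_weight" if "A \<in> sets borel" for A
    using h.integrable_stein_weight that unfolding set_integrable_def by (intro integrable_mult_indicator) auto
  have ind: "indicator {- w<..} x = (indicator {..<w} (- x) :: real)" for x
    by (auto simp: indicator_def)
  have "(LBINT x:{- w<..}. r.stein_weight x) = (LBINT x:{..<w}. h.stein_weight x)"
    unfolding set_lebesgue_integral_def weight ind
    using lborel_integral_real_affine[of "-1" "\<lambda>x. indicator {..<w} x *\<^sub>R h.stein_weight x" 0]
    by simp
  also have "\<dots> = - (LBINT x:{w<..}. h.stein_weight x)"
  proof -
    have "0 = (LBINT x:({..<w} \<union> {w<..}). h.stein_weight x)"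
    proof -
      have "(LBINT x:({..<w} \<union> {w<..}). h.stein_weight x) = integral\<^sup>L lborel h.stein_weight"
        unfolding set_lebesgue_integral_def
      proof (rule integral_cong_AE)
        show "AE x in lborel. indicator ({..<w} \<union> {w<..}) x *\<^sub>R h.stein_weight x = h.stein_weight x"
          using AE_lborel_singleton[of w] by eventually_elim (auto simp: indicator_def)
      qed (use h.integrable_stein_weight in auto)
      then show ?thesis by (simp add: h.integral_stein_weight)
    qed
    also have "\<dots> = (LBINT x:{..<w}. h.stein_weight x) + (LBINT x:{w<..}. h.stein_weight x)"
      by (intro set_integral_Un i) auto
    finally show ?thesis by simp
  qed
  finally show sol: "h.stein_sol w = - r.stein_sol (- w)"
    by (simp add: r.stein_sol_def h.stein_sol_def)
  show "h.stein_deriv w = r.stein_deriv (- w)"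
    by (simp add: r.stein_deriv_def h.stein_deriv_def sol mean)
qed

context lipschitz_test
begin

lemma stein_bounds: "\<bar>stein_sol w\<bar> \<le> 7" "\<bar>stein_deriv w\<bar> \<le> 3" "\<bar>w * stein_deriv w\<bar> \<le> 3"
proof -
  interpret r: lipschitz_test "\<lambda>x. h (- x)"
    by (rule lipschitz_test_reflect(1)) (rule lipschitz_test_axioms)
  note r = lipschitz_test_reflect(2,3)[OF lipschitz_test_axioms, of w]
  show "\<bar>stein_sol w\<bar> \<le> 7" "\<bar>stein_deriv w\<bar> \<le> 3" "\<bar>w * stein_deriv w\<bar> \<le> 3"
    using stein_sol_bound_pos[of w] r.stein_sol_bound_pos[of "- w"] stein_deriv_bound_pos[of w]
      r.stein_deriv_bound_pos[of "- w"] r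
    by (cases "0 \<le> w"; simp)+
qed

text \<open>The derivative of \<open>w * stein_sol w\<close> is
  \<open>stein_sol w + w * stein_deriv w\<close>, bounded by 7 + 3; the summand \<open>h\<close>
  contributes the Lipschitz constant 1. This is why a bound on \<open>w * stein_deriv w\<close> was
  established.\<close>

lemma stein_deriv_lipschitz: "\<bar>stein_deriv b - stein_deriv a\<bar> \<le> 11 * \<bar>b - a\<bar>"
proof -
  have d: "((\<lambda>w. w * stein_sol w) has_real_derivative (stein_sol w + w * stein_deriv w)) (at w)" for w
    using stein_sol_derivative[of w] by (auto intro!: derivative_eq_intros)
  have "norm (b * stein_sol b - a * stein_sol a) \<le> 10 * norm (b - a)"
  proof (rule field_differentiable_bound[where S = UNIV])
    fix w :: real
    show "((\<lambda>w. w * stein_sol w) has_field_derivative (stein_sol w + w * stein_deriv w)) (at w within UNIV)"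
      using d by simp
    show "norm (stein_sol w + w * stein_deriv w) \<le> 10"
      using stein_bounds[of w] by simp
  qed auto
  then have "\<bar>b * stein_sol b - a * stein_sol a\<bar> \<le> 10 * \<bar>b - a\<bar>" by simp
  moreover have "stein_deriv b - stein_deriv a = (b * stein_sol b - a * stein_sol a) + (h b - h a)"
    by (simp add: stein_deriv_def)
  moreover have "\<bar>(b * stein_sol b - a * stein_sol a) + (h b - h a)\<bar>
      \<le> \<bar>b * stein_sol b - a * stein_sol a\<bar> + \<bar>h b - h a\<bar>" by (rule abs_triangle_ineq)
  ultimately have "\<bar>stein_deriv b - stein_deriv a\<bar> \<le> 10 * \<bar>b - a\<bar> + \<bar>h b - h a\<bar>" by simp
  then show ?thesis using h_lip[of b a] by simp
qed

end

text \<open>Rescaling to variance \<open>s\<^sup>2\<close>: the function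
  \<open>h (s * x) / s\<close> is again 1-Lipschitz, and every derivative of its solution gains a
  factor \<open>1 / s\<close>.\<close>

lemma stein_equation:
  fixes h :: "real \<Rightarrow> real" and s :: real
  assumes h: "\<And>x y. \<bar>h x - h y\<bar> \<le> \<bar>x - y\<bar>" and s: "0 < s"
  obtains B B' where "\<And>u. (B has_real_derivative B' u) (at u)" "\<And>u. \<bar>B u\<bar> \<le> 7" "\<And>u. \<bar>B' u\<bar> \<le> 3 / s"
    "\<And>u v. \<bar>B' u - B' v\<bar> \<le> 11 / s\<^sup>2 * \<bar>u - v\<bar>"
    "\<And>u. h u - (LBINT z. std_normal_density z * h (s * z)) = s\<^sup>2 * B' u - u * B u"
proof -
  define k where "k = (\<lambda>x. h (s * x) / s)"
  interpret k: lipschitz_test k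
  proof
    show "\<bar>k x - k y\<bar> \<le> \<bar>x - y\<bar>" for x y
    proof -
      have "\<bar>k x - k y\<bar> = \<bar>h (s * x) - h (s * y)\<bar> / s"
        using s by (simp add: k_def diff_divide_distrib[symmetric] abs_divide)
      also have "\<dots> \<le> \<bar>s * x - s * y\<bar> / s" using h s by (intro divide_right_mono) auto
      also have "\<dots> = \<bar>x - y\<bar>" using s by (simp add: right_diff_distrib[symmetric] abs_mult)
      finally show ?thesis .
    qed
  qed
  define B where "B = (\<lambda>u. k.stein_sol (u / s))"
  define B' where "B' = (\<lambda>u. k.stein_deriv (u / s) / s)"
  show thesis
  proof (rule that[of B B'])
    show "(B has_real_derivative B' u) (at u)" for u
    proof -
      have "((\<lambda>u. u / s) has_real_derivative 1 / s) (at u)"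
        by (rule DERIV_cdivide[OF DERIV_ident])
      from DERIV_chain2[OF k.stein_sol_derivative this] show ?thesis by (simp add: B_def B'_def)
    qed
    show "\<bar>B u\<bar> \<le> 7" for u by (simp add: B_def k.stein_bounds)
    show "\<bar>B' u\<bar> \<le> 3 / s" for u
      using k.stein_bounds(2)[of "u / s"] s by (simp add: B'_def abs_divide divide_right_mono)
    show "\<bar>B' u - B' v\<bar> \<le> 11 / s\<^sup>2 * \<bar>u - v\<bar>" for u v
    proof -
      have "\<bar>B' u - B' v\<bar> = \<bar>k.stein_deriv (u / s) - k.stein_deriv (v / s)\<bar> / s"
        using s by (simp add: B'_def diff_divide_distrib[symmetric] abs_divide)
      also have "\<dots> \<le> (11 * \<bar>u / s - v / s\<bar>) / s"
        using k.stein_deriv_lipschitz s by (intro divide_right_mono) auto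
      also have "\<dots> = 11 / s\<^sup>2 * \<bar>u - v\<bar>"
        using s by (simp add: diff_divide_distrib[symmetric] abs_divide power2_eq_square)
      finally show ?thesis .
    qed
    show "h u - (LBINT z. std_normal_density z * h (s * z)) = s\<^sup>2 * B' u - u * B u" for u
    proof -
      have "k.gauss_mean = (LBINT z. std_normal_density z * h (s * z)) / s"
        unfolding k.gauss_mean_def by (simp add: k_def gauss_eq mult.commute)
      moreover have "s\<^sup>2 * B' u - u * B u = s * (k (u / s) - k.gauss_mean)"
        using s by (simp add: B_def B'_def k.stein_deriv_def power2_eq_square field_simps)
      moreover have "k (u / s) = h u / s" using s by (simp add: k_def)
      ultimately show ?thesis using s by (simp add: right_diff_distrib)
    qed
  qed
qed

section \<open>Expansion of the Stein functional\<close>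

context subcritical_system
begin

lemma abs_expectation_le:
  fixes \<psi> :: "real \<Rightarrow> real"
  assumes c: "0 \<le> c" and b: "\<And>x. 0 < x \<Longrightarrow> x < 1 \<Longrightarrow> \<bar>\<psi> x\<bar> \<le> c"
  shows "\<bar>integral\<^sup>L \<nu> \<psi>\<bar> \<le> c"
proof (cases "integrable \<nu> \<psi>")
  case True
  have "\<bar>integral\<^sup>L \<nu> \<psi>\<bar> \<le> (\<integral>x. \<bar>\<psi> x\<bar> \<partial>\<nu>)" by (rule integral_abs_bound)
  also have "\<dots> \<le> c"
    using True b by (intro \<nu>.integral_le_const integrable_abs AE_I2) auto
  finally show ?thesis .
next
  case False
  then show ?thesis using c by (simp add: not_integrable_integral_eq)
qed

lemma expectation_diff_le:
  fixes \<phi> \<psi> :: "real \<Rightarrow> real"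
  assumes "integrable \<nu> \<phi>" "integrable \<nu> \<psi>" "0 \<le> c" "\<And>x. 0 < x \<Longrightarrow> x < 1 \<Longrightarrow> \<bar>\<phi> x - \<psi> x\<bar> \<le> c"
  shows "\<bar>integral\<^sup>L \<nu> \<phi> - integral\<^sup>L \<nu> \<psi>\<bar> \<le> c"
  using abs_expectation_le[of c "\<lambda>x. \<phi> x - \<psi> x"] assms by simp

end

text \<open>Both bounds on \<open>f\<close> are required on the whole line; the observable of the
  theorem is extended by clamping its argument to \<open>[0, 1]\<close>. The rate \<open>w\<close>
  of memory loss stays abstract until the final estimates.\<close>

locale observable = subcritical_system +
  fixes f :: "real \<Rightarrow> real" and L :: real and w :: "nat \<Rightarrow> real"
  assumes f_lip: "\<And>x y. \<bar>f x - f y\<bar> \<le> L * \<bar>x - y\<bar>" and f_osc: "\<And>x y. \<bar>f x - f y\<bar> \<le> L"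
    and L_ge_1: "1 \<le> L" and w_loss: "\<And>m j. loss_bound (shift m \<alpha>) j (w j)" and w_nonneg: "\<And>j. 0 \<le> w j"
begin

definition centered :: "nat \<Rightarrow> real \<Rightarrow> real" where
  "centered i y = f y - (\<integral>x. f (intermittent_iter \<alpha> i x) \<partial>\<nu>)"

definition \<zeta> :: "nat \<Rightarrow> real \<Rightarrow> real" where
  "\<zeta> i x = centered i (intermittent_iter \<alpha> i x)"

lemma measurable_f [measurable]: "f \<in> borel_measurable borel"
proof -
  have "L-lipschitz_on UNIV f"
    using f_lip L_ge_1 by (intro lipschitz_onI) (auto simp: dist_real_def)
  then show ?thesis
    by (intro borel_measurable_continuous_onI lipschitz_on_continuous_on)
qed

lemma measurable_centered [measurable]: "centered i \<in> borel_measurable borel"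
  unfolding centered_def by measurable

lemma measurable_\<zeta> [measurable]: "\<zeta> i \<in> borel_measurable borel"
  unfolding \<zeta>_def by measurable

lemma measurable_proj' [measurable]: "proj m \<alpha> \<in> borel_measurable borel"
  using measurable_proj[OF adm, of "\<lambda>x. x"] by simp

lemma f_iter_integrable: "integrable \<nu> (\<lambda>x. f (intermittent_iter \<alpha> i x))"
proof (rule integrable_\<nu>_bounded)
  show "\<bar>f (intermittent_iter \<alpha> i x)\<bar> \<le> \<bar>f 0\<bar> + L" for x
    using f_osc[of "intermittent_iter \<alpha> i x" 0] by linarith
qed measurable

lemma centered_bound: "\<bar>centered i y\<bar> \<le> L"
proof -
  have "centered i y = (\<integral>x. f y - f (intermittent_iter \<alpha> i x) \<partial>\<nu>)"
    using f_iter_integrable \<nu>.prob_space by (simp add: centered_def)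
  then show ?thesis
    using abs_expectation_le[of L "\<lambda>x. f y - f (intermittent_iter \<alpha> i x)"] f_osc L_ge_1 by simp
qed

lemma centered_lip: "\<bar>centered i x - centered i y\<bar> \<le> L * \<bar>x - y\<bar>"
  using f_lip by (simp add: centered_def)

lemma \<zeta>_bound: "\<bar>\<zeta> i x\<bar> \<le> L"
  unfolding \<zeta>_def by (rule centered_bound)

lemma \<zeta>_mean: "integral\<^sup>L \<nu> (\<zeta> i) = 0"
  unfolding \<zeta>_def[abs_def] centered_def using f_iter_integrable \<nu>.prob_space by simp

lemma end_bound_mono: "i \<le> j \<Longrightarrow> end_bound j \<le> end_bound i"
  unfolding end_bound_def using \<beta>_pos by (intro powr_mono2') (auto intro!: add_pos_nonneg mult_left_mono)

lemma end_bound_nonneg: "0 \<le> end_bound i"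
  by (simp add: end_bound_def)

lemma \<zeta>_proj:
  assumes "i \<le> m" "0 < x" "x < 1"
  shows "\<bar>\<zeta> i x - \<zeta> i (proj m \<alpha> x)\<bar> \<le> L * end_bound (m - i)"
proof -
  let ?y = "intermittent_iter \<alpha> i x"
  have y: "0 \<le> ?y" "?y \<le> 1" using intermittent_iter_unit[OF adm, of x i] assms by auto
  have adm': "admissible \<beta> (shift i \<alpha>)" by (rule admissible_shift[OF adm])
  have "\<bar>\<zeta> i x - \<zeta> i (proj m \<alpha> x)\<bar> \<le> L * \<bar>?y - proj (m - i) (shift i \<alpha>) ?y\<bar>"
    unfolding \<zeta>_def intermittent_iter_proj[OF adm assms(1)] by (rule centered_lip)
  also have "\<dots> \<le> L * end_bound (m - i)"
    using proj_dist[OF adm' y, of "m - i"] left_end_le[OF adm', of "m - i"] L_ge_1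
    by (intro mult_left_mono) auto
  finally show ?thesis .
qed

lemma \<zeta>_iter: "i \<le> j \<Longrightarrow> \<zeta> j x = centered j (intermittent_iter (shift i \<alpha>) (j - i) (intermittent_iter \<alpha> i x))"
  using intermittent_iter_add[of \<alpha> i "j - i" x] by (simp add: \<zeta>_def)

text \<open>One half of the gap \<open>d\<close> is spent on approximating the earlier variable by
  cylinders, the other half on decoupling.\<close>

definition cov_bound :: "nat \<Rightarrow> real" where
  "cov_bound d = L\<^sup>2 * (end_bound (d div 2) + 2 * w (d - d div 2))"

lemma cov_bound_nonneg: "0 \<le> cov_bound d"
  unfolding cov_bound_def using end_bound_nonneg w_nonneg by (intro mult_nonneg_nonneg add_nonneg_nonneg) auto

lemma integrable_mult_bounded:
  fixes \<phi> \<psi> :: "real \<Rightarrow> real"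
  assumes "\<phi> \<in> borel_measurable borel" "\<psi> \<in> borel_measurable borel" "\<And>x. \<bar>\<phi> x\<bar> \<le> a" "\<And>x. \<bar>\<psi> x\<bar> \<le> b"
  shows "integrable \<nu> (\<lambda>x. \<phi> x * \<psi> x)"
proof (rule integrable_\<nu>_bounded)
  show "(\<lambda>x. \<phi> x * \<psi> x) \<in> borel_measurable borel" using assms(1,2) by measurable
  show "\<bar>\<phi> x * \<psi> x\<bar> \<le> a * b" for x
    unfolding abs_mult using assms(3)[of x] assms(4)[of x] by (intro mult_mono) auto
qed

lemma covariance_less:
  assumes "i < j"
  shows "\<bar>\<integral>x. \<zeta> i x * \<zeta> j x \<partial>\<nu>\<bar> \<le> cov_bound (j - i)"
proof -
  define l where "l = (j - i) div 2"
  define m where "m = i + l"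
  have mj: "m + (j - i - l) = j" "i \<le> m" using assms by (auto simp: m_def l_def)
  have i1: "integrable \<nu> (\<lambda>x. \<zeta> i x * \<zeta> j x)"
    using \<zeta>_bound by (intro integrable_mult_bounded) auto
  have i2: "integrable \<nu> (\<lambda>x. \<zeta> i (proj m \<alpha> x) * \<zeta> j x)"
    using \<zeta>_bound by (intro integrable_mult_bounded) auto
  have "\<bar>(\<integral>x. \<zeta> i x * \<zeta> j x \<partial>\<nu>) - (\<integral>x. \<zeta> i (proj m \<alpha> x) * \<zeta> j x \<partial>\<nu>)\<bar> \<le> L * end_bound l * L"
  proof (rule expectation_diff_le[OF i1 i2])
    show "0 \<le> L * end_bound l * L" using L_ge_1 end_bound_nonneg by simp
    fix x :: real assume x: "0 < x" "x < 1"
    have "\<bar>\<zeta> i x * \<zeta> j x - \<zeta> i (proj m \<alpha> x) * \<zeta> j x\<bar> = \<bar>\<zeta> i x - \<zeta> i (proj m \<alpha> x)\<bar> * \<bar>\<zeta> j x\<bar>"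
      by (simp add: left_diff_distrib[symmetric] abs_mult)
    also have "\<dots> \<le> L * end_bound l * L"
      using \<zeta>_proj[OF mj(2) x] \<zeta>_bound[of j x] end_bound_nonneg L_ge_1
      by (intro mult_mono) (auto simp: m_def)
    finally show "\<bar>\<zeta> i x * \<zeta> j x - \<zeta> i (proj m \<alpha> x) * \<zeta> j x\<bar> \<le> L * end_bound l * L" .
  qed
  moreover have "\<bar>(\<integral>x. \<zeta> i (proj m \<alpha> x) * \<zeta> j x \<partial>\<nu>)\<bar> \<le> 2 * (L * L) * w (j - i - l)"
  proof -
    define F where "F p y = \<zeta> i p * centered j y" for p y
    have Fm: "case_prod F \<in> borel_measurable (borel \<Otimes>\<^sub>M borel)"
      unfolding F_def split_beta' by measurable
    have FB: "\<bar>F p y\<bar> \<le> L * L" for p y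
      unfolding F_def abs_mult using \<zeta>_bound centered_bound L_ge_1 by (intro mult_mono) auto
    note d = decoupling[OF w_loss[of m "j - i - l"] Fm FB, unfolded mj(1)]
    have "(\<integral>x. F (proj m \<alpha> x) (intermittent_iter \<alpha> j z) \<partial>\<nu>)
        = \<zeta> j z * (\<integral>x. \<zeta> i (proj m \<alpha> x) \<partial>\<nu>)" for z
      unfolding F_def \<zeta>_def[of j] by (simp add: mult.commute)
    then have z0: "(\<integral>z. (\<integral>x. F (proj m \<alpha> x) (intermittent_iter \<alpha> j z) \<partial>\<nu>) \<partial>\<nu>) = 0"
      using \<zeta>_mean by simp
    show ?thesis using d[unfolded z0] unfolding F_def \<zeta>_def[of j] by simp
  qed
  ultimately have "\<bar>\<integral>x. \<zeta> i x * \<zeta> j x \<partial>\<nu>\<bar> \<le> L * end_bound l * L + 2 * (L * L) * w (j - i - l)"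
    by linarith
  also have "\<dots> = cov_bound (j - i)" by (simp add: cov_bound_def l_def power2_eq_square algebra_simps)
  finally show ?thesis .
qed

lemma covariance: "\<bar>\<integral>x. \<zeta> i x * \<zeta> j x \<partial>\<nu>\<bar> \<le> cov_bound (nat \<bar>int i - int j\<bar>)"
proof -
  consider "i < j" | "j < i" | "i = j" by linarith
  then show ?thesis
  proof cases
    case 1
    then show ?thesis using covariance_less[of i j] by (simp add: nat_diff_distrib' abs_if)
  next
    case 2
    then show ?thesis using covariance_less[of j i] by (simp add: nat_diff_distrib' abs_if mult.commute)
  next
    case 3
    have "\<bar>\<integral>x. \<zeta> i x * \<zeta> j x \<partial>\<nu>\<bar> \<le> L * L"
    proof (rule abs_expectation_le)
      show "\<bar>\<zeta> i x * \<zeta> j x\<bar> \<le> L * L" for x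
        unfolding abs_mult using \<zeta>_bound L_ge_1 by (intro mult_mono) auto
    qed (use L_ge_1 in auto)
    \<comment> \<open>At distance 0 the estimate is trivial, since
      \<open>end_bound 0 = 1\<close>.\<close>
    also have "L * L \<le> cov_bound 0"
      using w_nonneg[of 0] L_ge_1 by (simp add: cov_bound_def end_bound_def power2_eq_square mult_le_cancel_left1)
    finally show ?thesis using 3 by simp
  qed
qed

text \<open>
  The mean-zero middle block is first decoupled from the future sum \<open>R\<close> and then, with \<open>R\<close>
  frozen, from the past sum \<open>Q\<close>.
\<close>

lemma three_block:
  fixes M' R' A :: "real \<Rightarrow> real" and a p m k :: nat
  defines "M \<equiv> \<lambda>x. M' (intermittent_iter \<alpha> a x)"
    and "Q \<equiv> \<lambda>x. \<Sum>i<p. \<zeta> i x"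
    and "R \<equiv> \<lambda>x. R' (intermittent_iter \<alpha> (m + k) x)"
  assumes M'm: "M' \<in> borel_measurable borel" and bM: "\<And>y. \<bar>M' y\<bar> \<le> bM"
    and eM: "\<And>x. 0 < x \<Longrightarrow> x < 1 \<Longrightarrow> \<bar>M x - M (proj m \<alpha> x)\<bar> \<le> eM"
    and mean: "integral\<^sup>L \<nu> M = 0"
    and R'm: "R' \<in> borel_measurable borel" and Am: "A \<in> borel_measurable borel"
    and a0: "\<And>u. \<bar>A u\<bar> \<le> a0" and a1: "\<And>u v. \<bar>A u - A v\<bar> \<le> a1 * \<bar>u - v\<bar>"
    and pa: "p = 0 \<or> p + 2 * k \<le> a" and pm: "p + k \<le> m"
    and eQ: "L * (\<Sum>i<p. end_bound (p + k - i)) \<le> eQ"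
  shows "\<bar>\<integral>x. M x * A (Q x + R x) \<partial>\<nu>\<bar> \<le> 2 * eM * a0 + 3 * bM * a1 * eQ + 4 * bM * a0 * w k"
proof -
  note [measurable] = M'm R'm Am
  have [measurable]: "M \<in> borel_measurable borel" "Q \<in> borel_measurable borel" "R \<in> borel_measurable borel"
    unfolding M_def Q_def R_def by measurable
  have bM': "\<bar>M x\<bar> \<le> bM" for x unfolding M_def by (rule bM)
  have nn: "0 \<le> bM" "0 \<le> a0" using bM[of 0] a0[of 0] by linarith+
  have "0 \<le> a1" using abs_ge_zero[of "A 1 - A 0"] a1[of 1 0] by simp
  have "0 \<le> eM" using eM[of "1/2"] by force
  have Qproj: "\<bar>Q x - Q (proj n \<alpha> x)\<bar> \<le> eQ" if n: "p + k \<le> n" and x: "0 < x" "x < 1" for x n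
  proof -
    have "\<bar>Q x - Q (proj n \<alpha> x)\<bar> \<le> (\<Sum>i<p. \<bar>\<zeta> i x - \<zeta> i (proj n \<alpha> x)\<bar>)"
      unfolding Q_def by (simp add: sum_subtractf[symmetric] sum_abs)
    also have "\<dots> \<le> (\<Sum>i<p. L * end_bound (p + k - i))"
    proof (rule sum_mono)
      fix i assume i: "i \<in> {..<p}"
      then have "\<bar>\<zeta> i x - \<zeta> i (proj n \<alpha> x)\<bar> \<le> L * end_bound (n - i)"
        using n x by (intro \<zeta>_proj) auto
      also have "\<dots> \<le> L * end_bound (p + k - i)"
        using n L_ge_1 by (intro mult_left_mono end_bound_mono) auto
      finally show "\<bar>\<zeta> i x - \<zeta> i (proj n \<alpha> x)\<bar> \<le> L * end_bound (p + k - i)" .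
    qed
    also have "\<dots> \<le> eQ" using eQ by (simp add: sum_distrib_left)
    finally show ?thesis .
  qed
  have eQ0: "0 \<le> eQ" using Qproj[of m "1/2"] pm by force
  have A_diff: "\<bar>x * A u - y * A v\<bar> \<le> d * a0 + bM * a1 * e"
    if "\<bar>x - y\<bar> \<le> d" "\<bar>y\<bar> \<le> bM" "\<bar>u - v\<bar> \<le> e" for x y u v d e
  proof -
    have "x * A u - y * A v = (x - y) * A u + y * (A u - A v)" by (simp add: algebra_simps)
    moreover have "\<bar>(x - y) * A u\<bar> \<le> d * a0"
      unfolding abs_mult using that a0[of u] by (intro mult_mono) auto
    moreover have "\<bar>y * (A u - A v)\<bar> \<le> bM * (a1 * e)"
      unfolding abs_mult
    proof (rule mult_mono)
      show "\<bar>A u - A v\<bar> \<le> a1 * e"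
        using a1[of u v] mult_left_mono[OF that(3) \<open>0 \<le> a1\<close>] by linarith
    qed (use that nn in auto)
    ultimately show ?thesis by simp
  qed
  have int: "integrable \<nu> (\<lambda>x. \<phi> x * A (\<psi> x))"
    if "\<phi> \<in> borel_measurable borel" "\<psi> \<in> borel_measurable borel" "\<And>x. \<bar>\<phi> x\<bar> \<le> bM" for \<phi> \<psi> :: "real \<Rightarrow> real"
    using that a0 by (intro integrable_mult_bounded[where a = bM and b = a0]) auto
  have A_step: "\<bar>(\<integral>x. M x * A (Q x + R x) \<partial>\<nu>) - (\<integral>x. M (proj m \<alpha> x) * A (Q (proj m \<alpha> x) + R x) \<partial>\<nu>)\<bar>
      \<le> eM * a0 + bM * a1 * eQ"
  proof (rule expectation_diff_le)
    show "0 \<le> eM * a0 + bM * a1 * eQ" using nn \<open>0 \<le> a1\<close> \<open>0 \<le> eM\<close> eQ0 by simp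
    show "\<bar>M x * A (Q x + R x) - M (proj m \<alpha> x) * A (Q (proj m \<alpha> x) + R x)\<bar> \<le> eM * a0 + bM * a1 * eQ"
      if "0 < x" "x < 1" for x
      using eM[OF that] Qproj[OF pm that] bM' by (intro A_diff) auto
  qed (use bM' in \<open>auto intro!: int\<close>)
  define F where "F y z = M y * A (Q y + R' z)" for y z
  have Fm: "case_prod F \<in> borel_measurable (borel \<Otimes>\<^sub>M borel)"
    unfolding F_def split_beta' by measurable
  have FB: "\<bar>F y z\<bar> \<le> bM * a0" for y z
    unfolding F_def abs_mult using bM' a0 nn by (intro mult_mono) auto
  have B_step: "\<bar>(\<integral>x. M (proj m \<alpha> x) * A (Q (proj m \<alpha> x) + R x) \<partial>\<nu>)
      - (\<integral>z. (\<integral>x. M (proj m \<alpha> x) * A (Q (proj m \<alpha> x) + R z) \<partial>\<nu>) \<partial>\<nu>)\<bar> \<le> 2 * (bM * a0) * w k"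
    using decoupling[OF w_loss[of m k] Fm FB] unfolding F_def R_def .
  \<comment> \<open>The future is frozen at \<open>\<rho>\<close> and may be an arbitrary shift; the
    mean zero of \<open>M\<close> is used only against the past.\<close>
  have inner: "\<bar>\<integral>x. M (proj m \<alpha> x) * A (Q (proj m \<alpha> x) + \<rho>) \<partial>\<nu>\<bar>
      \<le> eM * a0 + bM * a1 * (2 * eQ) + 2 * (bM * a0) * w k" for \<rho>
  proof -
    \<comment> \<open>\<open>M\<close> returns to its exact form, while \<open>Q\<close> is now read
      from cylinders of length only \<open>p + k\<close>, which leaves a gap of \<open>k\<close>
      before time \<open>a\<close>. The past sum is changed twice, hence
      \<open>2 * eQ\<close>.\<close>
    have C_step: "\<bar>(\<integral>x. M (proj m \<alpha> x) * A (Q (proj m \<alpha> x) + \<rho>) \<partial>\<nu>)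
        - (\<integral>x. M x * A (Q (proj (p + k) \<alpha> x) + \<rho>) \<partial>\<nu>)\<bar> \<le> eM * a0 + bM * a1 * (2 * eQ)"
    proof (rule expectation_diff_le)
      show "0 \<le> eM * a0 + bM * a1 * (2 * eQ)" using nn \<open>0 \<le> a1\<close> \<open>0 \<le> eM\<close> eQ0 by simp
      show "\<bar>M (proj m \<alpha> x) * A (Q (proj m \<alpha> x) + \<rho>) - M x * A (Q (proj (p + k) \<alpha> x) + \<rho>)\<bar>
          \<le> eM * a0 + bM * a1 * (2 * eQ)" if "0 < x" "x < 1" for x
        using eM[OF that] Qproj[OF pm that] Qproj[OF order_refl that] bM'
        by (intro A_diff) (auto simp: abs_minus_commute)
    qed (use bM' in \<open>auto intro!: int\<close>)
    have D_step: "\<bar>\<integral>x. M x * A (Q (proj (p + k) \<alpha> x) + \<rho>) \<partial>\<nu>\<bar> \<le> 2 * (bM * a0) * w k"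
    \<comment> \<open>If the window reaches back to time 0, truncated subtraction gives
      \<open>p = 0\<close>. The gap condition may then fail, but the past sum is empty and the mean
      of \<open>M\<close> already vanishes.\<close>
    proof (cases "p = 0")
      case True
      then have "(\<integral>x. M x * A (Q (proj (p + k) \<alpha> x) + \<rho>) \<partial>\<nu>) = 0"
        using mean by (simp add: Q_def)
      then show ?thesis using nn w_nonneg[of k] by simp
    next
      case False
      then have pa': "p + 2 * k \<le> a" using pa by simp
      define M2 where "M2 y = M' (intermittent_iter (shift (p + 2 * k) \<alpha>) (a - (p + 2 * k)) y)" for y
      have M2: "M x = M2 (intermittent_iter \<alpha> (p + k + k) x)" for x
        using intermittent_iter_add[of \<alpha> "p + 2 * k" "a - (p + 2 * k)" x] pa'
        by (simp add: M_def M2_def mult_2 add.assoc)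
      have [measurable]: "M2 \<in> borel_measurable borel" unfolding M2_def by measurable
      define G where "G y z = A (Q y + \<rho>) * M2 z" for y z
      have Gm: "case_prod G \<in> borel_measurable (borel \<Otimes>\<^sub>M borel)"
        unfolding G_def split_beta' by measurable
      have GB: "\<bar>G y z\<bar> \<le> bM * a0" for y z
      proof -
        have "\<bar>A (Q y + \<rho>)\<bar> * \<bar>M2 z\<bar> \<le> a0 * bM"
          using bM a0 nn unfolding M2_def by (intro mult_mono) auto
        then show ?thesis by (simp add: G_def abs_mult mult.commute)
      qed
      note d = decoupling[OF w_loss[of "p + k" k] Gm GB]
      have "(\<integral>x. G (proj (p + k) \<alpha> x) (intermittent_iter \<alpha> (p + k + k) z) \<partial>\<nu>)
          = M z * (\<integral>x. A (Q (proj (p + k) \<alpha> x) + \<rho>) \<partial>\<nu>)" for z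
        unfolding G_def M2 by (simp add: mult.commute)
      then have z0: "(\<integral>z. (\<integral>x. G (proj (p + k) \<alpha> x) (intermittent_iter \<alpha> (p + k + k) z) \<partial>\<nu>) \<partial>\<nu>) = 0"
        using mean by simp
      show ?thesis using d[unfolded z0] unfolding G_def M2[symmetric] by (simp add: mult.commute)
    qed
    show ?thesis using C_step D_step by linarith
  qed
  have "\<bar>\<integral>z. (\<integral>x. M (proj m \<alpha> x) * A (Q (proj m \<alpha> x) + R z) \<partial>\<nu>) \<partial>\<nu>\<bar>
      \<le> eM * a0 + bM * a1 * (2 * eQ) + 2 * (bM * a0) * w k"
    by (rule abs_expectation_le) (use inner nn \<open>0 \<le> a1\<close> \<open>0 \<le> eM\<close> eQ0 w_nonneg[of k] in auto)
  then have "\<bar>\<integral>x. M x * A (Q x + R x) \<partial>\<nu>\<bar>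
      \<le> (eM * a0 + bM * a1 * eQ) + 2 * (bM * a0) * w k + (eM * a0 + bM * a1 * (2 * eQ) + 2 * (bM * a0) * w k)"
    using A_step B_step by linarith
  also have "\<dots> = 2 * eM * a0 + 3 * bM * a1 * eQ + 4 * bM * a0 * w k" by (simp add: algebra_simps)
  finally show ?thesis .
qed

text \<open>Summable covariances make the second moment linear in the number of summands, where the
  trivial bound would be quadratic.\<close>

lemma integral_sum_square_le:
  assumes J: "finite J" and c0: "\<And>i. i \<in> J \<Longrightarrow> (\<Sum>j\<in>J. cov_bound (nat \<bar>int i - int j\<bar>)) \<le> c0"
  shows "(\<integral>x. (\<Sum>i\<in>J. \<zeta> i x)\<^sup>2 \<partial>\<nu>) \<le> real (card J) * c0"
proof -
  have i: "integrable \<nu> (\<lambda>x. \<zeta> i x * \<zeta> j x)" for i j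
    using \<zeta>_bound by (intro integrable_mult_bounded) auto
  have "(\<integral>x. (\<Sum>i\<in>J. \<zeta> i x)\<^sup>2 \<partial>\<nu>) = (\<integral>x. (\<Sum>i\<in>J. \<Sum>j\<in>J. \<zeta> i x * \<zeta> j x) \<partial>\<nu>)"
    by (simp add: power2_eq_square sum_product)
  also have "\<dots> = (\<Sum>i\<in>J. \<Sum>j\<in>J. \<integral>x. \<zeta> i x * \<zeta> j x \<partial>\<nu>)"
    using i by simp
  also have "\<dots> \<le> (\<Sum>i\<in>J. \<Sum>j\<in>J. cov_bound (nat \<bar>int i - int j\<bar>))"
    using covariance by (intro sum_mono) (auto intro: order_trans[OF abs_ge_self])
  also have "\<dots> \<le> (\<Sum>i\<in>J. c0)" using c0 by (intro sum_mono) auto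
  finally show ?thesis by simp
qed

section \<open>Windows around a time, and the sum outside them\<close>

definition window :: "nat \<Rightarrow> nat \<Rightarrow> nat \<Rightarrow> nat set" where
  "window N r n = {i. i < N \<and> n \<le> i + r \<and> i \<le> n + r}"

definition total :: "nat \<Rightarrow> real \<Rightarrow> real" where
  "total N x = (\<Sum>i<N. \<zeta> i x)"

definition local_sum :: "nat \<Rightarrow> nat \<Rightarrow> nat \<Rightarrow> real \<Rightarrow> real" where
  "local_sum N r n x = (\<Sum>i\<in>window N r n. \<zeta> i x)"

lemma finite_window [simp]: "finite (window N r n)"
  unfolding window_def by (rule finite_subset[of _ "{..<N}"]) auto

lemma card_window: "card (window N r n) \<le> 2 * r + 1"
proof -
  have "card (window N r n) \<le> card {n - r..n + r}"
    by (intro card_mono) (auto simp: window_def)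
  then show ?thesis by simp
qed

lemma measurable_total [measurable]: "total N \<in> borel_measurable borel"
  unfolding total_def by measurable

lemma measurable_local_sum [measurable]: "local_sum N r n \<in> borel_measurable borel"
  unfolding local_sum_def by measurable

lemma sum_\<zeta>_bound: "\<bar>\<Sum>i\<in>J. \<zeta> i x\<bar> \<le> real (card J) * L"
  using order_trans[OF sum_abs sum_bounded_above[of J "\<lambda>i. \<bar>\<zeta> i x\<bar>" L]] \<zeta>_bound by simp

lemma total_bound: "\<bar>total N x\<bar> \<le> real N * L"
  using sum_\<zeta>_bound[where J = "{..<N}" and x = x] by (simp add: total_def)

lemma local_sum_bound: "\<bar>local_sum N r n x\<bar> \<le> real (2 * r + 1) * L"
proof -
  have "\<bar>local_sum N r n x\<bar> \<le> real (card (window N r n)) * L"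
    unfolding local_sum_def by (rule sum_\<zeta>_bound)
  also have "\<dots> \<le> real (2 * r + 1) * L"
    using card_window[of N r n] L_ge_1 by (intro mult_right_mono) (simp_all del: of_nat_add of_nat_mult)
  finally show ?thesis .
qed

lemma total_split:
  assumes "n < N"
  shows "total N x - local_sum N r n x = (\<Sum>i<n - r. \<zeta> i x) + (\<Sum>i\<in>{n + r + 1..<N}. \<zeta> i x)"
proof -
  have eq: "{..<N} = (window N r n \<union> {..<n - r}) \<union> {n + r + 1..<N}"
    using assms by (auto simp: window_def)
  have "total N x = (\<Sum>i\<in>(window N r n \<union> {..<n - r}) \<union> {n + r + 1..<N}. \<zeta> i x)"
    unfolding total_def eq[symmetric] ..
  also have "\<dots> = (\<Sum>i\<in>window N r n \<union> {..<n - r}. \<zeta> i x) + (\<Sum>i\<in>{n + r + 1..<N}. \<zeta> i x)"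
    by (intro sum.union_disjoint) (auto simp: window_def)
  also have "(\<Sum>i\<in>window N r n \<union> {..<n - r}. \<zeta> i x) = local_sum N r n x + (\<Sum>i<n - r. \<zeta> i x)"
    unfolding local_sum_def by (intro sum.union_disjoint) (auto simp: window_def)
  finally show ?thesis by simp
qed

text \<open>Decoupling admits the future only through the state at a single time \<open>j\<close>;
  this rewrites the later summands as functions of that state.\<close>

lemma future_sum:
  assumes "j \<le> n"
  shows "(\<Sum>i\<in>{n..<N}. \<zeta> i x)
    = (\<Sum>i\<in>{n..<N}. centered i (intermittent_iter (shift j \<alpha>) (i - j) (intermittent_iter \<alpha> j x)))"
  using assms by (intro sum.cong) (auto intro!: \<zeta>_iter)

text \<open>Radius \<open>2 * k\<close> leaves two gaps of length \<open>k\<close> on each side: one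
  for the approximation by cylinders, one for the loss of memory. The middle block is the single
  time \<open>n\<close>, with \<open>p = n - 2 * k\<close> and \<open>m = n + k\<close>.\<close>

lemma decoupled_point:
  assumes n: "n < N" and Am: "A \<in> borel_measurable borel"
    and a0: "\<And>u. \<bar>A u\<bar> \<le> a0" and a1: "\<And>u v. \<bar>A u - A v\<bar> \<le> a1 * \<bar>u - v\<bar>"
    and T: "\<And>p. (\<Sum>i<p. end_bound (p + k - i)) \<le> T"
  shows "\<bar>\<integral>x. \<zeta> n x * A (total N x - local_sum N (2 * k) n x) \<partial>\<nu>\<bar>
    \<le> 2 * (L * end_bound k) * a0 + 3 * L * a1 * (L * T) + 4 * L * a0 * w k"
proof -
  define R' where "R' y = (\<Sum>i\<in>{n + 2 * k + 1..<N}. centered i (intermittent_iter (shift (n + k + k) \<alpha>) (i - (n + k + k)) y))" for y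
  have R'm: "R' \<in> borel_measurable borel" unfolding R'_def by measurable
  have R': "(\<Sum>i\<in>{n + 2 * k + 1..<N}. \<zeta> i x) = R' (intermittent_iter \<alpha> (n + k + k) x)" for x
    unfolding R'_def by (rule future_sum) simp
  have eM: "\<bar>centered n (intermittent_iter \<alpha> n x) - centered n (intermittent_iter \<alpha> n (proj (n + k) \<alpha> x))\<bar> \<le> L * end_bound k"
    if "0 < x" "x < 1" for x
    using \<zeta>_proj[of n "n + k" x] that by (simp add: \<zeta>_def)
  have mean: "(\<integral>x. centered n (intermittent_iter \<alpha> n x) \<partial>\<nu>) = 0"
    using \<zeta>_mean[of n] by (simp add: \<zeta>_def[abs_def])
  have LT: "L * (\<Sum>i<n - 2 * k. end_bound (n - 2 * k + k - i)) \<le> L * T"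
    using T[of "n - 2 * k"] L_ge_1 by (intro mult_left_mono) auto
  have "\<bar>\<integral>x. centered n (intermittent_iter \<alpha> n x) * A ((\<Sum>i<n - 2 * k. \<zeta> i x) + R' (intermittent_iter \<alpha> (n + k + k) x)) \<partial>\<nu>\<bar>
    \<le> 2 * (L * end_bound k) * a0 + 3 * L * a1 * (L * T) + 4 * L * a0 * w k"
    by (rule three_block[OF measurable_centered centered_bound eM mean R'm Am a0 a1 _ _ LT]) auto
  then show ?thesis
    unfolding total_split[OF n] R' \<zeta>_def[of n] .
qed

text \<open>The middle block now extends over radius \<open>2 * k\<close>, so the gaps lie between
  \<open>2 * k\<close> and \<open>4 * k\<close>. The product has size at most
  \<open>5 * L\<^sup>2 * real k\<close>, and subtracting its mean doubles this, which explains
  \<open>bM\<close>.\<close>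

lemma decoupled_pair:
  assumes n: "n < N" and Am: "A \<in> borel_measurable borel"
    and a0: "\<And>u. \<bar>A u\<bar> \<le> a0" and a1: "\<And>u v. \<bar>A u - A v\<bar> \<le> a1 * \<bar>u - v\<bar>"
    and T: "\<And>p. (\<Sum>i<p. end_bound (p + k - i)) \<le> T"
    and k: "1 \<le> k"
  defines "\<gamma> \<equiv> \<integral>x. \<zeta> n x * local_sum N (2 * k) n x \<partial>\<nu>"
    and "bM \<equiv> 10 * L\<^sup>2 * real k"
  shows "\<bar>\<integral>x. (\<zeta> n x * local_sum N (2 * k) n x - \<gamma>) * A (total N x - local_sum N (4 * k) n x) \<partial>\<nu>\<bar>
    \<le> 2 * (bM * end_bound k) * a0 + 3 * bM * a1 * (L * T) + 4 * bM * a0 * w k"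
proof -
  define a where "a = n - 2 * k"
  define m where "m = n + 3 * k"
  define W where "W = window N (2 * k) n"
  define M' where "M' y = centered n (intermittent_iter (shift a \<alpha>) (n - a) y)
      * (\<Sum>i\<in>W. centered i (intermittent_iter (shift a \<alpha>) (i - a) y)) - \<gamma>" for y
  define R' where "R' y = (\<Sum>i\<in>{n + 4 * k + 1..<N}. centered i (intermittent_iter (shift (m + k) \<alpha>) (i - (m + k)) y))" for y
  have R'm: "R' \<in> borel_measurable borel" unfolding R'_def by measurable
  have R': "(\<Sum>i\<in>{n + 4 * k + 1..<N}. \<zeta> i x) = R' (intermittent_iter \<alpha> (m + k) x)" for x
    unfolding R'_def by (rule future_sum) (simp add: m_def)
  have M'm: "M' \<in> borel_measurable borel" unfolding M'_def by measurable
  have aW: "a \<le> i" if "i \<in> W" for i using that by (auto simp: W_def window_def a_def)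
  have M': "M' (intermittent_iter \<alpha> a x) = \<zeta> n x * local_sum N (2 * k) n x - \<gamma>" for x
  proof -
    have "(\<Sum>i\<in>W. \<zeta> i x) = (\<Sum>i\<in>W. centered i (intermittent_iter (shift a \<alpha>) (i - a) (intermittent_iter \<alpha> a x)))"
      by (intro sum.cong refl \<zeta>_iter aW)
    moreover have "\<zeta> n x = centered n (intermittent_iter (shift a \<alpha>) (n - a) (intermittent_iter \<alpha> a x))"
      by (rule \<zeta>_iter) (simp add: a_def)
    ultimately show ?thesis by (simp add: M'_def local_sum_def W_def)
  qed
  have cW: "real (card W) \<le> 5 * real k"
    using card_window[of N "2 * k" n] k unfolding W_def by linarith
  have prod_le: "u * v \<le> 5 * L\<^sup>2 * real k" if "u \<le> L" "v \<le> real (card W) * L" "0 \<le> v" for u v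
  proof -
    have "u * v \<le> L * (5 * real k * L)"
    proof (rule mult_mono)
      show "v \<le> 5 * real k * L" using that(2) mult_right_mono[OF cW, of L] L_ge_1 by linarith
    qed (use that L_ge_1 in auto)
    then show ?thesis by (simp add: power2_eq_square mult_ac)
  qed
  have \<gamma>: "\<bar>\<gamma>\<bar> \<le> 5 * L\<^sup>2 * real k"
    unfolding \<gamma>_def
  proof (rule abs_expectation_le)
    show "\<bar>\<zeta> n x * local_sum N (2 * k) n x\<bar> \<le> 5 * L\<^sup>2 * real k" for x
      unfolding abs_mult local_sum_def W_def[symmetric]
      using \<zeta>_bound sum_\<zeta>_bound by (intro prod_le) auto
  qed simp
  have bM: "\<bar>M' y\<bar> \<le> bM" for y
  proof -
    have "\<bar>\<Sum>i\<in>W. centered i (intermittent_iter (shift a \<alpha>) (i - a) y)\<bar>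
        \<le> (\<Sum>i\<in>W. \<bar>centered i (intermittent_iter (shift a \<alpha>) (i - a) y)\<bar>)" by (rule sum_abs)
    also have "\<dots> \<le> real (card W) * L" using centered_bound by (rule sum_bounded_above)
    finally have "\<bar>centered n (intermittent_iter (shift a \<alpha>) (n - a) y)
      * (\<Sum>i\<in>W. centered i (intermittent_iter (shift a \<alpha>) (i - a) y))\<bar> \<le> 5 * L\<^sup>2 * real k"
      unfolding abs_mult using centered_bound by (intro prod_le) auto
    then show ?thesis using \<gamma> unfolding M'_def bM_def by linarith
  qed
  have eM: "\<bar>M' (intermittent_iter \<alpha> a x) - M' (intermittent_iter \<alpha> a (proj m \<alpha> x))\<bar> \<le> bM * end_bound k"
    if x: "0 < x" "x < 1" for x
  proof -
    let ?x = "proj m \<alpha> x"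
    have d: "\<bar>\<zeta> i x - \<zeta> i ?x\<bar> \<le> L * end_bound k" if "i \<le> n + 2 * k" for i
    proof -
      have "\<bar>\<zeta> i x - \<zeta> i ?x\<bar> \<le> L * end_bound (m - i)" using that x by (intro \<zeta>_proj) (auto simp: m_def)
      also have "\<dots> \<le> L * end_bound k"
        using that L_ge_1 by (intro mult_left_mono end_bound_mono) (auto simp: m_def)
      finally show ?thesis .
    qed
    have dS: "\<bar>(\<Sum>i\<in>W. \<zeta> i x) - (\<Sum>i\<in>W. \<zeta> i ?x)\<bar> \<le> real (card W) * (L * end_bound k)"
    proof -
      have "\<bar>(\<Sum>i\<in>W. \<zeta> i x) - (\<Sum>i\<in>W. \<zeta> i ?x)\<bar> \<le> (\<Sum>i\<in>W. \<bar>\<zeta> i x - \<zeta> i ?x\<bar>)"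
        by (simp add: sum_subtractf[symmetric] sum_abs)
      also have "\<dots> \<le> real (card W) * (L * end_bound k)"
        by (rule sum_bounded_above) (auto intro!: d simp: W_def window_def)
      finally show ?thesis .
    qed
    have "M' (intermittent_iter \<alpha> a x) - M' (intermittent_iter \<alpha> a ?x)
      = \<zeta> n x * ((\<Sum>i\<in>W. \<zeta> i x) - (\<Sum>i\<in>W. \<zeta> i ?x)) + (\<zeta> n x - \<zeta> n ?x) * (\<Sum>i\<in>W. \<zeta> i ?x)"
      unfolding M' local_sum_def W_def[symmetric] by (simp add: algebra_simps)
    also have "\<bar>\<dots>\<bar> \<le> L * (real (card W) * (L * end_bound k)) + (L * end_bound k) * (real (card W) * L)"
    proof (rule order_trans[OF abs_triangle_ineq add_mono])
      show "\<bar>\<zeta> n x * ((\<Sum>i\<in>W. \<zeta> i x) - (\<Sum>i\<in>W. \<zeta> i ?x))\<bar> \<le> L * (real (card W) * (L * end_bound k))"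
        unfolding abs_mult using \<zeta>_bound dS L_ge_1 by (intro mult_mono) auto
      show "\<bar>(\<zeta> n x - \<zeta> n ?x) * (\<Sum>i\<in>W. \<zeta> i ?x)\<bar> \<le> (L * end_bound k) * (real (card W) * L)"
        unfolding abs_mult using d[of n] sum_\<zeta>_bound[where J = W and x = ?x] L_ge_1 end_bound_nonneg
        by (intro mult_mono) auto
    qed
    also have "\<dots> = real (card W) * (2 * L\<^sup>2 * end_bound k)" by (simp add: power2_eq_square algebra_simps)
    also have "\<dots> \<le> 5 * real k * (2 * L\<^sup>2 * end_bound k)"
      using cW end_bound_nonneg by (intro mult_right_mono) auto
    finally show ?thesis by (simp add: bM_def mult_ac)
  qed
  have mean: "(\<integral>x. M' (intermittent_iter \<alpha> a x) \<partial>\<nu>) = 0"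
  proof -
    have "integrable \<nu> (\<lambda>x. \<zeta> n x * local_sum N (2 * k) n x)"
      using \<zeta>_bound local_sum_bound by (intro integrable_mult_bounded) auto
    then show ?thesis unfolding M' using \<nu>.prob_space by (simp add: \<gamma>_def)
  qed
  have LT: "L * (\<Sum>i<n - 4 * k. end_bound (n - 4 * k + k - i)) \<le> L * T"
    using T[of "n - 4 * k"] L_ge_1 by (intro mult_left_mono) auto
  have "\<bar>\<integral>x. M' (intermittent_iter \<alpha> a x) * A ((\<Sum>i<n - 4 * k. \<zeta> i x) + R' (intermittent_iter \<alpha> (m + k) x)) \<partial>\<nu>\<bar>
    \<le> 2 * (bM * end_bound k) * a0 + 3 * bM * a1 * (L * T) + 4 * bM * a0 * w k"
    by (rule three_block[OF M'm bM eM mean R'm Am a0 a1 _ _ LT]) (auto simp: a_def m_def)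
  then show ?thesis
    unfolding total_split[OF n] R' M' .
qed

text \<open>If distant blocks were independent, Taylor expansion at \<open>U - S\<close> would give
  \<open>E (\<zeta> n * B U) \<approx> E (\<zeta> n * S) * E (B' U)\<close>, up to quadratic terms.
  The inner window is removed so that \<open>\<zeta> n\<close> decouples from
  \<open>B (U - S)\<close>, the outer one so that \<open>\<zeta> n * S\<close> decouples from
  \<open>B' (U - S')\<close>. The terms of the bound are, in order: covariances outside the inner
  window, the return from \<open>U - S'\<close> to \<open>U\<close>, the two decouplings, and the
  quadratic remainders.\<close>

lemma stein_point:
  assumes n: "n < N" and k: "1 \<le> k"
    and B: "\<And>u. (B has_real_derivative B' u) (at u)" "\<And>u. \<bar>B u\<bar> \<le> 7" "\<And>u. \<bar>B' u\<bar> \<le> b1"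
    and B': "\<And>u v. \<bar>B' u - B' v\<bar> \<le> b2 * \<bar>u - v\<bar>"
    and T: "\<And>p. (\<Sum>i<p. end_bound (p + k - i)) \<le> T"
    and c0: "\<And>i. (\<Sum>j<N. cov_bound (nat \<bar>int i - int j\<bar>)) \<le> c0"
    and tb: "(\<Sum>j\<in>{..<N} - window N (2 * k) n. cov_bound (nat \<bar>int n - int j\<bar>)) \<le> tb"
  shows "\<bar>(\<integral>x. \<zeta> n x * total N x \<partial>\<nu>) * (\<integral>x. B' (total N x) \<partial>\<nu>) - (\<integral>x. \<zeta> n x * B (total N x) \<partial>\<nu>)\<bar>
    \<le> tb * b1 + c0 * b2 * (1 + 9 * real k * c0)
      + (14 * L * end_bound k + 3 * L\<^sup>2 * b1 * T + 28 * L * w k)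
      + 10 * L\<^sup>2 * real k * (2 * end_bound k * b1 + 3 * b2 * L * T + 4 * b1 * w k)
      + 24 * L * b2 * real k * c0"
proof -
  define U where "U = total N"
  define S where "S = local_sum N (2 * k) n"
  define S' where "S' = local_sum N (4 * k) n"
  define \<gamma> where "\<gamma> = (\<integral>x. \<zeta> n x * S x \<partial>\<nu>)"
  have b1: "0 \<le> b1" using B(3)[of 0] abs_ge_zero[of "B' 0"] by linarith
  have b2: "0 \<le> b2" using B'[of 1 0] abs_ge_zero[of "B' 1 - B' 0"] by simp
  have [measurable]: "U \<in> borel_measurable borel" "S \<in> borel_measurable borel" "S' \<in> borel_measurable borel"
    unfolding U_def S_def S'_def by measurable
  have Bc: "B \<in> borel_measurable borel"
    using B(1) by (intro borel_measurable_continuous_onI DERIV_continuous_on) (auto intro: has_field_derivative_at_within)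
  have B'c: "B' \<in> borel_measurable borel"
  proof -
    have "b2-lipschitz_on UNIV B'" using B' b2 by (intro lipschitz_onI) (auto simp: dist_real_def)
    then show ?thesis by (intro borel_measurable_continuous_onI lipschitz_on_continuous_on)
  qed
  note [measurable] = Bc B'c
  have B_lip: "\<bar>B u - B v\<bar> \<le> b1 * \<bar>u - v\<bar>" for u v
    using field_differentiable_bound[of UNIV B B' b1 u v] B(1,3) by (simp add: has_field_derivative_at_within)
  \<comment> \<open>\<open>B'\<close> is only Lipschitz, so the second-order remainder comes from
    the mean value inequality for \<open>B v - v * B' u\<close> on the ball of radius
    \<open>\<bar>h\<bar>\<close> around \<open>u\<close>.\<close>
  have taylor: "\<bar>B (u + h) - B u - h * B' u\<bar> \<le> b2 * h\<^sup>2" for u h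
  proof -
    have "\<bar>(B (u + h) - (u + h) * B' u) - (B u - u * B' u)\<bar> \<le> (b2 * \<bar>h\<bar>) * \<bar>(u + h) - u\<bar>"
    proof -
      let ?S = "cball u \<bar>h\<bar>"
      have "norm ((B (u + h) - (u + h) * B' u) - (B u - u * B' u)) \<le> (b2 * \<bar>h\<bar>) * norm ((u + h) - u)"
      proof (rule field_differentiable_bound[where S = ?S])
        show "((\<lambda>v. B v - v * B' u) has_field_derivative (B' v - B' u)) (at v within ?S)" for v
          by (rule has_field_derivative_at_within) (auto intro!: derivative_eq_intros B(1))
        show "norm (B' v - B' u) \<le> b2 * \<bar>h\<bar>" if "v \<in> ?S" for v
        proof -
          have "\<bar>B' v - B' u\<bar> \<le> b2 * \<bar>v - u\<bar>" by (rule B')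
          also have "\<dots> \<le> b2 * \<bar>h\<bar>"
            using that b2 by (intro mult_left_mono) (auto simp: dist_real_def abs_minus_commute)
          finally show ?thesis by simp
        qed
      qed (auto simp: dist_real_def)
      then show ?thesis by simp
    qed
    then show ?thesis by (simp add: power2_eq_square algebra_simps)
  qed
  have Ub: "\<bar>U x\<bar> \<le> real N * L" for x unfolding U_def by (rule total_bound)
  have Sb: "\<bar>S x\<bar> \<le> real (2 * (2 * k) + 1) * L" for x unfolding S_def by (rule local_sum_bound)
  have S'b: "\<bar>S' x\<bar> \<le> real (2 * (4 * k) + 1) * L" for x unfolding S'_def by (rule local_sum_bound)
  have c0': "(\<Sum>j\<in>J. cov_bound (nat \<bar>int i - int j\<bar>)) \<le> c0" if "J \<subseteq> {..<N}" for J i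
    using sum_mono2[OF _ that, of "\<lambda>j. cov_bound (nat \<bar>int i - int j\<bar>)"] cov_bound_nonneg c0[of i] by fastforce
  have c0_nn: "0 \<le> c0" using c0'[of "{}"] by simp
  have win: "window N r n \<subseteq> {..<N}" for r by (auto simp: window_def)
  have ES_gen: "(\<integral>x. (local_sum N r n x)\<^sup>2 \<partial>\<nu>) \<le> real (2 * r + 1) * c0" for r
  proof -
    have "(\<integral>x. (local_sum N r n x)\<^sup>2 \<partial>\<nu>) \<le> real (card (window N r n)) * c0"
      unfolding local_sum_def using c0'[OF win] by (intro integral_sum_square_le) auto
    also have "\<dots> \<le> real (2 * r + 1) * c0"
      using card_window[of N r n] c0_nn by (intro mult_right_mono) (simp_all del: of_nat_add of_nat_mult)
    finally show ?thesis .
  qed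
  have ES: "(\<integral>x. (S x)\<^sup>2 \<partial>\<nu>) \<le> 5 * real k * c0"
  proof -
    have "real (2 * (2 * k) + 1) * c0 \<le> 5 * real k * c0" using k c0_nn by (intro mult_right_mono) auto
    then show ?thesis using ES_gen[of "2 * k"] unfolding S_def by linarith
  qed
  have ES': "(\<integral>x. (S' x)\<^sup>2 \<partial>\<nu>) \<le> 9 * real k * c0"
  proof -
    have "real (2 * (4 * k) + 1) * c0 \<le> 9 * real k * c0" using k c0_nn by (intro mult_right_mono) auto
    then show ?thesis using ES_gen[of "4 * k"] unfolding S'_def by linarith
  qed
  have iS: "integrable \<nu> (\<lambda>x. (S x)\<^sup>2)" "integrable \<nu> (\<lambda>x. (S' x)\<^sup>2)"
    unfolding power2_eq_square using Sb S'b by (auto intro!: integrable_mult_bounded)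
  have iZU: "integrable \<nu> (\<lambda>x. \<zeta> n x * U x)" "integrable \<nu> (\<lambda>x. \<zeta> n x * S x)"
    using \<zeta>_bound Ub Sb by (auto intro!: integrable_mult_bounded)
  have iB'U: "integrable \<nu> (\<lambda>x. B' (U x))" "integrable \<nu> (\<lambda>x. B' (U x - S' x))"
    using B(3) by (auto intro!: integrable_\<nu>_bounded)
  have iBU: "integrable \<nu> (\<lambda>x. \<zeta> n x * B (U x))" "integrable \<nu> (\<lambda>x. \<zeta> n x * B (U x - S x))"
    using \<zeta>_bound B(2) by (auto intro!: integrable_mult_bounded)
  \<comment> \<open>Three corrections: \<open>t3\<close> is the Taylor remainder at
    \<open>U - S\<close>, \<open>t4\<close> replaces the inner by the outer window in the argument
    of \<open>B'\<close>, and \<open>t2\<close> is the fluctuation of \<open>\<zeta> n * S\<close>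
    around its mean.\<close>
  define t2 where "t2 x = (\<zeta> n x * S x - \<gamma>) * B' (U x - S' x)" for x
  define t3 where "t3 x = \<zeta> n x * (B (U x) - B (U x - S x) - S x * B' (U x - S x))" for x
  define t4 where "t4 x = \<zeta> n x * S x * (B' (U x - S x) - B' (U x - S' x))" for x
  have ZSb: "\<bar>\<zeta> n x * S x\<bar> \<le> L * (real (2 * (2 * k) + 1) * L)" for x
    unfolding abs_mult using \<zeta>_bound Sb L_ge_1 by (intro mult_mono) auto
  have it2: "integrable \<nu> t2"
    unfolding t2_def
  proof (rule integrable_mult_bounded)
    show "\<bar>\<zeta> n x * S x - \<gamma>\<bar> \<le> L * (real (2 * (2 * k) + 1) * L) + \<bar>\<gamma>\<bar>" for x
      using ZSb[of x] by linarith
  qed (use B(3) in auto)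
  have it4: "integrable \<nu> t4"
    unfolding t4_def
  proof (rule integrable_mult_bounded[OF _ _ ZSb])
    show "\<bar>B' (U x - S x) - B' (U x - S' x)\<bar> \<le> b1 + b1" for x
      using B(3)[of "U x - S x"] B(3)[of "U x - S' x"] by linarith
  qed auto
  have t3_le: "\<bar>t3 x\<bar> \<le> L * b2 * (S x)\<^sup>2" for x
  proof -
    have "\<bar>B (U x) - B (U x - S x) - S x * B' (U x - S x)\<bar> \<le> b2 * (S x)\<^sup>2"
      using taylor[of "U x - S x" "S x"] by simp
    then have "\<bar>t3 x\<bar> \<le> L * (b2 * (S x)\<^sup>2)"
      unfolding t3_def abs_mult using \<zeta>_bound L_ge_1 by (intro mult_mono) auto
    then show ?thesis by simp
  qed
  have t4_le: "\<bar>t4 x\<bar> \<le> L * b2 * (2 * (S x)\<^sup>2 + (S' x)\<^sup>2)" for x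
  proof -
    have "\<bar>B' (U x - S x) - B' (U x - S' x)\<bar> \<le> b2 * \<bar>S' x - S x\<bar>"
      using B'[of "U x - S x" "U x - S' x"] by (simp add: abs_minus_commute)
    then have "\<bar>t4 x\<bar> \<le> L * \<bar>S x\<bar> * (b2 * \<bar>S' x - S x\<bar>)"
      unfolding t4_def abs_mult using \<zeta>_bound L_ge_1 by (intro mult_mono) auto
    also have "\<dots> = L * b2 * (\<bar>S x\<bar> * \<bar>S' x - S x\<bar>)" by simp
    also have "\<bar>S x\<bar> * \<bar>S' x - S x\<bar> \<le> 2 * (S x)\<^sup>2 + (S' x)\<^sup>2"
    proof -
      have "\<bar>S x\<bar> * \<bar>S' x - S x\<bar> \<le> \<bar>S x\<bar> * (\<bar>S' x\<bar> + \<bar>S x\<bar>)" by (intro mult_left_mono) auto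
      moreover have "2 * (\<bar>S' x\<bar> * \<bar>S x\<bar>) \<le> (S x)\<^sup>2 + (S' x)\<^sup>2"
        using zero_le_power2[of "\<bar>S x\<bar> - \<bar>S' x\<bar>"] by (simp add: power2_eq_square algebra_simps)
      moreover have "\<bar>S x\<bar> * (\<bar>S' x\<bar> + \<bar>S x\<bar>) = \<bar>S' x\<bar> * \<bar>S x\<bar> + (S x)\<^sup>2"
        by (simp add: power2_eq_square algebra_simps)
      moreover have "0 \<le> (S x)\<^sup>2" "0 \<le> (S' x)\<^sup>2" by auto
      ultimately show ?thesis by linarith
    qed
    finally show ?thesis using L_ge_1 b2 by (simp add: mult_left_mono)
  qed
  have it3: "integrable \<nu> t3"
  proof -
    have "t3 = (\<lambda>x. \<zeta> n x * B (U x) - \<zeta> n x * B (U x - S x) - \<zeta> n x * S x * B' (U x - S x))"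
      by (simp add: t3_def fun_eq_iff algebra_simps)
    moreover have "integrable \<nu> (\<lambda>x. \<zeta> n x * S x * B' (U x - S x))"
      using ZSb B(3) by (intro integrable_mult_bounded) auto
    ultimately show ?thesis using iBU by simp
  qed
  have decomp: "\<zeta> n x * B (U x) = \<zeta> n x * B (U x - S x) + t3 x + t4 x + t2 x + \<gamma> * B' (U x - S' x)" for x
    by (simp add: t2_def t3_def t4_def algebra_simps)
  have I: "(\<integral>x. \<zeta> n x * B (U x) \<partial>\<nu>) = (\<integral>x. \<zeta> n x * B (U x - S x) \<partial>\<nu>) + integral\<^sup>L \<nu> t3 + integral\<^sup>L \<nu> t4
      + integral\<^sup>L \<nu> t2 + \<gamma> * (\<integral>x. B' (U x - S' x) \<partial>\<nu>)"
    unfolding decomp using iBU(2) it2 it3 it4 iB'U(2) by simp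
  have "\<zeta> n x * U x = \<zeta> n x * S x + (\<Sum>j\<in>{..<N} - window N (2 * k) n. \<zeta> n x * \<zeta> j x)" for x
  proof -
    have "U x = S x + (\<Sum>j\<in>{..<N} - window N (2 * k) n. \<zeta> j x)"
      unfolding U_def S_def total_def local_sum_def
      using sum.subset_diff[OF win, of "\<lambda>j. \<zeta> j x" "2 * k"] by simp
    then show ?thesis by (simp add: ring_distribs sum_distrib_left)
  qed
  then have "(\<integral>x. \<zeta> n x * U x \<partial>\<nu>) = \<gamma> + (\<integral>x. (\<Sum>j\<in>{..<N} - window N (2 * k) n. \<zeta> n x * \<zeta> j x) \<partial>\<nu>)"
    unfolding \<gamma>_def using iZU(2) \<zeta>_bound
    by (subst Bochner_Integration.integral_add[symmetric]) (auto intro!: integrable_mult_bounded Bochner_Integration.integrable_sum)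
  also have "(\<integral>x. (\<Sum>j\<in>{..<N} - window N (2 * k) n. \<zeta> n x * \<zeta> j x) \<partial>\<nu>)
      = (\<Sum>j\<in>{..<N} - window N (2 * k) n. \<integral>x. \<zeta> n x * \<zeta> j x \<partial>\<nu>)"
    using \<zeta>_bound by (intro Bochner_Integration.integral_sum integrable_mult_bounded) auto
  finally have IU: "(\<integral>x. \<zeta> n x * U x \<partial>\<nu>) = \<gamma> + (\<Sum>j\<in>{..<N} - window N (2 * k) n. \<integral>x. \<zeta> n x * \<zeta> j x \<partial>\<nu>)" .
  define \<tau> where "\<tau> = (\<Sum>j\<in>{..<N} - window N (2 * k) n. \<integral>x. \<zeta> n x * \<zeta> j x \<partial>\<nu>)"
  have \<tau>: "\<bar>\<tau>\<bar> \<le> tb"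
    unfolding \<tau>_def using order_trans[OF sum_abs sum_mono[OF covariance]] tb by (rule order_trans)
  have EB': "\<bar>\<integral>x. B' (U x) \<partial>\<nu>\<bar> \<le> b1" using B(3) b1 by (intro abs_expectation_le) auto
  have \<gamma>: "\<bar>\<gamma>\<bar> \<le> c0"
  proof -
    have "\<gamma> = (\<Sum>j\<in>window N (2 * k) n. \<integral>x. \<zeta> n x * \<zeta> j x \<partial>\<nu>)"
      unfolding \<gamma>_def S_def local_sum_def sum_distrib_left
      using \<zeta>_bound by (intro Bochner_Integration.integral_sum integrable_mult_bounded) auto
    also have "\<bar>\<dots>\<bar> \<le> c0"
      by (rule order_trans[OF order_trans[OF sum_abs sum_mono[OF covariance]] c0'[OF win]])
    finally show ?thesis .
  qed
  have p1: "\<bar>\<tau> * (\<integral>x. B' (U x) \<partial>\<nu>)\<bar> \<le> tb * b1"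
    unfolding abs_mult using \<tau> EB' by (intro mult_mono) auto
  have p2: "\<bar>\<gamma> * ((\<integral>x. B' (U x) \<partial>\<nu>) - (\<integral>x. B' (U x - S' x) \<partial>\<nu>))\<bar> \<le> c0 * b2 * (1 + 9 * real k * c0)"
  proof -
    have "\<bar>(\<integral>x. B' (U x) \<partial>\<nu>) - (\<integral>x. B' (U x - S' x) \<partial>\<nu>)\<bar> = \<bar>\<integral>x. B' (U x) - B' (U x - S' x) \<partial>\<nu>\<bar>"
      using iB'U by simp
    also have "\<dots> \<le> (\<integral>x. \<bar>B' (U x) - B' (U x - S' x)\<bar> \<partial>\<nu>)" by (rule integral_abs_bound)
    also have "\<dots> \<le> (\<integral>x. b2 * (1 + (S' x)\<^sup>2) \<partial>\<nu>)"
    proof (rule integral_mono)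
      show "integrable \<nu> (\<lambda>x. \<bar>B' (U x) - B' (U x - S' x)\<bar>)" using iB'U by simp
      show "integrable \<nu> (\<lambda>x. b2 * (1 + (S' x)\<^sup>2))" using iS by simp
      fix x
      have "\<bar>B' (U x) - B' (U x - S' x)\<bar> \<le> b2 * \<bar>S' x\<bar>" using B'[of "U x" "U x - S' x"] by simp
      \<comment> \<open>Bounding the first moment through the second is crude, but it has the order
        \<open>k\<close> of the quadratic remainders and therefore costs only a constant.\<close>
      also have "\<bar>S' x\<bar> \<le> 1 + (S' x)\<^sup>2"
        using zero_le_power2[of "\<bar>S' x\<bar> - 1"] zero_le_power2[of "S' x"] abs_ge_zero[of "S' x"]
        by (simp add: power2_eq_square algebra_simps)
      finally show "\<bar>B' (U x) - B' (U x - S' x)\<bar> \<le> b2 * (1 + (S' x)\<^sup>2)" using b2 by (simp add: mult_left_mono)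
    qed
    also have "\<dots> = b2 * (1 + (\<integral>x. (S' x)\<^sup>2 \<partial>\<nu>))" using iS \<nu>.prob_space by simp
    also have "\<dots> \<le> b2 * (1 + 9 * real k * c0)" using ES' b2 by (intro mult_left_mono) auto
    finally have "\<bar>\<gamma>\<bar> * \<bar>(\<integral>x. B' (U x) \<partial>\<nu>) - (\<integral>x. B' (U x - S' x) \<partial>\<nu>)\<bar> \<le> c0 * (b2 * (1 + 9 * real k * c0))"
      using \<gamma> c0_nn by (intro mult_mono) auto
    then show ?thesis by (simp add: abs_mult mult.assoc)
  qed
  have p3: "\<bar>\<integral>x. \<zeta> n x * B (U x - S x) \<partial>\<nu>\<bar> \<le> 14 * L * end_bound k + 3 * L\<^sup>2 * b1 * T + 28 * L * w k"
    using decoupled_point[OF n Bc B(2) B_lip T] unfolding U_def S_def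
    by (simp add: power2_eq_square mult_ac)
  have p4: "\<bar>integral\<^sup>L \<nu> t2\<bar> \<le> 10 * L\<^sup>2 * real k * (2 * end_bound k * b1 + 3 * b2 * L * T + 4 * b1 * w k)"
    using decoupled_pair[OF n B'c B(3) B' T k] unfolding U_def S_def S'_def t2_def \<gamma>_def
    by (simp add: algebra_simps)
  have p5: "\<bar>integral\<^sup>L \<nu> t3\<bar> + \<bar>integral\<^sup>L \<nu> t4\<bar> \<le> 24 * L * b2 * real k * c0"
  proof -
    have "\<bar>integral\<^sup>L \<nu> t3\<bar> \<le> (\<integral>x. \<bar>t3 x\<bar> \<partial>\<nu>)" by (rule integral_abs_bound)
    also have "\<dots> \<le> (\<integral>x. L * b2 * (S x)\<^sup>2 \<partial>\<nu>)" using it3 iS t3_le by (intro integral_mono) auto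
    finally have 3: "\<bar>integral\<^sup>L \<nu> t3\<bar> \<le> L * b2 * (\<integral>x. (S x)\<^sup>2 \<partial>\<nu>)" by simp
    have "\<bar>integral\<^sup>L \<nu> t4\<bar> \<le> (\<integral>x. \<bar>t4 x\<bar> \<partial>\<nu>)" by (rule integral_abs_bound)
    also have "\<dots> \<le> (\<integral>x. L * b2 * (2 * (S x)\<^sup>2 + (S' x)\<^sup>2) \<partial>\<nu>)" using it4 iS t4_le by (intro integral_mono) auto
    also have "\<dots> = L * b2 * (2 * (\<integral>x. (S x)\<^sup>2 \<partial>\<nu>) + (\<integral>x. (S' x)\<^sup>2 \<partial>\<nu>))" using iS by simp
    finally have "\<bar>integral\<^sup>L \<nu> t3\<bar> + \<bar>integral\<^sup>L \<nu> t4\<bar> \<le> L * b2 * (3 * (\<integral>x. (S x)\<^sup>2 \<partial>\<nu>) + (\<integral>x. (S' x)\<^sup>2 \<partial>\<nu>))"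
      using 3 by (simp add: algebra_simps)
    also have "\<dots> \<le> L * b2 * (24 * real k * c0)" using ES ES' L_ge_1 b2 by (intro mult_left_mono) auto
    finally show ?thesis by (simp add: mult.assoc)
  qed
  have "(\<integral>x. \<zeta> n x * U x \<partial>\<nu>) * (\<integral>x. B' (U x) \<partial>\<nu>) - (\<integral>x. \<zeta> n x * B (U x) \<partial>\<nu>)
    = \<tau> * (\<integral>x. B' (U x) \<partial>\<nu>) + \<gamma> * ((\<integral>x. B' (U x) \<partial>\<nu>) - (\<integral>x. B' (U x - S' x) \<partial>\<nu>))
      - (\<integral>x. \<zeta> n x * B (U x - S x) \<partial>\<nu>) - integral\<^sup>L \<nu> t2 - integral\<^sup>L \<nu> t3 - integral\<^sup>L \<nu> t4"
    unfolding I IU \<tau>_def[symmetric] by (simp add: algebra_simps)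
  then show ?thesis
    using p1 p2 p3 p4 p5 unfolding U_def by linarith
qed

end

section \<open>Rates and the normal approximation\<close>

text \<open>Telescoping: \<open>2 / (1 + x) - 2 / (2 + x) = 2 / ((1 + x) * (2 + x))\<close>
  dominates the summand.\<close>

lemma sum_inverse_square_le:
  "(\<Sum>l<n. 1 / (1 + real (r + l))\<^sup>2) \<le> 2 / (1 + real r)"
proof -
  have "(\<Sum>l<n. 1 / (1 + real (r + l))\<^sup>2) \<le> 2 / (1 + real r) - 2 / (1 + real (r + n))"
  proof (induction n)
    case (Suc n)
    define x where "x = real (r + n)"
    have x: "0 \<le> x" by (simp add: x_def)
    have "2 / (1 + x) - 2 / (2 + x) = 2 / ((1 + x) * (2 + x))"
      using x by (simp add: diff_frac_eq)
    moreover have "1 / (1 + x)\<^sup>2 \<le> 2 / ((1 + x) * (2 + x))"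
    proof -
      have "(1 + x) * (2 + x) \<le> 2 * (1 + x)\<^sup>2" using x by (simp add: power2_eq_square algebra_simps)
      then show ?thesis using x by (simp add: divide_le_eq pos_le_divide_eq)
    qed
    ultimately have "1 / (1 + x)\<^sup>2 \<le> 2 / (1 + x) - 2 / (2 + x)" by simp
    then show ?case using Suc by (simp add: x_def add.commute)
  qed simp
  also have "\<dots> \<le> 2 / (1 + real r)" by simp
  finally show ?thesis .
qed

lemma sum_inverse_square_finite_le:
  assumes "finite D" "\<And>d. d \<in> D \<Longrightarrow> r \<le> d"
  shows "(\<Sum>d\<in>D. 1 / (1 + real d)\<^sup>2) \<le> 2 / (1 + real r)"
proof -
  define b where "b = Max D"
  have b: "d \<le> b" if "d \<in> D" for d unfolding b_def using assms(1) that by (rule Max_ge)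
  have "(\<Sum>d\<in>D. 1 / (1 + real d)\<^sup>2) \<le> (\<Sum>d\<in>(\<lambda>l. r + l) ` {..<Suc b}. 1 / (1 + real d)\<^sup>2)"
  proof (rule sum_mono2)
    show "D \<subseteq> (\<lambda>l. r + l) ` {..<Suc b}"
    proof
      fix d assume "d \<in> D"
      then have "d = r + (d - r)" "d - r < Suc b" using assms(2)[of d] b[of d] by auto
      then show "d \<in> (\<lambda>l. r + l) ` {..<Suc b}" by blast
    qed
  qed auto
  also have "\<dots> = (\<Sum>l<Suc b. 1 / (1 + real (r + l))\<^sup>2)" by (subst sum.reindex) (auto simp: comp_def)
  also have "\<dots> \<le> 2 / (1 + real r)" by (rule sum_inverse_square_le)
  finally show ?thesis .
qed

text \<open>Every distance from \<open>i\<close> occurs at most twice, once on each side.\<close>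

lemma sum_inverse_square_dist_le:
  fixes i :: nat
  assumes J: "finite J" and r: "\<And>j. j \<in> J \<Longrightarrow> r \<le> nat \<bar>int i - int j\<bar>"
  shows "(\<Sum>j\<in>J. 1 / (1 + real (nat \<bar>int i - int j\<bar>))\<^sup>2) \<le> 4 / (1 + real r)"
proof -
  let ?d = "\<lambda>j. nat \<bar>int i - int j\<bar>" and ?g = "\<lambda>d. 1 / (1 + real d)\<^sup>2"
  have part: "(\<Sum>j\<in>K. ?g (?d j)) \<le> 2 / (1 + real r)" if K: "K \<subseteq> J" "inj_on ?d K" for K
  proof -
    have "(\<Sum>j\<in>K. ?g (?d j)) = (\<Sum>d\<in>?d ` K. ?g d)" using K(2) by (subst sum.reindex) (auto simp: comp_def)
    also have "\<dots> \<le> 2 / (1 + real r)"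
      using K(1) r J by (intro sum_inverse_square_finite_le) (auto intro: finite_subset)
    finally show ?thesis .
  qed
  have "(\<Sum>j\<in>J. ?g (?d j)) = (\<Sum>j\<in>{j\<in>J. j \<le> i} \<union> {j\<in>J. i < j}. ?g (?d j))"
    by (intro sum.cong) auto
  also have "\<dots> = (\<Sum>j\<in>{j\<in>J. j \<le> i}. ?g (?d j)) + (\<Sum>j\<in>{j\<in>J. i < j}. ?g (?d j))"
    using J by (intro sum.union_disjoint) auto
  also have "\<dots> \<le> 2 / (1 + real r) + 2 / (1 + real r)"
    by (intro add_mono part) (auto simp: inj_on_def)
  finally show ?thesis by simp
qed

context subcritical
begin

text \<open>\<open>loss_rate\<close> with its logarithms collected, since (ln n)^(1/\<beta> - 1) *
  (ln n)^2 = (ln n)^(1/\<beta> + 1), and shifted by one so that it is positive for every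
  index.\<close>

definition rate :: "nat \<Rightarrow> real" where
  "rate j = (1 + real j) powr (1 - 1 / \<beta>) * (1 + ln (1 + real j)) powr (1 / \<beta> + 1)"

lemma inverse_\<beta>: "3 < 1 / \<beta>"
  using \<beta>_pos \<beta>_less by (simp add: field_simps)

lemma rate_nonneg: "0 \<le> rate j"
  by (simp add: rate_def)

lemma memory_loss_uniform:
  obtains C where "1 \<le> C" "\<And>\<alpha> j. admissible \<beta> \<alpha> \<Longrightarrow> loss_bound \<alpha> j (C * rate j)"
proof -
  obtain C0 where C0: "0 < C0" "\<And>\<alpha> n. admissible \<beta> \<alpha> \<Longrightarrow> 2 \<le> n \<Longrightarrow> loss_bound \<alpha> n (C0 * loss_rate n)"
    by (rule memory_loss) blast
  define a where "a = 1 / \<beta>"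
  define C where "C = max 1 (max (C0 * 2 powr (a - 1)) (3 / (1 - \<beta>) * 2 powr (a - 1)))"
  have a: "3 < a" using inverse_\<beta> by (simp add: a_def)
  show thesis
  proof (rule that[of C])
    show "1 \<le> C" by (simp add: C_def)
    fix \<alpha> and j :: nat assume adm: "admissible \<beta> \<alpha>"
    show "loss_bound \<alpha> j (C * rate j)"
    proof (cases "2 \<le> j")
      case True
      have ln: "0 < ln (real j)" using True by simp
      have "loss_rate j = real j powr (1 - a) * (ln (real j) powr (a - 1) * ln (real j) powr 2)"
      proof -
        have "ln (real j) powr (1 - a) = inverse (ln (real j) powr (a - 1))"
          using powr_minus[of "ln (real j)" "a - 1"] by simp
        moreover have "loss_rate j = real j powr (1 - a) / ln (real j) powr (1 - a) * (ln (real j))\<^sup>2"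
          unfolding loss_rate_def a_def powr_divide ..
        ultimately show ?thesis using ln by (simp add: divide_inverse)
      qed
      also have "ln (real j) powr (a - 1) * ln (real j) powr 2 = ln (real j) powr (a + 1)"
        by (simp add: powr_add[symmetric] add.commute)
      also have "real j powr (1 - a) * ln (real j) powr (a + 1)
          \<le> (2 powr (a - 1) * (1 + real j) powr (1 - a)) * (1 + ln (1 + real j)) powr (a + 1)"
      proof (rule mult_mono)
        have "real j powr (1 - a) \<le> ((1 + real j) / 2) powr (1 - a)"
          using True a by (intro powr_mono2') auto
        also have "\<dots> = 2 powr (a - 1) * (1 + real j) powr (1 - a)"
          unfolding powr_divide using powr_minus_divide[of 2 "a - 1"] by simp
        finally show "real j powr (1 - a) \<le> 2 powr (a - 1) * (1 + real j) powr (1 - a)" .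
        have "ln (real j) \<le> ln (1 + real j)" using True by simp
        then show "ln (real j) powr (a + 1) \<le> (1 + ln (1 + real j)) powr (a + 1)"
          using ln a by (intro powr_mono2) auto
      qed auto
      also have "\<dots> = 2 powr (a - 1) * rate j" by (simp add: rate_def a_def)
      finally have "C0 * loss_rate j \<le> (C0 * 2 powr (a - 1)) * rate j"
        using C0(1) by (simp add: mult.assoc mult_left_mono)
      also have "\<dots> \<le> C * rate j" by (intro mult_right_mono rate_nonneg) (simp add: C_def)
      finally show ?thesis by (rule loss_bound_mono[OF C0(2)[OF adm True]])
    next
      case False
      have "1 \<le> 2 powr (a - 1) * rate j"
      proof -
        have "1 = 2 powr (a - 1) * 2 powr (1 - a)" by (simp add: powr_add[symmetric])
        also have "\<dots> \<le> 2 powr (a - 1) * rate j"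
        proof (rule mult_left_mono)
          have "2 powr (1 - a) * 1 \<le> (1 + real j) powr (1 - a) * (1 + ln (1 + real j)) powr (a + 1)"
            using False a by (intro mult_mono powr_mono2' ge_one_powr_ge_zero) auto
          then show "2 powr (1 - a) \<le> rate j" by (simp add: rate_def a_def)
        qed simp
        finally show ?thesis .
      qed
      then have "3 / (1 - \<beta>) * 1 \<le> 3 / (1 - \<beta>) * (2 powr (a - 1) * rate j)"
        using \<beta>_less by (intro mult_left_mono) auto
      also have "\<dots> = (3 / (1 - \<beta>) * 2 powr (a - 1)) * rate j" by simp
      also have "\<dots> \<le> C * rate j" by (intro mult_right_mono rate_nonneg) (simp add: C_def)
      finally show ?thesis by (intro loss_bound_mono[OF loss_bound_trivial[OF adm]]) simp
    qed
  qed
qed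

lemma end_bound_le: "end_bound j \<le> (2 / \<beta>) powr (1 / \<beta>) * (1 + real j) powr (- 1 / \<beta>)"
proof -
  have "\<beta> / 2 * (1 + real j) \<le> 1 + \<beta> / 2 * real j" using \<beta>_less by (simp add: algebra_simps)
  then have "end_bound j \<le> (\<beta> / 2 * (1 + real j)) powr (- 1 / \<beta>)"
    unfolding end_bound_def using \<beta>_pos by (intro powr_mono2') auto
  also have "\<dots> = (\<beta> / 2) powr (- 1 / \<beta>) * (1 + real j) powr (- 1 / \<beta>)" by (rule powr_mult)
  also have "(\<beta> / 2) powr (- 1 / \<beta>) = (2 / \<beta>) powr (1 / \<beta>)"
    using \<beta>_pos by (simp add: powr_minus powr_divide)
  finally show ?thesis .
qed

text \<open>Writing \<open>y powr - a = y powr (2 - a) * y powr - 2\<close> and freezing the first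
  factor at its largest value reduces the tail of the series to inverse squares.\<close>

lemma end_bound_sum_le:
  "(\<Sum>i<p. end_bound (p + k - i)) \<le> 2 * (2 / \<beta>) powr (1 / \<beta>) * (1 + real k) powr (1 - 1 / \<beta>)"
proof -
  define a where "a = 1 / \<beta>"
  have a: "3 < a" using inverse_\<beta> by (simp add: a_def)
  let ?c = "(2 / \<beta>) powr a"
  have "(\<Sum>i<p. end_bound (p + k - i)) = (\<Sum>i<p. (\<lambda>l. end_bound (k + 1 + l)) (p - Suc i))"
    by (intro sum.cong) (auto intro!: arg_cong[of _ _ end_bound])
  also have "\<dots> = (\<Sum>l<p. end_bound (k + 1 + l))" by (rule sum.nat_diff_reindex)
  also have "\<dots> \<le> (\<Sum>l<p. ?c * (1 + real k) powr (2 - a) * (1 / (1 + real (k + 1 + l))\<^sup>2))"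
  proof (rule sum_mono)
    fix l
    let ?y = "1 + real (k + 1 + l)"
    have "end_bound (k + 1 + l) \<le> ?c * ?y powr (- a)"
      using end_bound_le[of "k + 1 + l"] by (simp add: a_def)
    also have "?y powr (- a) = ?y powr (2 - a) * ?y powr (- 2)" by (simp add: powr_add[symmetric])
    also have "?y powr (- 2) = 1 / ?y\<^sup>2" by (simp add: powr_minus divide_inverse)
    also have "?c * (?y powr (2 - a) * (1 / ?y\<^sup>2)) \<le> ?c * ((1 + real k) powr (2 - a) * (1 / ?y\<^sup>2))"
      using a by (intro mult_left_mono mult_right_mono powr_mono2') auto
    finally show "end_bound (k + 1 + l) \<le> ?c * (1 + real k) powr (2 - a) * (1 / ?y\<^sup>2)" by (simp add: mult.assoc)
  qed
  also have "\<dots> = ?c * (1 + real k) powr (2 - a) * (\<Sum>l<p. 1 / (1 + real (k + 1 + l))\<^sup>2)"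
    by (simp add: sum_distrib_left)
  also have "\<dots> \<le> ?c * (1 + real k) powr (2 - a) * (2 / (1 + real k))"
  proof (rule mult_left_mono)
    have "(\<Sum>l<p. 1 / (1 + real (k + 1 + l))\<^sup>2) \<le> 2 / (1 + real (k + 1))" by (rule sum_inverse_square_le)
    also have "\<dots> \<le> 2 / (1 + real k)" by (intro divide_left_mono) auto
    finally show "(\<Sum>l<p. 1 / (1 + real (k + 1 + l))\<^sup>2) \<le> 2 / (1 + real k)" .
  qed simp
  also have "\<dots> = 2 * ?c * (1 + real k) powr (1 - a)"
    using powr_diff[of "1 + real k" "2 - a" 1] by simp
  finally show ?thesis by (simp add: a_def)
qed

text \<open>As \<open>a = 1 / \<beta> > 3\<close>, the decay exceeds the inverse square by the power
  \<open>a - 3\<close>, which absorbs the logarithm; \<open>e\<close> is chosen so that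
  \<open>e * (a + 1) = a - 3\<close>.\<close>

lemma rate_le_inverse_square:
  obtains C where "0 < C" "\<And>d. rate d \<le> C * (1 / (1 + real d)\<^sup>2)"
proof -
  define a where "a = 1 / \<beta>"
  define e where "e = (a - 3) / (a + 1)"
  have a: "3 < a" using inverse_\<beta> by (simp add: a_def)
  have e: "0 < e" using a by (simp add: e_def)
  show thesis
  proof (rule that[of "(1 + 1 / e) powr (a + 1)"])
    show "0 < (1 + 1 / e) powr (a + 1)" using e by (simp add: add_nonneg_eq_0_iff)
    fix d :: nat
    define y where "y = 1 + real d"
    have y: "1 \<le> y" by (simp add: y_def)
    have "ln y \<le> y powr e / e" by (rule ln_powr_bound[OF y e])
    moreover have "1 \<le> y powr e" using y e by (intro ge_one_powr_ge_zero) auto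
    ultimately have "1 + ln y \<le> (1 + 1 / e) * y powr e" by (simp add: ring_distribs)
    then have "(1 + ln y) powr (a + 1) \<le> ((1 + 1 / e) * y powr e) powr (a + 1)"
      using y a by (intro powr_mono2) auto
    also have "\<dots> = (1 + 1 / e) powr (a + 1) * y powr (a - 3)"
      using a by (simp add: powr_mult powr_powr e_def)
    finally have "rate d \<le> y powr (1 - a) * ((1 + 1 / e) powr (a + 1) * y powr (a - 3))"
      unfolding rate_def by (simp add: y_def a_def mult_left_mono)
    also have "\<dots> = (1 + 1 / e) powr (a + 1) * y powr (- 2)" by (simp add: powr_add[symmetric])
    also have "y powr (- 2) = 1 / y\<^sup>2" using y by (simp add: powr_minus divide_inverse)
    finally show "rate d \<le> (1 + 1 / e) powr (a + 1) * (1 / (1 + real d)\<^sup>2)" by (simp add: y_def)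
  qed
qed

text \<open>\<open>rate k\<close> with the logarithm taken at the full length \<open>N\<close>, so
  that sums over distances between \<open>k\<close> and \<open>N\<close> become sums of pure
  powers.\<close>

definition tail_rate :: "nat \<Rightarrow> nat \<Rightarrow> real" where
  "tail_rate N k = (1 + real k) powr (1 - 1 / \<beta>) * (1 + ln (real N)) powr (1 / \<beta> + 1)"

lemma tail_rate_nonneg: "0 \<le> tail_rate N k"
  by (simp add: tail_rate_def)

lemma rate_tail_sum:
  assumes J: "finite J" and J': "\<And>j. j \<in> J \<Longrightarrow> k \<le> nat \<bar>int i - int j\<bar> \<and> nat \<bar>int i - int j\<bar> < N"
  shows "(\<Sum>j\<in>J. rate (nat \<bar>int i - int j\<bar>)) \<le> 4 * (1 + real k) * tail_rate N k"
proof -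
  define a where "a = 1 / \<beta>"
  have a: "3 < a" using inverse_\<beta> by (simp add: a_def)
  let ?c = "(1 + real k) powr (3 - a) * (1 + ln (real N)) powr (a + 1)"
  have "(\<Sum>j\<in>J. rate (nat \<bar>int i - int j\<bar>)) \<le> (\<Sum>j\<in>J. ?c * (1 / (1 + real (nat \<bar>int i - int j\<bar>))\<^sup>2))"
  proof (rule sum_mono)
    fix j assume "j \<in> J"
    define d where "d = nat \<bar>int i - int j\<bar>"
    have d: "k \<le> d" "d < N" using J'[OF \<open>j \<in> J\<close>] by (auto simp: d_def)
    let ?y = "1 + real d"
    have "rate d = ?y powr (3 - a) * ?y powr (- 2) * (1 + ln ?y) powr (a + 1)"
      by (simp add: rate_def a_def[symmetric] powr_add[symmetric])
    also have "\<dots> \<le> (1 + real k) powr (3 - a) * ?y powr (- 2) * (1 + ln (real N)) powr (a + 1)"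
    proof (rule mult_mono)
      show "?y powr (3 - a) * ?y powr (- 2) \<le> (1 + real k) powr (3 - a) * ?y powr (- 2)"
        using a d by (intro mult_right_mono powr_mono2') auto
      show "(1 + ln ?y) powr (a + 1) \<le> (1 + ln (real N)) powr (a + 1)"
        using a d by (intro powr_mono2) auto
    qed auto
    also have "?y powr (- 2) = 1 / ?y\<^sup>2" by (simp add: powr_minus divide_inverse)
    finally show "rate (nat \<bar>int i - int j\<bar>) \<le> ?c * (1 / (1 + real (nat \<bar>int i - int j\<bar>))\<^sup>2)"
      by (simp add: d_def mult_ac)
  qed
  also have "\<dots> = ?c * (\<Sum>j\<in>J. 1 / (1 + real (nat \<bar>int i - int j\<bar>))\<^sup>2)" by (simp add: sum_distrib_left)
  also have "\<dots> \<le> ?c * (4 / (1 + real k))"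
    using J J' by (intro mult_left_mono sum_inverse_square_dist_le) auto
  also have "\<dots> = 4 * (1 + real k) * tail_rate N k"
  proof -
    have "(1 + real k) powr (3 - a) = (1 + real k)\<^sup>2 * (1 + real k) powr (1 - a)"
      using powr_add[of "1 + real k" 2 "1 - a"] by simp
    then show ?thesis by (simp add: tail_rate_def a_def power2_eq_square)
  qed
  finally show ?thesis .
qed

end

context observable
begin

text \<open>Halving the gap changes the powers only by constants, and the cylinder error decays by
  one power faster than \<open>rate\<close>.\<close>

lemma cov_bound_le_rate:
  assumes C: "0 \<le> C" "\<And>j. w j \<le> C * rate j"
  obtains C' where "0 < C'" "\<And>d. cov_bound d \<le> C' * rate d"
proof -
  define a where "a = 1 / \<beta>"
  define C' where "C' = L\<^sup>2 * ((4 / \<beta>) powr a + 2 * (C * 2 powr (a - 1)))"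
  have a: "3 < a" using inverse_\<beta> by (simp add: a_def)
  have half: "(y / 2) powr (- b) = 2 powr b * y powr (- b)" for y b :: real
    unfolding powr_divide powr_minus_divide[of 2 b] by simp
  show thesis
  proof (rule that[of C'])
    show "0 < C'" using L_ge_1 \<beta>_pos C by (auto simp: C'_def intro!: mult_pos_pos add_pos_nonneg)
    fix d
    define y where "y = 1 + real d"
    have y: "1 \<le> y" by (simp add: y_def)
    have l1: "1 \<le> (1 + ln y) powr (a + 1)" using y a by (intro ge_one_powr_ge_zero) auto
    have h1: "y / 2 \<le> 1 + real (d div 2)" "y / 2 \<le> 1 + real (d - d div 2)" "1 + real (d - d div 2) \<le> y"
    proof -
      have "d \<le> 2 * (d div 2) + 1" "d \<le> 2 * (d - d div 2)" by linarith+
      then have "real d \<le> 2 * real (d div 2) + 1" "real d \<le> 2 * real (d - d div 2)" by linarith+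
      then show "y / 2 \<le> 1 + real (d div 2)" "y / 2 \<le> 1 + real (d - d div 2)" "1 + real (d - d div 2) \<le> y"
        unfolding y_def by auto
    qed
    have e: "end_bound (d div 2) \<le> (4 / \<beta>) powr a * rate d"
    proof -
      have "end_bound (d div 2) \<le> (2 / \<beta>) powr a * (1 + real (d div 2)) powr (- a)"
        using end_bound_le[of "d div 2"] by (simp add: a_def)
      also have "\<dots> \<le> (2 / \<beta>) powr a * (y / 2) powr (- a)"
        using h1(1) y a by (intro mult_left_mono powr_mono2') auto
      also have "\<dots> = ((2 / \<beta>) powr a * 2 powr a) * y powr (- a)" unfolding half by simp
      also have "(2 / \<beta>) powr a * 2 powr a = (4 / \<beta>) powr a" by (simp add: powr_mult[symmetric])
      also have "y powr (- a) \<le> y powr (1 - a) * (1 + ln y) powr (a + 1)"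
        using mult_mono[OF powr_mono[of "- a" "1 - a" y] l1] y by simp
      finally show ?thesis by (simp add: rate_def y_def a_def mult_left_mono)
    qed
    have r: "rate (d - d div 2) \<le> 2 powr (a - 1) * rate d"
    proof -
      let ?z = "1 + real (d - d div 2)"
      have "rate (d - d div 2) = ?z powr (1 - a) * (1 + ln ?z) powr (a + 1)" by (simp add: rate_def a_def)
      also have "\<dots> \<le> (y / 2) powr (1 - a) * (1 + ln y) powr (a + 1)"
      proof (rule mult_mono)
        show "?z powr (1 - a) \<le> (y / 2) powr (1 - a)" using h1 y a by (intro powr_mono2') auto
        have "ln ?z \<le> ln y" using h1(3) by simp
        then show "(1 + ln ?z) powr (a + 1) \<le> (1 + ln y) powr (a + 1)" using a by (intro powr_mono2) auto
      qed auto
      also have "(y / 2) powr (1 - a) = 2 powr (a - 1) * y powr (1 - a)" using half[of y "a - 1"] by simp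
      finally show ?thesis by (simp add: rate_def y_def a_def)
    qed
    have "w (d - d div 2) \<le> C * (2 powr (a - 1) * rate d)"
      using C(2)[of "d - d div 2"] mult_left_mono[OF r C(1)] by linarith
    then have "end_bound (d div 2) + 2 * w (d - d div 2) \<le> ((4 / \<beta>) powr a + 2 * (C * 2 powr (a - 1))) * rate d"
      using e by (simp add: algebra_simps)
    from mult_left_mono[OF this, of "L\<^sup>2"] show "cov_bound d \<le> C' * rate d"
      by (simp add: cov_bound_def C'_def mult.assoc)
  qed
qed

text \<open>Summing \<open>stein_point\<close> over \<open>n\<close>: decoupling a single variable
  costs \<open>tail_rate N k\<close>; decoupling pairs and dropping distant covariances cost
  \<open>k\<close> times this over \<open>s\<close>; the quadratic terms cost
  \<open>k / s\<^sup>2\<close>. Mixed terms are absorbed by means of \<open>s \<ge> 1\<close>, and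
  \<open>k + 1 \<le> c1 * N\<close> compares the logarithm of \<open>k\<close> with that of
  \<open>N\<close>.\<close>

lemma stein_total:
  assumes C: "0 \<le> C" "\<And>j. w j \<le> C * rate j" and c1: "1 \<le> c1"
  obtains K where "0 < K"
    "\<And>N k s h. 2 \<le> N \<Longrightarrow> 1 \<le> k \<Longrightarrow> real k + 1 \<le> c1 * real N \<Longrightarrow> 1 \<le> s \<Longrightarrow> s\<^sup>2 = (\<integral>x. (total N x)\<^sup>2 \<partial>\<nu>) \<Longrightarrow>
      \<forall>x y. \<bar>h x - h y\<bar> \<le> \<bar>x - y\<bar> \<Longrightarrow>
      \<bar>(\<integral>x. h (total N x) \<partial>\<nu>) - (LBINT z. std_normal_density z * h (s * z))\<bar>
        \<le> K * real N * (tail_rate N k + real k * tail_rate N k / s + real k / s\<^sup>2)"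
proof -
  define a where "a = 1 / \<beta>"
  have a: "3 < a" using inverse_\<beta> by (simp add: a_def)
  obtain C' where C': "0 < C'" "\<And>d. cov_bound d \<le> C' * rate d"
    by (rule cov_bound_le_rate[OF C]) (rule that)
  obtain C'' where C'': "0 < C''" "\<And>d. rate d \<le> C'' * (1 / (1 + real d)\<^sup>2)"
    by (rule rate_le_inverse_square) (rule that)
  define c0 where "c0 = 4 * C' * C''"
  define b where "b = (2 / \<beta>) powr a"
  define l where "l = (1 + ln c1) powr (a + 1)"
  define K where "K = 24 * C' + c0 * 11 * (1 + 9 * c0) + (14 * L * b + 18 * L\<^sup>2 * b + 28 * L * (C * l))
     + 10 * L\<^sup>2 * (6 * b + 66 * L * b + 12 * (C * l)) + 264 * L * c0"
  have nn: "0 < c0" "0 \<le> b" "0 \<le> l" "0 \<le> C * l" using C' C'' C by (auto simp: c0_def b_def l_def)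
  show thesis
  proof (rule that[of K])
    show "0 < K" unfolding K_def using nn L_ge_1 C' C(1)
      by (intro add_pos_nonneg add_nonneg_nonneg mult_nonneg_nonneg) auto
    fix N k :: nat and s :: real and h :: "real \<Rightarrow> real"
    assume N: "2 \<le> N" and k: "1 \<le> k" and kN: "real k + 1 \<le> c1 * real N" and s: "1 \<le> s"
      and V: "s\<^sup>2 = (\<integral>x. (total N x)\<^sup>2 \<partial>\<nu>)" and "\<forall>x y. \<bar>h x - h y\<bar> \<le> \<bar>x - y\<bar>"
    then have h: "\<bar>h x - h y\<bar> \<le> \<bar>x - y\<bar>" for x y by blast
    define \<Lambda> where "\<Lambda> = tail_rate N k"
    have \<Lambda>: "0 \<le> \<Lambda>" unfolding \<Lambda>_def by (rule tail_rate_nonneg)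
    have lN: "0 \<le> ln (real N)" using N by simp
    have pk: "(1 + real k) powr (1 - a) \<le> \<Lambda>"
    proof -
      have "1 \<le> (1 + ln (real N)) powr (a + 1)" using lN a by (intro ge_one_powr_ge_zero) auto
      from mult_left_mono[OF this, of "(1 + real k) powr (1 - a)"] show ?thesis
        by (simp add: \<Lambda>_def tail_rate_def a_def)
    qed
    have eb: "end_bound k \<le> b * \<Lambda>"
    proof -
      have "end_bound k \<le> b * (1 + real k) powr (- a)" using end_bound_le[of k] by (simp add: b_def a_def)
      also have "\<dots> \<le> b * (1 + real k) powr (1 - a)" using nn by (intro mult_left_mono powr_mono) auto
      also have "\<dots> \<le> b * \<Lambda>" using pk nn by (intro mult_left_mono) auto
      finally show ?thesis .
    qed
    have T: "(\<Sum>i<p. end_bound (p + k - i)) \<le> 2 * b * \<Lambda>" for p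
    proof -
      have "(\<Sum>i<p. end_bound (p + k - i)) \<le> 2 * b * (1 + real k) powr (1 - a)"
        using end_bound_sum_le[of p k] by (simp add: b_def a_def)
      also have "\<dots> \<le> 2 * b * \<Lambda>" using pk nn by (intro mult_left_mono) auto
      finally show ?thesis .
    qed
    have wk: "w k \<le> C * l * \<Lambda>"
    proof -
      have "1 + ln (1 + real k) \<le> (1 + ln c1) * (1 + ln (real N))"
      proof -
        have "ln (1 + real k) \<le> ln (c1 * real N)" using kN by (subst ln_le_cancel_iff) auto
        also have "\<dots> = ln c1 + ln (real N)" using c1 N by (simp add: ln_mult)
        finally have "ln (1 + real k) \<le> ln c1 + ln (real N)" .
        moreover have "0 \<le> ln c1 * ln (real N)" using c1 lN by (intro mult_nonneg_nonneg) auto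
        ultimately show ?thesis by (simp add: ring_distribs)
      qed
      then have "(1 + ln (1 + real k)) powr (a + 1) \<le> l * (1 + ln (real N)) powr (a + 1)"
        unfolding l_def powr_mult[symmetric] using a by (intro powr_mono2) auto
      then have "rate k \<le> l * \<Lambda>"
        unfolding rate_def \<Lambda>_def tail_rate_def a_def[symmetric]
        using mult_left_mono[of "(1 + ln (1 + real k)) powr (a + 1)" "l * (1 + ln (real N)) powr (a + 1)" "(1 + real k) powr (1 - a)"]
        by (simp add: mult_ac)
      from mult_left_mono[OF this C(1)] show ?thesis using C(2)[of k] by (simp add: mult.assoc)
    qed
    have csum: "(\<Sum>j<N. cov_bound (nat \<bar>int i - int j\<bar>)) \<le> c0" for i
    proof -
      have "(\<Sum>j<N. cov_bound (nat \<bar>int i - int j\<bar>)) \<le> (\<Sum>j<N. C' * C'' * (1 / (1 + real (nat \<bar>int i - int j\<bar>))\<^sup>2))"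
      proof (rule sum_mono)
        fix j
        show "cov_bound (nat \<bar>int i - int j\<bar>) \<le> C' * C'' * (1 / (1 + real (nat \<bar>int i - int j\<bar>))\<^sup>2)"
          unfolding mult.assoc
          by (rule order_trans[OF C'(2) mult_left_mono[OF C''(2)]]) (use C'(1) in simp)
      qed
      also have "\<dots> = C' * C'' * (\<Sum>j<N. 1 / (1 + real (nat \<bar>int i - int j\<bar>))\<^sup>2)" by (simp add: sum_distrib_left)
      also have "\<dots> \<le> C' * C'' * (4 / (1 + real 0))"
        using C' C'' by (intro mult_left_mono sum_inverse_square_dist_le) auto
      finally show ?thesis by (simp add: c0_def)
    qed
    have tsum: "(\<Sum>j\<in>{..<N} - window N (2 * k) n. cov_bound (nat \<bar>int n - int j\<bar>)) \<le> 8 * C' * (real k * \<Lambda>)"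
      if n: "n < N" for n
    proof -
      have "(\<Sum>j\<in>{..<N} - window N (2 * k) n. cov_bound (nat \<bar>int n - int j\<bar>))
          \<le> (\<Sum>j\<in>{..<N} - window N (2 * k) n. C' * rate (nat \<bar>int n - int j\<bar>))"
        using C'(2) by (intro sum_mono)
      also have "\<dots> = C' * (\<Sum>j\<in>{..<N} - window N (2 * k) n. rate (nat \<bar>int n - int j\<bar>))" by (simp add: sum_distrib_left)
      also have "\<dots> \<le> C' * (4 * (1 + real k) * \<Lambda>)"
        unfolding \<Lambda>_def using C'(1) n by (intro mult_left_mono rate_tail_sum) (auto simp: window_def)
      also have "\<dots> \<le> C' * (4 * (2 * real k) * \<Lambda>)"
        using C'(1) k \<Lambda> by (intro mult_left_mono mult_right_mono) auto
      finally show ?thesis by (simp add: mult_ac)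
    qed
    have s0: "0 < s" using s by simp
    obtain B B' where B: "\<And>u. (B has_real_derivative B' u) (at u)" "\<And>u. \<bar>B u\<bar> \<le> 7" "\<And>u. \<bar>B' u\<bar> \<le> 3 / s"
      "\<And>u v. \<bar>B' u - B' v\<bar> \<le> 11 / s\<^sup>2 * \<bar>u - v\<bar>"
      "\<And>u. h u - (LBINT z. std_normal_density z * h (s * z)) = s\<^sup>2 * B' u - u * B u"
      by (rule stein_equation[OF h s0]) (rule that)
    define X where "X = 8 * C' * (real k * \<Lambda>) * (3 / s) + c0 * (11 / s\<^sup>2) * (1 + 9 * real k * c0)
      + (14 * L * end_bound k + 3 * L\<^sup>2 * (3 / s) * (2 * b * \<Lambda>) + 28 * L * w k)
      + 10 * L\<^sup>2 * real k * (2 * end_bound k * (3 / s) + 3 * (11 / s\<^sup>2) * L * (2 * b * \<Lambda>) + 4 * (3 / s) * w k)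
      + 24 * L * (11 / s\<^sup>2) * real k * c0"
    have point: "\<bar>(\<integral>x. \<zeta> n x * total N x \<partial>\<nu>) * (\<integral>x. B' (total N x) \<partial>\<nu>) - (\<integral>x. \<zeta> n x * B (total N x) \<partial>\<nu>)\<bar> \<le> X"
      if "n < N" for n
      unfolding X_def by (rule stein_point[OF that k B(1-4) T csum tsum[OF that]])
    have Bm: "B \<in> borel_measurable borel"
      using B(1) by (intro borel_measurable_continuous_onI DERIV_continuous_on) (auto intro: has_field_derivative_at_within)
    have B'm: "B' \<in> borel_measurable borel"
    proof -
      have "(11 / s\<^sup>2)-lipschitz_on UNIV B'" using B(4) by (intro lipschitz_onI) (auto simp: dist_real_def)
      then show ?thesis by (intro borel_measurable_continuous_onI lipschitz_on_continuous_on)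
    qed
    note [measurable] = Bm B'm
    have hm [measurable]: "h \<in> borel_measurable borel"
    proof -
      have "1-lipschitz_on UNIV h" using h by (intro lipschitz_onI) (auto simp: dist_real_def)
      then show ?thesis by (intro borel_measurable_continuous_onI lipschitz_on_continuous_on)
    qed
    have i1: "integrable \<nu> (\<lambda>x. B' (total N x))" using B(3) by (intro integrable_\<nu>_bounded) auto
    have i2: "integrable \<nu> (\<lambda>x. \<zeta> n x * B (total N x))" for n
      using \<zeta>_bound B(2) by (intro integrable_mult_bounded) auto
    have i3: "integrable \<nu> (\<lambda>x. \<zeta> n x * total N x)" for n
      using \<zeta>_bound total_bound by (intro integrable_mult_bounded) auto
    have i4: "integrable \<nu> (\<lambda>x. total N x * B (total N x))"
      using total_bound B(2) by (intro integrable_mult_bounded) auto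
    define m where "m = (LBINT z. std_normal_density z * h (s * z))"
    have hx: "h (total N x) = m + (s\<^sup>2 * B' (total N x) - total N x * B (total N x))" for x
      using B(5)[of "total N x"] by (simp add: m_def)
    \<comment> \<open>Expectations are taken in Stein's equation. The variance is then distributed
      over the summands, so that the difference becomes a sum of the quantities estimated in
      \<open>stein_point\<close>.\<close>
    have "(\<integral>x. h (total N x) \<partial>\<nu>) - m = s\<^sup>2 * (\<integral>x. B' (total N x) \<partial>\<nu>) - (\<integral>x. total N x * B (total N x) \<partial>\<nu>)"
      unfolding hx using i1 i4 \<nu>.prob_space by simp
    also have "s\<^sup>2 = (\<Sum>n<N. \<integral>x. \<zeta> n x * total N x \<partial>\<nu>)"
    proof -
      have "(\<integral>x. (total N x)\<^sup>2 \<partial>\<nu>) = (\<integral>x. (\<Sum>n<N. \<zeta> n x * total N x) \<partial>\<nu>)"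
        by (simp add: power2_eq_square total_def sum_distrib_right)
      then show ?thesis using V i3 by simp
    qed
    also have "(\<integral>x. total N x * B (total N x) \<partial>\<nu>) = (\<Sum>n<N. \<integral>x. \<zeta> n x * B (total N x) \<partial>\<nu>)"
    proof -
      have "(\<integral>x. total N x * B (total N x) \<partial>\<nu>) = (\<integral>x. (\<Sum>n<N. \<zeta> n x * B (total N x)) \<partial>\<nu>)"
        by (subst (1) total_def) (simp add: sum_distrib_right)
      then show ?thesis using i2 by simp
    qed
    also have "(\<Sum>n<N. \<integral>x. \<zeta> n x * total N x \<partial>\<nu>) * (\<integral>x. B' (total N x) \<partial>\<nu>) - (\<Sum>n<N. \<integral>x. \<zeta> n x * B (total N x) \<partial>\<nu>)
      = (\<Sum>n<N. (\<integral>x. \<zeta> n x * total N x \<partial>\<nu>) * (\<integral>x. B' (total N x) \<partial>\<nu>) - (\<integral>x. \<zeta> n x * B (total N x) \<partial>\<nu>))"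
      by (simp add: sum_distrib_right sum_subtractf)
    finally have diff: "(\<integral>x. h (total N x) \<partial>\<nu>) - m
      = (\<Sum>n<N. (\<integral>x. \<zeta> n x * total N x \<partial>\<nu>) * (\<integral>x. B' (total N x) \<partial>\<nu>) - (\<integral>x. \<zeta> n x * B (total N x) \<partial>\<nu>))" .
    have "\<bar>(\<integral>x. h (total N x) \<partial>\<nu>) - m\<bar> \<le> (\<Sum>n<N. X)"
      unfolding diff by (rule order_trans[OF sum_abs sum_mono]) (use point in auto)
    then have main: "\<bar>(\<integral>x. h (total N x) \<partial>\<nu>) - m\<bar> \<le> real N * X" by simp
    define G where "G = \<Lambda> + real k * \<Lambda> / s + real k / s\<^sup>2"
    have s2: "1 \<le> s\<^sup>2" using s by simp
    have k0: "1 \<le> real k" using k by simp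
    have G1: "\<Lambda> \<le> G" "real k * \<Lambda> / s \<le> G" "real k / s\<^sup>2 \<le> G" "0 \<le> G"
      using \<Lambda> s0 by (auto simp: G_def)
    have G2: "\<Lambda> / s \<le> G"
    proof -
      have "1 * (\<Lambda> / s) \<le> real k * (\<Lambda> / s)" using k0 \<Lambda> s0 by (intro mult_right_mono) auto
      then show ?thesis using G1(2) by simp
    qed
    have G3: "1 / s\<^sup>2 \<le> G"
    proof -
      have "1 / s\<^sup>2 \<le> real k / s\<^sup>2" using k0 by (intro divide_right_mono) auto
      then show ?thesis using G1(3) by simp
    qed
    have G4: "real k * \<Lambda> / s\<^sup>2 \<le> G"
    proof -
      have "real k * \<Lambda> / s\<^sup>2 \<le> real k * \<Lambda> / s"
        using \<Lambda> s by (intro divide_left_mono) (auto simp: power2_eq_square)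
      then show ?thesis using G1(2) by simp
    qed
    have X: "X \<le> K * G"
    proof -
      have x1: "8 * C' * (real k * \<Lambda>) * (3 / s) \<le> 24 * C' * G"
        using mult_left_mono[OF G1(2), of "24 * C'"] C'(1) by (simp add: mult_ac)
      have x2: "c0 * (11 / s\<^sup>2) * (1 + 9 * real k * c0) \<le> c0 * 11 * (1 + 9 * c0) * G"
      proof -
        have "c0 * (11 / s\<^sup>2) * (1 + 9 * real k * c0) = c0 * 11 * (1 / s\<^sup>2) + c0 * 11 * 9 * c0 * (real k / s\<^sup>2)"
          by (simp add: algebra_simps add_divide_distrib)
        also have "\<dots> \<le> c0 * 11 * G + c0 * 11 * 9 * c0 * G"
          using G3 G1(3) nn by (intro add_mono mult_left_mono) auto
        finally show ?thesis by (simp add: algebra_simps)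
      qed
      have x3: "14 * L * end_bound k \<le> 14 * L * b * G"
      proof -
        have "b * \<Lambda> \<le> b * G" using G1(1) nn by (intro mult_left_mono) auto
        then have "end_bound k \<le> b * G" using eb by linarith
        from mult_left_mono[OF this, of "14 * L"] show ?thesis using L_ge_1 by (simp add: mult.assoc)
      qed
      have x4: "3 * L\<^sup>2 * (3 / s) * (2 * b * \<Lambda>) \<le> 18 * L\<^sup>2 * b * G"
        using mult_left_mono[OF G2, of "18 * L\<^sup>2 * b"] nn by (simp add: mult_ac)
      have x5: "28 * L * w k \<le> 28 * L * (C * l) * G"
      proof -
        have "C * l * \<Lambda> \<le> C * l * G" using G1(1) nn by (intro mult_left_mono) auto
        then have "w k \<le> C * l * G" using wk by linarith
        from mult_left_mono[OF this, of "28 * L"] show ?thesis using L_ge_1 by (simp add: mult.assoc)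
      qed
      have x6: "10 * L\<^sup>2 * real k * (2 * end_bound k * (3 / s)) \<le> 10 * L\<^sup>2 * (6 * b) * G"
      proof -
        have "end_bound k * (real k / s) \<le> b * \<Lambda> * (real k / s)" using eb s0 by (intro mult_right_mono) auto
        also have "\<dots> \<le> b * G" using mult_left_mono[OF G1(2) nn(2)] by (simp add: mult_ac)
        finally show ?thesis using mult_left_mono[of "end_bound k * (real k / s)" "b * G" "60 * L\<^sup>2"] by (simp add: mult_ac)
      qed
      have x7: "10 * L\<^sup>2 * real k * (3 * (11 / s\<^sup>2) * L * (2 * b * \<Lambda>)) \<le> 10 * L\<^sup>2 * (66 * L * b) * G"
        using mult_left_mono[OF G4, of "660 * L\<^sup>2 * L * b"] nn L_ge_1 by (simp add: mult_ac)
      have x8: "10 * L\<^sup>2 * real k * (4 * (3 / s) * w k) \<le> 10 * L\<^sup>2 * (12 * (C * l)) * G"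
      proof -
        have "w k * (real k / s) \<le> C * l * \<Lambda> * (real k / s)" using wk s0 by (intro mult_right_mono) auto
        also have "\<dots> \<le> C * l * G" using mult_left_mono[OF G1(2) nn(4)] by (simp add: mult_ac)
        finally show ?thesis using mult_left_mono[of "w k * (real k / s)" "C * l * G" "120 * L\<^sup>2"] by (simp add: mult_ac)
      qed
      have x9: "24 * L * (11 / s\<^sup>2) * real k * c0 \<le> 264 * L * c0 * G"
        using mult_left_mono[OF G1(3), of "264 * L * c0"] nn L_ge_1 by (simp add: mult_ac)
      have "X \<le> 24 * C' * G + c0 * 11 * (1 + 9 * c0) * G + (14 * L * b * G + 18 * L\<^sup>2 * b * G + 28 * L * (C * l) * G)
        + (10 * L\<^sup>2 * (6 * b) * G + 10 * L\<^sup>2 * (66 * L * b) * G + 10 * L\<^sup>2 * (12 * (C * l)) * G) + 264 * L * c0 * G"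
        unfolding X_def ring_distribs(1)[of "10 * L\<^sup>2 * real k"]
        by (intro add_mono x1 x2 x3 x4 x5 x6 x7 x8 x9)
      also have "\<dots> = K * G" by (simp add: K_def algebra_simps)
      finally show ?thesis .
    qed
    have "real N * X \<le> real N * (K * G)" using X by (intro mult_left_mono) auto
    then show "\<bar>(\<integral>x. h (total N x) \<partial>\<nu>) - (LBINT z. std_normal_density z * h (s * z))\<bar>
        \<le> K * real N * (tail_rate N k + real k * tail_rate N k / s + real k / s\<^sup>2)"
      using main by (simp add: m_def G_def \<Lambda>_def mult_ac)
  qed
qed

end

context subcritical
begin

text \<open>The bound of the theorem multiplied by \<open>sqrt N\<close>, because the sums here are
  not normalized; it also serves as the length \<open>k\<close> of the gaps.\<close>

definition gap_scale :: "nat \<Rightarrow> real" where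
  "gap_scale N = real N powr \<beta> * ln (real N) powr (1 / \<beta>)"

text \<open>The second bound holds because \<open>\<beta> < 1/2\<close> leaves a positive power for
  the logarithm. In the third, with l = ln N and a = 1/\<beta>, inserting the lower bound for
  \<open>1 + k\<close> gives N^\<beta> l^(1 + 2a - a^2) up to a constant; this is
  \<open>gap_scale N\<close> times l^(1 + a - a^2), whose exponent is negative as a > 3.\<close>

lemma gap_scale_bounds:
  obtains c where "1 \<le> c"
    "\<And>N. 2 \<le> N \<Longrightarrow> 1 \<le> c * gap_scale N"
    "\<And>N. 2 \<le> N \<Longrightarrow> gap_scale N \<le> c * sqrt (real N)"
    "\<And>N k. 2 \<le> N \<Longrightarrow> gap_scale N \<le> 1 + real k \<Longrightarrow> real N * tail_rate N k \<le> c * gap_scale N"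
proof -
  define a where "a = 1 / \<beta>"
  have a: "3 < a" using inverse_\<beta> by (simp add: a_def)
  define e where "e = (1/2 - \<beta>) / a"
  have e: "0 < e" using a \<beta>_less by (simp add: e_def)
  have ln2: "0 < ln (2::real)" by simp
  define c2 where "c2 = ln 2 powr (- a)"
  define c3 where "c3 = (1 / e) powr a"
  define c4 where "c4 = (1 + 1 / ln 2) powr (a + 1) * ln 2 powr (1 + a - a * a)"
  define c where "c = max 1 (max c2 (max c3 c4))"
  have c: "1 \<le> c" "c2 \<le> c" "c3 \<le> c" "c4 \<le> c" by (auto simp: c_def)
  show thesis
  proof (rule that[of c])
    fix N :: nat assume N: "2 \<le> N"
    define l where "l = ln (real N)"
    have l: "ln 2 \<le> l" "0 < l" using N ln2 by (auto simp: l_def)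
    have g: "gap_scale N = real N powr \<beta> * l powr a" by (simp add: gap_scale_def l_def a_def)
    have g0: "0 < gap_scale N" using N l by (simp add: g)
    show "1 \<le> c * gap_scale N"
    proof -
      have "1 = c2 * (1 * ln 2 powr a)" using ln2 by (simp add: c2_def powr_add[symmetric])
      also have "\<dots> \<le> c2 * (real N powr \<beta> * l powr a)"
        using N l a \<beta>_pos by (intro mult_left_mono mult_mono powr_mono2 ge_one_powr_ge_zero) (auto simp: c2_def)
      also have "\<dots> \<le> c * gap_scale N" unfolding g[symmetric] using c g0 by (intro mult_right_mono) auto
      finally show ?thesis .
    qed
    show "gap_scale N \<le> c * sqrt (real N)"
    proof -
      have "l \<le> real N powr e / e" unfolding l_def using N e by (intro ln_powr_bound) auto
      then have "l powr a \<le> (1 / e * real N powr e) powr a" using l a by (intro powr_mono2) auto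
      also have "\<dots> = c3 * real N powr (1/2 - \<beta>)"
        unfolding powr_mult powr_powr c3_def using a by (simp add: e_def)
      finally have "gap_scale N \<le> real N powr \<beta> * (c3 * real N powr (1/2 - \<beta>))"
        unfolding g by (intro mult_left_mono) auto
      also have "\<dots> = c3 * sqrt (real N)" by (simp add: powr_add[symmetric] powr_half_sqrt)
      also have "\<dots> \<le> c * sqrt (real N)" using c by (intro mult_right_mono) auto
      finally show ?thesis .
    qed
    fix k assume k: "gap_scale N \<le> 1 + real k"
    show "real N * tail_rate N k \<le> c * gap_scale N"
    proof -
      have ab: "\<beta> * (1 - a) = \<beta> - 1" using \<beta>_pos by (simp add: a_def algebra_simps)
      have "(1 + real k) powr (1 - a) \<le> gap_scale N powr (1 - a)"
        using k g0 a by (intro powr_mono2') auto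
      also have "\<dots> = real N powr (\<beta> - 1) * l powr (a - a * a)"
        unfolding g powr_mult powr_powr ab by (simp add: algebra_simps)
      finally have p1: "(1 + real k) powr (1 - a) \<le> real N powr (\<beta> - 1) * l powr (a - a * a)" .
      have "1 + l \<le> (1 + 1 / ln 2) * l" using l ln2 by (simp add: field_simps)
      then have "(1 + l) powr (a + 1) \<le> ((1 + 1 / ln 2) * l) powr (a + 1)" using l a by (intro powr_mono2) auto
      then have p2: "(1 + l) powr (a + 1) \<le> (1 + 1 / ln 2) powr (a + 1) * l powr (a + 1)" by (simp add: powr_mult)
      have "tail_rate N k \<le> (real N powr (\<beta> - 1) * l powr (a - a * a)) * ((1 + 1 / ln 2) powr (a + 1) * l powr (a + 1))"
        unfolding tail_rate_def a_def[symmetric] l_def[symmetric] using p1 p2 by (intro mult_mono) auto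
      then have "real N * tail_rate N k
        \<le> real N * ((real N powr (\<beta> - 1) * l powr (a - a * a)) * ((1 + 1 / ln 2) powr (a + 1) * l powr (a + 1)))"
        by (intro mult_left_mono) auto
      also have "\<dots> = (real N powr 1 * real N powr (\<beta> - 1)) * (1 + 1 / ln 2) powr (a + 1) * (l powr (a - a * a) * l powr (a + 1))"
        using N by simp
      also have "\<dots> = (1 + 1 / ln 2) powr (a + 1) * l powr (1 + a - a * a) * (real N powr \<beta> * l powr a)"
        unfolding powr_add[symmetric] by (simp add: powr_add[symmetric] algebra_simps)
      also have "\<dots> \<le> (1 + 1 / ln 2) powr (a + 1) * ln 2 powr (1 + a - a * a) * (real N powr \<beta> * l powr a)"
      proof (intro mult_right_mono mult_left_mono powr_mono2')
        have "3 * a \<le> a * a" using a by (intro mult_right_mono) auto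
        then show "1 + a - a * a \<le> 0" using a by linarith
      qed (use l ln2 in auto)
      also have "\<dots> = c4 * gap_scale N" by (simp add: c4_def g)
      also have "\<dots> \<le> c * gap_scale N" using c g0 by (intro mult_right_mono) auto
      finally show ?thesis .
    qed
  qed (use c in auto)
qed

end

context observable
begin

text \<open>For \<open>s \<ge> 1\<close>, \<open>stein_total\<close> is applied with
  \<open>k\<close> equal to \<open>gap_scale N\<close> rounded up, which makes
  \<open>N * tail_rate N k\<close> at most a multiple of \<open>k\<close>. For \<open>s < 1\<close>
  both variables have mean absolute value at most 1, so the difference is at most 2, and
  \<open>gap_scale N\<close> is bounded below.\<close>

lemma normal_approximation:
  assumes C: "0 \<le> C" "\<And>j. w j \<le> C * rate j"
  obtains K where "0 < K"
    "\<And>N s h. 2 \<le> N \<Longrightarrow> 0 < s \<Longrightarrow> s\<^sup>2 = (\<integral>x. (total N x)\<^sup>2 \<partial>\<nu>) \<Longrightarrow>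
      \<forall>x y. \<bar>h x - h y\<bar> \<le> \<bar>x - y\<bar> \<Longrightarrow>
      \<bar>(\<integral>x. h (total N x) \<partial>\<nu>) - (LBINT z. std_normal_density z * h (s * z))\<bar>
        \<le> K * max 1 (real N / s\<^sup>2) * gap_scale N"
proof -
  obtain c where c: "1 \<le> c"
    "\<And>N. 2 \<le> N \<Longrightarrow> 1 \<le> c * gap_scale N"
    "\<And>N. 2 \<le> N \<Longrightarrow> gap_scale N \<le> c * sqrt (real N)"
    "\<And>N k. 2 \<le> N \<Longrightarrow> gap_scale N \<le> 1 + real k \<Longrightarrow> real N * tail_rate N k \<le> c * gap_scale N"
    by (rule gap_scale_bounds) (rule that)
  define c1 where "c1 = 3 * c * c"
  have cc: "1 * 1 \<le> c * c" using c(1) by (intro mult_mono) auto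
  then have c1: "1 \<le> c1" by (simp add: c1_def)
  obtain K0 where K0: "0 < K0"
    "\<And>N k s h. 2 \<le> N \<Longrightarrow> 1 \<le> k \<Longrightarrow> real k + 1 \<le> c1 * real N \<Longrightarrow> 1 \<le> s \<Longrightarrow> s\<^sup>2 = (\<integral>x. (total N x)\<^sup>2 \<partial>\<nu>) \<Longrightarrow>
      \<forall>x y. \<bar>h x - h y\<bar> \<le> \<bar>x - y\<bar> \<Longrightarrow>
      \<bar>(\<integral>x. h (total N x) \<partial>\<nu>) - (LBINT z. std_normal_density z * h (s * z))\<bar>
        \<le> K0 * real N * (tail_rate N k + real k * tail_rate N k / s + real k / s\<^sup>2)"
    by (rule stein_total[OF C c1]) (rule that)
  define K where "K = max (K0 * (c + 2 * c * c * c + 2 * c)) (2 * c)"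
  show thesis
  proof (rule that[of K])
    show "0 < K" using c(1) by (simp add: K_def)
    fix N :: nat and s :: real and h :: "real \<Rightarrow> real"
    assume N: "2 \<le> N" and s: "0 < s" and V: "s\<^sup>2 = (\<integral>x. (total N x)\<^sup>2 \<partial>\<nu>)"
      and h': "\<forall>x y. \<bar>h x - h y\<bar> \<le> \<bar>x - y\<bar>"
    then have h: "\<bar>h x - h y\<bar> \<le> \<bar>x - y\<bar>" for x y by blast
    define y where "y = gap_scale N"
    define M where "M = max 1 (real N / s\<^sup>2)"
    have y: "1 \<le> c * y" "y \<le> c * sqrt (real N)" using c(2,3)[OF N] by (auto simp: y_def)
    have y0: "0 < y" using N by (simp add: y_def gap_scale_def)
    have M: "1 \<le> M" by (simp add: M_def)
    show "\<bar>(\<integral>x. h (total N x) \<partial>\<nu>) - (LBINT z. std_normal_density z * h (s * z))\<bar>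
        \<le> K * max 1 (real N / s\<^sup>2) * gap_scale N"
    proof (cases "1 \<le> s")
      case True
      define k where "k = nat \<lceil>y\<rceil>"
      have k: "y \<le> real k" "real k \<le> y + 1" unfolding k_def using y0 by linarith+
      have k1: "1 \<le> k" using k(1) y0 by linarith
      have yc: "y \<le> c * y" using mult_right_mono[OF c(1), of y] y0 by simp
      have k2: "real k \<le> 2 * c * y" using k(2) y(1) yc by linarith
      have sq: "sqrt (real N) \<le> real N"
      proof -
        have "real N \<le> (real N)\<^sup>2" using N by (simp add: power2_eq_square)
        then show ?thesis by (intro real_le_lsqrt) auto
      qed
      have kN: "real k + 1 \<le> c1 * real N"
      proof -
        have "real k + 1 \<le> 3 * c * y" using k2 y(1) by linarith
        also have "\<dots> \<le> 3 * c * (c * sqrt (real N))" using y(2) c(1) by (intro mult_left_mono) auto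
        also have "\<dots> \<le> c1 * real N"
          using mult_left_mono[OF sq, of c1] c1 by (simp add: c1_def mult.assoc)
        finally show ?thesis .
      qed
      define T where "T = real N * tail_rate N k"
      have T: "T \<le> c * y" "0 \<le> T"
        unfolding T_def y_def using c(4)[OF N, of k] k(1) tail_rate_nonneg[of N k] by (auto simp: y_def)
      \<comment> \<open>In terms of the normalized deviation this says
        \<open>1 / \<sigma> \<le> max 1 (1 / \<sigma>\<^sup>2)\<close>, so the term with a single
        \<open>1 / s\<close> fits into the claimed bound.\<close>
      have inv: "sqrt (real N) / s \<le> M"
      proof -
        define u where "u = sqrt (real N) / s"
        have u: "0 \<le> u" "u\<^sup>2 = real N / s\<^sup>2" using s by (auto simp: u_def power_divide)
        have "u \<le> max 1 (u\<^sup>2)"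
        proof (cases "u \<le> 1")
          case False
          then have "u * 1 \<le> u * u" using u by (intro mult_left_mono) auto
          then show ?thesis by (simp add: power2_eq_square)
        qed simp
        then show ?thesis using u(2) by (simp add: M_def u_def)
      qed
      have t1: "T \<le> c * (M * y)"
      proof -
        have "1 * y \<le> M * y" using M y0 by (intro mult_right_mono) auto
        then have "c * y \<le> c * (M * y)" using c(1) by (intro mult_left_mono) auto
        then show ?thesis using T(1) by linarith
      qed
      have t2: "real k * T / s \<le> 2 * c * c * c * (M * y)"
      proof -
        have "real k * T / s \<le> (2 * c * y) * (c * (c * sqrt (real N))) / s"
        proof (intro divide_right_mono mult_mono)
          show "T \<le> c * (c * sqrt (real N))" using T(1) mult_left_mono[OF y(2), of c] c(1) by linarith
        qed (use k2 T s c(1) y0 in auto)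
        also have "\<dots> = (2 * c * c * c * y) * (sqrt (real N) / s)" by (simp add: mult_ac)
        also have "\<dots> \<le> (2 * c * c * c * y) * M" using inv c(1) y0 by (intro mult_left_mono) auto
        finally show ?thesis by (simp add: mult_ac)
      qed
      have t3: "real N * real k / s\<^sup>2 \<le> 2 * c * (M * y)"
      proof -
        have "real N * real k / s\<^sup>2 = real k * (real N / s\<^sup>2)" by simp
        also have "\<dots> \<le> (2 * c * y) * M"
          using k2 c(1) y0 by (intro mult_mono) (auto simp: M_def)
        finally show ?thesis by (simp add: mult_ac)
      qed
      have "\<bar>(\<integral>x. h (total N x) \<partial>\<nu>) - (LBINT z. std_normal_density z * h (s * z))\<bar>
        \<le> K0 * real N * (tail_rate N k + real k * tail_rate N k / s + real k / s\<^sup>2)"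
        by (rule K0(2)[OF N k1 kN True V h'])
      also have "\<dots> = K0 * (T + real k * T / s + real N * real k / s\<^sup>2)"
        by (simp add: T_def algebra_simps)
      also have "\<dots> \<le> K0 * (c * (M * y) + 2 * c * c * c * (M * y) + 2 * c * (M * y))"
        using t1 t2 t3 K0(1) by (intro mult_left_mono add_mono) auto
      also have "\<dots> = K0 * (c + 2 * c * c * c + 2 * c) * (M * y)" by (simp add: algebra_simps)
      also have "\<dots> \<le> K * (M * y)" using M y0 by (intro mult_right_mono) (auto simp: K_def)
      finally show ?thesis by (simp add: M_def y_def mult.assoc)
    next
      case False
      then have s1: "s \<le> 1" "s\<^sup>2 \<le> 1" using s by (auto intro: power_le_one)
      interpret t: lipschitz_test "\<lambda>x. h (s * x)"
      proof
        fix x y :: real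
        have "\<bar>h (s * x) - h (s * y)\<bar> \<le> \<bar>s * (x - y)\<bar>" using h[of "s * x" "s * y"] by (simp add: right_diff_distrib)
        also have "\<dots> \<le> 1 * \<bar>x - y\<bar>" unfolding abs_mult using s s1 by (intro mult_right_mono) auto
        finally show "\<bar>h (s * x) - h (s * y)\<bar> \<le> \<bar>x - y\<bar>" by simp
      qed
      have m: "t.gauss_mean = (LBINT z. std_normal_density z * h (s * z))"
        unfolding t.gauss_mean_def by (simp add: gauss_eq mult.commute)
      have hm: "h \<in> borel_measurable borel"
      proof -
        have "1-lipschitz_on UNIV h" using h by (intro lipschitz_onI) (auto simp: dist_real_def)
        then show ?thesis by (intro borel_measurable_continuous_onI lipschitz_on_continuous_on)
      qed
      note [measurable] = hm
      have i2: "integrable \<nu> (\<lambda>x. (total N x)\<^sup>2)"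
        unfolding power2_eq_square using total_bound by (intro integrable_mult_bounded) auto
      have ih: "integrable \<nu> (\<lambda>x. h (total N x) - h 0)"
      proof (rule integrable_\<nu>_bounded)
        show "\<bar>h (total N x) - h 0\<bar> \<le> real N * L" for x
          using h[of "total N x" 0] total_bound[of N x] by simp
      qed measurable
      have "\<bar>(\<integral>x. h (total N x) - h 0 \<partial>\<nu>)\<bar> \<le> (\<integral>x. \<bar>h (total N x) - h 0\<bar> \<partial>\<nu>)" by (rule integral_abs_bound)
      also have "\<dots> \<le> (\<integral>x. 1/2 * (total N x)\<^sup>2 + 1/2 \<partial>\<nu>)"
      proof (rule integral_mono)
        show "integrable \<nu> (\<lambda>x. \<bar>h (total N x) - h 0\<bar>)" using ih by simp
        show "integrable \<nu> (\<lambda>x. 1/2 * (total N x)\<^sup>2 + 1/2)" using i2 by simp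
        fix x
        have "\<bar>total N x\<bar> \<le> 1/2 * (total N x)\<^sup>2 + 1/2"
          using zero_le_power2[of "\<bar>total N x\<bar> - 1"] by (simp add: power2_eq_square algebra_simps)
        then show "\<bar>h (total N x) - h 0\<bar> \<le> 1/2 * (total N x)\<^sup>2 + 1/2" using h[of "total N x" 0] by simp
      qed
      also have "\<dots> = 1/2 * s\<^sup>2 + 1/2" using i2 V \<nu>.prob_space by simp
      also have "\<dots> \<le> 1" using s1 by simp
      finally have "\<bar>(\<integral>x. h (total N x) - h 0 \<partial>\<nu>)\<bar> \<le> 1" .
      moreover have "(\<integral>x. h (total N x) \<partial>\<nu>) = (\<integral>x. h (total N x) - h 0 \<partial>\<nu>) + h 0"
      proof -
        have "(\<integral>x. h (total N x) \<partial>\<nu>) = (\<integral>x. (h (total N x) - h 0) + h 0 \<partial>\<nu>)" by simp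
        also have "\<dots> = (\<integral>x. h (total N x) - h 0 \<partial>\<nu>) + h 0"
          by (subst Bochner_Integration.integral_add[OF ih]) (use \<nu>.prob_space in auto)
        finally show ?thesis .
      qed
      moreover have "\<bar>h 0 - t.gauss_mean\<bar> \<le> 1" using t.h_mean_bound[of 0] by simp
      ultimately have "\<bar>(\<integral>x. h (total N x) \<partial>\<nu>) - (LBINT z. std_normal_density z * h (s * z))\<bar> \<le> 2"
        unfolding m[symmetric] by linarith
      also have "\<dots> \<le> 2 * c * y" using y(1) by linarith
      also have "\<dots> \<le> 2 * c * (M * y)" using mult_right_mono[OF M, of y] y0 c(1) by (intro mult_left_mono) auto
      also have "\<dots> \<le> K * (M * y)" using M y0 by (intro mult_right_mono) (auto simp: K_def)
      finally show ?thesis by (simp add: M_def y_def mult.assoc)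
    qed
  qed
qed

end

section \<open>From the class \<open>C_star\<close> to the working cone, and the conclusion\<close>

lemma C_star_constant:
  assumes "0 \<le> \<beta>" "\<beta> \<le> (1/3 :: real)"
  shows "2 powr \<beta> * (2 + \<beta>) \<le> 3"
proof -
  have "2 powr \<beta> \<le> 2 powr (1/3 :: real)" using assms by (intro powr_mono) auto
  \<comment> \<open>63/50 is a rational upper bound for the cube root of 2, and 63/50 * 7/3 = 147/50
    is still below 3.\<close>
  also have "\<dots> \<le> ((63/50)^3) powr (1/3)" by (intro powr_mono2) (auto simp: power3_eq_cube)
  also have "\<dots> = 63/50" using powr_powr[of "63/50" 3 "1/3"] by simp
  finally have "2 powr \<beta> * (2 + \<beta>) \<le> 63/50 * (7/3)" using assms by (intro mult_mono) auto
  then show ?thesis by simp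
qed

lemma unit_lborel_AE_interior: "AE x in unit_lborel. 0 < x \<and> x < 1"
proof -
  have "AE x in lborel. x \<in> {0..1} \<longrightarrow> 0 < x \<and> x < (1::real)"
    using AE_lborel_singleton[of 0] AE_lborel_singleton[of 1] by eventually_elim auto
  then show ?thesis unfolding unit_lborel_def by (subst AE_restrict_space_iff) auto
qed

lemma integral_unit_lborel:
  fixes \<phi> :: "real \<Rightarrow> real"
  assumes "\<phi> \<in> borel_measurable unit_lborel"
  shows "integral\<^sup>L unit_lborel \<phi> = (\<integral>x. indicator {0<..<1} x * \<phi> x \<partial>uniform)"
    and "(\<lambda>x. indicator {0<..<1} x * \<phi> x) \<in> borel_measurable borel"
proof -
  have m: "(\<lambda>x. indicator {0..1} x *\<^sub>R \<phi> x) \<in> borel_measurable borel"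
    using assms unfolding unit_lborel_def by (subst (asm) borel_measurable_restrict_space_iff) auto
  have eq: "(\<lambda>x. indicator {0<..<1} x * \<phi> x) = (\<lambda>x. indicator {0<..<1} x * (indicator {0..1} x *\<^sub>R \<phi> x))"
    by (auto simp: fun_eq_iff indicator_def)
  show "(\<lambda>x. indicator {0<..<1} x * \<phi> x) \<in> borel_measurable borel"
    unfolding eq using m by measurable
  then have m': "(\<lambda>x. indicator {0<..<1} x *\<^sub>R (indicator {0<..<1} x * \<phi> x)) \<in> borel_measurable lborel" by measurable
  have "integral\<^sup>L unit_lborel \<phi> = (LBINT x. indicator {0..1} x *\<^sub>R \<phi> x)"
    unfolding unit_lborel_def by (subst integral_restrict_space) auto
  also have "\<dots> = (LBINT x. indicator {0<..<1} x *\<^sub>R (indicator {0<..<1} x * \<phi> x))"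
  proof (rule integral_cong_AE)
    show "AE x in lborel. indicator {0..1} x *\<^sub>R \<phi> x = indicator {0<..<1} x *\<^sub>R (indicator {0<..<1} x * \<phi> x)"
      using AE_lborel_singleton[of 0] AE_lborel_singleton[of 1]
      by eventually_elim (auto simp: indicator_def)
  qed (use m m' in auto)
  finally show "integral\<^sup>L unit_lborel \<phi> = (\<integral>x. indicator {0<..<1} x * \<phi> x \<partial>uniform)"
    by (simp add: integral_uniform set_lebesgue_integral_def)
qed

text \<open>Cutting the density off outside the open interval makes it Borel on the whole line and
  loses only a null set. Being a probability measure fixes the mass at 1, so the pointwise bound in
  \<open>C_star\<close> becomes the domination by \<open>3 * x powr - \<beta>\<close>.\<close>

lemma (in subcritical) C_star_density:
  fixes g :: "real \<Rightarrow> real" and \<mu> :: "real measure"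
  defines "g' \<equiv> \<lambda>x. indicator {0<..<1} x * g x"
  assumes \<mu>: "prob_space \<mu>" "\<mu> = density unit_lborel (\<lambda>x. ennreal (g x))" and g: "g \<in> C_star \<beta>"
  shows "tame g'" "density_cone (1 + \<beta>) g'" "integral\<^sup>L uniform g' = 1"
    "\<And>\<phi>. \<phi> \<in> borel_measurable borel \<Longrightarrow> integral\<^sup>L \<mu> \<phi> = integral\<^sup>L (density uniform (\<lambda>x. ennreal (g' x))) (\<phi> :: real \<Rightarrow> real)"
proof -
  have int: "integrable unit_lborel g" using g by (simp add: C_star_def)
  have gm: "g \<in> borel_measurable unit_lborel" using int by (rule borel_measurable_integrable)
  have nn: "0 \<le> g x" if "0 < x" "x \<le> 1" for x using g that by (simp add: C_star_def)
  have AE_nn: "AE x in unit_lborel. 0 \<le> g x"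
    using unit_lborel_AE_interior by eventually_elim (use nn in auto)
  have "ennreal (integral\<^sup>L unit_lborel g) = (\<integral>\<^sup>+x. ennreal (g x) \<partial>unit_lborel)"
    by (rule nn_integral_eq_integral[OF int AE_nn, symmetric])
  also have "\<dots> = emeasure \<mu> (space \<mu>)"
    unfolding \<mu>(2) using gm sets.top[of unit_lborel]
    by (subst emeasure_density) (auto intro!: nn_integral_cong)
  also have "\<dots> = 1" using \<mu>(1) by (rule prob_space.emeasure_space_1)
  finally have mass: "integral\<^sup>L unit_lborel g = 1" by (simp add: ennreal_eq_1)
  show g1: "integral\<^sup>L uniform g' = 1"
    using integral_unit_lborel(1)[OF gm] mass by (simp add: g'_def)
  have g'm: "g' \<in> borel_measurable borel" unfolding g'_def by (rule integral_unit_lborel(2)[OF gm])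
  have g'_eq: "g' x = g x" if "0 < x" "x < 1" for x using that by (simp add: g'_def)
  have un: "unit_nonneg g'" using nn by (auto simp: unit_nonneg_def g'_eq)
  have de: "decreasing g'"
    unfolding decreasing_def
  proof (intro allI impI)
    fix x y :: real assume xy: "0 < x" "x \<le> y" "y < 1"
    have "antimono_on {0<..1} g" using g by (simp add: C_star_def)
    then have "g y \<le> g x" using xy by (auto simp: monotone_on_def)
    then show "g' y \<le> g' x" using xy by (simp add: g'_eq)
  qed
  have wi: "weighted_inc (1 + \<beta>) 1 g'"
    unfolding weighted_inc_def
  proof (intro allI impI)
    fix x y :: real assume xy: "0 < x" "x \<le> y" "y < 1"
    have "mono_on {0<..1} (\<lambda>x. x powr (\<beta> + 1) * g x)" using g by (simp add: C_star_def)
    then have "x powr (\<beta> + 1) * g x \<le> y powr (\<beta> + 1) * g y" using xy by (auto simp: monotone_on_def)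
    then show "x powr (1 + \<beta>) * g' x \<le> y powr (1 + \<beta>) * g' y" using xy by (simp add: g'_eq add.commute)
  qed
  show "density_cone (1 + \<beta>) g'" using un de wi by (simp add: density_cone_def)
  have "g' x \<le> 3 * x powr - \<beta>" if x: "0 < x" "x < 1" for x
  proof -
    have "\<forall>x\<in>{0<..1}. g x \<le> 2 powr \<beta> * (2 + \<beta>) * x powr (- \<beta>) * (\<integral>y. g y \<partial>unit_lborel)"
      using g by (simp add: C_star_def)
    then have "g x \<le> 2 powr \<beta> * (2 + \<beta>) * x powr (- \<beta>)" using x mass by auto
    also have "\<dots> \<le> 3 * x powr - \<beta>"
      using C_star_constant[of \<beta>] \<beta>_pos \<beta>_less by (intro mult_right_mono) auto
    finally show ?thesis using x by (simp add: g'_eq)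
  qed
  then show "tame g'" using g'm un de g1 by (simp add: tame_def)
  fix \<phi> :: "real \<Rightarrow> real" assume \<phi>: "\<phi> \<in> borel_measurable borel"
  have \<phi>m: "\<phi> \<in> borel_measurable unit_lborel"
    unfolding unit_lborel_def by (rule measurable_restrict_space1) (use \<phi> in simp)
  have "integral\<^sup>L \<mu> \<phi> = (\<integral>x. g x * \<phi> x \<partial>unit_lborel)"
    unfolding \<mu>(2) by (subst integral_density) (use gm \<phi>m AE_nn in auto)
  also have "\<dots> = (\<integral>x. indicator {0<..<1} x * (g x * \<phi> x) \<partial>uniform)"
    using gm \<phi>m by (intro integral_unit_lborel(1)) auto
  also have "\<dots> = (\<integral>x. g' x * \<phi> x \<partial>uniform)" by (simp add: g'_def mult.assoc)
  also have "\<dots> = integral\<^sup>L (density uniform (\<lambda>x. ennreal (g' x))) \<phi>"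
    using borel_measurable_uniform[OF g'm] borel_measurable_uniform[OF \<phi>] un
    by (subst integral_density) (auto intro!: AE_I2 simp: unit_nonneg_def)
  finally show "integral\<^sup>L \<mu> \<phi> = integral\<^sup>L (density uniform (\<lambda>x. ennreal (g' x))) \<phi>" .
qed

theorem theorem2p2:
  fixes \<beta> :: real and \<alpha> :: "nat \<Rightarrow> real" and f g :: "real \<Rightarrow> real"
    and \<mu> :: "real measure" and P :: "'b measure" and Z :: "'b \<Rightarrow> real"
  assumes "0 < \<beta>" and "\<beta> < 1/3"
    and "admissible \<beta> \<alpha>"
    and "prob_space P"
    and "distributed P lborel Z (\<lambda>x. ennreal (std_normal_density x))"
    and "prob_space \<mu>"
    and "\<mu> = density unit_lborel (\<lambda>x. ennreal (g x))"
    and "g \<in> C_star \<beta>"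
    and "\<exists>L. L-lipschitz_on {0..1} f"
  shows "\<exists>C>0. \<forall>N::nat. N \<ge> 2 \<and> birkhoff_sigma \<mu> \<alpha> f N > 0 \<longrightarrow>
    wasserstein_dist \<mu> (birkhoff_W \<mu> \<alpha> f N) P (\<lambda>\<omega>. birkhoff_sigma \<mu> \<alpha> f N * Z \<omega>)
      \<le> ereal (C * max 1 (birkhoff_sigma \<mu> \<alpha> f N powi (-2))
               * real N powr (\<beta> - 1/2) * ln (real N) powr (1 / \<beta>))"
proof -
  interpret subcritical \<beta> by standard (use assms(1,2) in auto)
  define g' where "g' = (\<lambda>x. indicator {0<..<1} x * g x)"
  note dens = C_star_density(1-3)[OF assms(6-8), folded g'_def]
  interpret subcritical_system \<beta> \<alpha> g'
    by standard (use assms(3) dens in auto)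
  obtain L0 where L0: "L0-lipschitz_on {0..1} f" using assms(9) by blast
  define L where "L = max 1 L0"
  \<comment> \<open>The observable is Lipschitz only on \<open>[0, 1]\<close>. Precomposing with the
    retraction onto this interval extends it to the line with the same constant and bounds its
    oscillation, without changing it along orbits.\<close>
  define clamp :: "real \<Rightarrow> real" where "clamp x = max 0 (min 1 x)" for x
  define f' where "f' x = f (clamp x)" for x
  have cl: "clamp x \<in> {0..1}" "\<bar>clamp x - clamp y\<bar> \<le> \<bar>x - y\<bar>" "\<bar>clamp x - clamp y\<bar> \<le> 1" for x y
    by (auto simp: clamp_def)
  have lip: "\<bar>f' x - f' y\<bar> \<le> L * \<bar>clamp x - clamp y\<bar>" for x y
  proof -
    have "\<bar>f' x - f' y\<bar> \<le> L0 * \<bar>clamp x - clamp y\<bar>"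
      using lipschitz_onD[OF L0 cl(1) cl(1)] by (simp add: f'_def dist_real_def)
    also have "\<dots> \<le> L * \<bar>clamp x - clamp y\<bar>" by (intro mult_right_mono) (auto simp: L_def)
    finally show ?thesis .
  qed
  have L1: "1 \<le> L" by (simp add: L_def)
  obtain C where C: "1 \<le> C" "\<And>\<alpha> j. admissible \<beta> \<alpha> \<Longrightarrow> loss_bound \<alpha> j (C * rate j)"
    by (rule memory_loss_uniform) (rule that)
  interpret observable \<beta> \<alpha> g' f' L "\<lambda>j. C * rate j"
  proof
    show "\<bar>f' x - f' y\<bar> \<le> L * \<bar>x - y\<bar>" for x y
      using lip[of x y] mult_left_mono[OF cl(2)[of x y], of L] L1 by linarith
    show "\<bar>f' x - f' y\<bar> \<le> L" for x y
      using lip[of x y] mult_left_mono[OF cl(3)[of x y], of L] L1 by linarith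
    show "loss_bound (shift m \<alpha>) j (C * rate j)" for m j
      by (rule C(2)[OF admissible_shift[OF assms(3)]])
    show "0 \<le> C * rate j" for j using C(1) rate_nonneg[of j] by simp
  qed (rule L1)
  have C0: "0 \<le> C" using C(1) by simp
  obtain K where K: "0 < K"
    "\<And>N s h. 2 \<le> N \<Longrightarrow> 0 < s \<Longrightarrow> s\<^sup>2 = (\<integral>x. (total N x)\<^sup>2 \<partial>\<nu>) \<Longrightarrow>
      \<forall>x y. \<bar>h x - h y\<bar> \<le> \<bar>x - y\<bar> \<Longrightarrow>
      \<bar>(\<integral>x. h (total N x) \<partial>\<nu>) - (LBINT z. std_normal_density z * h (s * z))\<bar>
        \<le> K * max 1 (real N / s\<^sup>2) * gap_scale N"
    by (rule normal_approximation[OF C0 order_refl]) (rule that)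
  have \<mu>_int: "integral\<^sup>L \<mu> \<phi> = integral\<^sup>L \<nu> \<phi>" if "\<phi> \<in> borel_measurable borel" for \<phi> :: "real \<Rightarrow> real"
    unfolding \<nu>_def unfolding g'_def by (rule C_star_density(4)[OF assms(6-8) that])
  have space_\<mu>: "space \<mu> = {0..1}"
    unfolding assms(7) by (simp add: unit_lborel_def space_restrict_space)
  have f_eq: "f (intermittent_iter \<alpha> i x) = f' (intermittent_iter \<alpha> i x)" if "x \<in> {0..1}" for i x
    using intermittent_iter_unit[OF assms(3), of x i] that by (simp add: f'_def clamp_def)
  have W_eq: "birkhoff_W \<mu> \<alpha> f N x = total N x / sqrt (real N)" if x: "x \<in> {0..1}" for N x
  proof -
    have "(\<integral>y. f (intermittent_iter \<alpha> i y) \<partial>\<mu>) = (\<integral>y. f' (intermittent_iter \<alpha> i y) \<partial>\<nu>)" for i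
    proof -
      have "(\<integral>y. f (intermittent_iter \<alpha> i y) \<partial>\<mu>) = (\<integral>y. f' (intermittent_iter \<alpha> i y) \<partial>\<mu>)"
        by (rule Bochner_Integration.integral_cong[OF refl]) (simp add: space_\<mu> f_eq)
      also have "\<dots> = (\<integral>y. f' (intermittent_iter \<alpha> i y) \<partial>\<nu>)" by (rule \<mu>_int) measurable
      finally show ?thesis .
    qed
    then show ?thesis
      using f_eq[OF x] by (simp add: birkhoff_W_def total_def \<zeta>_def centered_def)
  qed
  show ?thesis
  proof (intro exI[of _ K] conjI allI impI K(1))
    fix N :: nat
    define \<sigma> where "\<sigma> = birkhoff_sigma \<mu> \<alpha> f N"
    assume "N \<ge> 2 \<and> birkhoff_sigma \<mu> \<alpha> f N > 0"
    then have N: "2 \<le> N" and \<sigma>: "0 < \<sigma>" by (auto simp: \<sigma>_def)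
    define r where "r = sqrt (real N)"
    have r: "0 < r" "r\<^sup>2 = real N" using N by (auto simp: r_def)
    define s where "s = r * \<sigma>"
    have s: "0 < s" using r \<sigma> by (simp add: s_def)
    have "(\<integral>x. (birkhoff_W \<mu> \<alpha> f N x)\<^sup>2 \<partial>\<mu>) = (\<integral>x. (total N x)\<^sup>2 / real N \<partial>\<mu>)"
      by (rule Bochner_Integration.integral_cong[OF refl]) (use N in \<open>simp add: space_\<mu> W_eq power_divide\<close>)
    also have "\<dots> = (\<integral>x. (total N x)\<^sup>2 / real N \<partial>\<nu>)" by (rule \<mu>_int) measurable
    finally have W2: "(\<integral>x. (birkhoff_W \<mu> \<alpha> f N x)\<^sup>2 \<partial>\<mu>) = (\<integral>x. (total N x)\<^sup>2 \<partial>\<nu>) / real N" by simp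
    have "0 \<le> (\<integral>x. (birkhoff_W \<mu> \<alpha> f N x)\<^sup>2 \<partial>\<mu>)" by (intro Bochner_Integration.integral_nonneg) auto
    then have "\<sigma>\<^sup>2 = (\<integral>x. (total N x)\<^sup>2 \<partial>\<nu>) / real N" unfolding \<sigma>_def birkhoff_sigma_def W2 by simp
    then have V: "s\<^sup>2 = (\<integral>x. (total N x)\<^sup>2 \<partial>\<nu>)" using N r by (simp add: s_def power_mult_distrib)
    have M: "real N / s\<^sup>2 = \<sigma> powi (-2)"
      using r N \<sigma> by (simp add: s_def power_mult_distrib power_int_minus divide_inverse)
    show "wasserstein_dist \<mu> (birkhoff_W \<mu> \<alpha> f N) P (\<lambda>\<omega>. birkhoff_sigma \<mu> \<alpha> f N * Z \<omega>)
      \<le> ereal (K * max 1 (birkhoff_sigma \<mu> \<alpha> f N powi (-2))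
               * real N powr (\<beta> - 1/2) * ln (real N) powr (1 / \<beta>))"
      unfolding wasserstein_dist_def \<sigma>_def[symmetric]
    proof (rule SUP_least)
      fix h :: "real \<Rightarrow> real" assume "h \<in> {h. 1-lipschitz_on UNIV h}"
      then have h1: "1-lipschitz_on UNIV h" by simp
      have h: "\<bar>h x - h y\<bar> \<le> \<bar>x - y\<bar>" for x y using lipschitz_onD[OF h1, of x y] by (simp add: dist_real_def)
      have hm [measurable]: "h \<in> borel_measurable borel"
        using h1 by (intro borel_measurable_continuous_onI lipschitz_on_continuous_on)
      \<comment> \<open>This test function is again 1-Lipschitz and turns \<open>h\<close> of the
        normalized sum into \<open>k\<close> of the unnormalized one, divided by \<open>r\<close>;
        this division by \<open>sqrt N\<close> gives the exponent
        \<open>\<beta> - 1/2\<close>.\<close>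
      define k where "k x = r * h (x / r)" for x
      have k: "\<forall>x y. \<bar>k x - k y\<bar> \<le> \<bar>x - y\<bar>"
      proof (intro allI)
        fix x y
        have "\<bar>k x - k y\<bar> = r * \<bar>h (x / r) - h (y / r)\<bar>"
          using r by (simp add: k_def right_diff_distrib[symmetric] abs_mult)
        also have "\<dots> \<le> r * \<bar>x / r - y / r\<bar>" using r h by (intro mult_left_mono) auto
        also have "\<dots> = \<bar>x - y\<bar>" using r by (simp add: diff_divide_distrib[symmetric] abs_divide)
        finally show "\<bar>k x - k y\<bar> \<le> \<bar>x - y\<bar>" .
      qed
      have "(\<integral>x. h (birkhoff_W \<mu> \<alpha> f N x) \<partial>\<mu>) = (\<integral>x. k (total N x) / r \<partial>\<mu>)"
        by (rule Bochner_Integration.integral_cong[OF refl]) (use r in \<open>simp add: space_\<mu> W_eq k_def r_def\<close>)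
      also have "\<dots> = (\<integral>x. k (total N x) / r \<partial>\<nu>)" by (rule \<mu>_int) (unfold k_def, measurable)
      finally have E1: "(\<integral>x. h (birkhoff_W \<mu> \<alpha> f N x) \<partial>\<mu>) = (\<integral>x. k (total N x) \<partial>\<nu>) / r" by simp
      have "(\<integral>\<omega>. h (\<sigma> * Z \<omega>) \<partial>P) = (LBINT z. std_normal_density z * h (\<sigma> * z))"
        by (rule distributed_integral[OF assms(5), symmetric]) auto
      also have "\<dots> = (LBINT z. std_normal_density z * k (s * z) / r)"
        using r by (simp add: k_def s_def)
      finally have E2: "(\<integral>\<omega>. h (\<sigma> * Z \<omega>) \<partial>P) = (LBINT z. std_normal_density z * k (s * z)) / r" by simp
      have "\<bar>(\<integral>x. h (birkhoff_W \<mu> \<alpha> f N x) \<partial>\<mu>) - (\<integral>\<omega>. h (\<sigma> * Z \<omega>) \<partial>P)\<bar>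
          = \<bar>(\<integral>x. k (total N x) \<partial>\<nu>) - (LBINT z. std_normal_density z * k (s * z))\<bar> / r"
        unfolding E1 E2 using r by (simp add: diff_divide_distrib[symmetric] abs_divide)
      also have "\<dots> \<le> (K * max 1 (real N / s\<^sup>2) * gap_scale N) / r"
        using r by (intro divide_right_mono K(2)[OF N s V k]) auto
      also have "\<dots> = K * max 1 (\<sigma> powi (-2)) * real N powr (\<beta> - 1/2) * ln (real N) powr (1 / \<beta>)"
        unfolding M gap_scale_def r_def using N by (simp add: powr_diff powr_half_sqrt)
      finally show "ereal \<bar>(\<integral>x. h (birkhoff_W \<mu> \<alpha> f N x) \<partial>\<mu>) - (\<integral>\<omega>. h (\<sigma> * Z \<omega>) \<partial>P)\<bar>
        \<le> ereal (K * max 1 (\<sigma> powi (-2)) * real N powr (\<beta> - 1/2) * ln (real N) powr (1 / \<beta>))"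
        by simp
    qed
  qed
qed

end
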